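(* Let $K/K'/k$ be field extensions of finite type and let $W_\bullet$ be a graded linear series of $K/k$ that is generated over $k$ by its homogeneous elements of degree $1$. Assume that $W_1$ contains $1\in K$ and that the projective spectrum $P:=\mathrm{Proj}(W_\bullet)$ is a normal scheme. Let $X$ be any integral normal projective $k$-scheme whose field of rational functions is $k$-isomorphic to $k(W_\bullet\cap K'[T])$ (and identify $\mathrm{Rat}(X)$ with $k(W_\bullet\cap K'[T])$ via such an isomorphism). Then there exists a $\mathbb Q$-Weil divisor $D$ on $X$ such that $$W_n\cap K'\subset H^0(X,nD)\subset k(W_\bullet\cap K'[T])$$ for every sufficiently large positive integer $n$.
   Context: Let $K[T]=\bigoplus_{n\in\mathbb N}KT^n$ be the graded polynomial ring in one variable. A graded linear series of $K/k$ is a graded sub-$k$-algebra $V_\bullet=\bigoplus_{n\in\mathbb N}V_nT^n$ of $K[T]$ such that $V_0=k$ and $V_n$ is a finite dimensional $k$-vector subspace of $K$ for every $n\geq 1$. The field of rational functions $k(V_\bullet)$ is the subextension of $K/k$ generated over $k$ by all elements $f/g$, where $f,g$ are nonzero elements of $K$ for which there is $n\geq 1$ with $\{f,g\}\subset V_n$. The intersection $W_\bullet\cap K'[T]$ is the graded linear series $\bigoplus_n (W_n\cap K')T^n$. For an integral scheme $X$, $\mathrm{Rat}(X)$ is its field of rational functions and $X^{(1)}$ is the set of points whose local ring has Krull dimension $1$. For a projective normal integral $k$-scheme $X$, a $\mathbb Q$-Weil divisor is an element $D=\sum_{V\in X^{(1)}}n_VV$ of $\mathbb Q^{\oplus X^{(1)}}$;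 it is effective ($D\geq 0$) if all $n_V\geq 0$. For $\phi\in\mathrm{Rat}(X)^\times$, $(\phi)=\sum_{V\in X^{(1)}}\mathrm{ord}_V(\phi)V$, and $H^0(X,D):=\{\phi\in\mathrm{Rat}(X)^\times : D+(\phi)\geq 0\}\cup\{0\}$. *)

theory Defs
  imports
    "HOL-Analysis.Function_Topology"
    "HOL-Algebra.Algebra"
    "HOL-Algebra.Algebraic_Closure_Type"
    "HOL-Library.Extended_Nat"
begin

(* HOL-Algebra reserves X for the indeterminate of its list polynomials. *)
no_notation var (\<open>X\<index>\<close>)

text \<open>
  Fields are subfields (in the sense of HOL-Algebra) of a type of class field, and the graded
  polynomial ring is the type of univariate polynomials over it.  The abbreviation below turns
  such a type into a HOL-Algebra ring restricted to a given carrier.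
\<close>

abbreviation ring_on :: "'a::comm_ring_1 set \<Rightarrow> 'a ring" where
  "ring_on A \<equiv> ring_of_type_algebra \<lparr>carrier := A\<rparr>"

section \<open>Commutative algebra\<close>

definition fg_field_extension :: "'a::field set \<Rightarrow> 'a set \<Rightarrow> bool" where
  "fg_field_extension k K \<longleftrightarrow>
     subfield k ring_of_type_algebra \<and> subfield K ring_of_type_algebra \<and>
     (\<exists>S. finite S \<and> K = generate_field ring_of_type_algebra (k \<union> S))"

definition frac_field :: "'a::field set \<Rightarrow> 'a set" where
  "frac_field A = {a / b |a b. a \<in> A \<and> b \<in> A \<and> b \<noteq> 0}"

definition localization_at :: "'a::field set \<Rightarrow> 'a set \<Rightarrow> 'a set" where
  "localization_at A P = {a / b |a b. a \<in> A \<and> b \<in> A - P}"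

definition integral_over :: "'a::field set \<Rightarrow> 'a \<Rightarrow> bool" where
  "integral_over A z \<longleftrightarrow>
     (\<exists>p. lead_coeff p = 1 \<and> (\<forall>i. Polynomial.coeff p i \<in> A) \<and> poly p z = 0)"

definition integrally_closed :: "'a::field set \<Rightarrow> bool" where
  "integrally_closed A \<longleftrightarrow> (\<forall>z \<in> frac_field A. integral_over A z \<longrightarrow> z \<in> A)"

definition prime_chain :: "'a::comm_ring_1 set \<Rightarrow> nat \<Rightarrow> (nat \<Rightarrow> 'a set) \<Rightarrow> bool" where
  "prime_chain A n P \<longleftrightarrow> (\<forall>i\<le>n. primeideal (P i) (ring_on A)) \<and> (\<forall>i<n. P i \<subset> P (Suc i))"

definition krull_dim :: "'a::comm_ring_1 set \<Rightarrow> enat" where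
  "krull_dim A = Sup {enat n |n. \<exists>P. prime_chain A n P}"

definition uniformizer :: "'a::field set \<Rightarrow> 'a \<Rightarrow> bool" where
  "uniformizer A t \<longleftrightarrow> t \<in> A \<and> (*) t ` A = A - Units (ring_on A)"

text \<open>
  The normalized valuation of a discrete valuation ring \<open>A\<close>, for nonzero elements of its
  fraction field.  It is only used for the local rings at codimension one points of normal
  projective schemes, where uniformizers exist and the integer below is unique.
\<close>

definition dvr_ord :: "'a::field set \<Rightarrow> 'a \<Rightarrow> int" where
  "dvr_ord A \<phi> =
     (THE n. \<exists>t u. uniformizer A t \<and> u \<in> Units (ring_on A) \<and> \<phi> = u * t powi n)"

section \<open>Graded linear series\<close>

text \<open>Elements of \<open>K[T]\<close>; its degree \<open>n\<close> part consists of the \<open>monom a n\<close> with \<open>a \<in> K\<close>.\<close>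

definition polys_over :: "'a::field set \<Rightarrow> 'a poly set" where
  "polys_over K = {p. \<forall>n. Polynomial.coeff p n \<in> K}"

definition graded_piece :: "'a::field poly set \<Rightarrow> nat \<Rightarrow> 'a set" where
  "graded_piece V n = {a. Polynomial.monom a n \<in> V}"

definition homogeneous :: "'a::field poly set \<Rightarrow> bool" where
  "homogeneous V \<longleftrightarrow> (\<forall>p\<in>V. \<forall>n. Polynomial.monom (Polynomial.coeff p n) n \<in> V)"

definition graded_linear_series :: "'a::field set \<Rightarrow> 'a set \<Rightarrow> 'a poly set \<Rightarrow> bool" where
  "graded_linear_series K k V \<longleftrightarrow>
     V \<subseteq> polys_over K \<and> subring V ring_of_type_algebra \<and> homogeneous V \<and>
     graded_piece V 0 = k \<and>
     (\<forall>n\<ge>1. ring.finite_dimension ring_of_type_algebra k (graded_piece V n))"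

definition generated_in_degree_one :: "'a::field set \<Rightarrow> 'a poly set \<Rightarrow> bool" where
  "generated_in_degree_one k V \<longleftrightarrow>
     V = generate_ring ring_of_type_algebra
           ((\<lambda>c. Polynomial.monom c 0) ` k \<union> (\<lambda>a. Polynomial.monom a 1) ` graded_piece V 1)"

definition series_field :: "'a::field set \<Rightarrow> 'a poly set \<Rightarrow> 'a set" where
  "series_field k V =
     generate_field ring_of_type_algebra
       (k \<union> {f / g |f g n. n \<ge> 1 \<and> f \<in> graded_piece V n \<and> g \<in> graded_piece V n \<and>
                       f \<noteq> 0 \<and> g \<noteq> 0})"

section \<open>Integral schemes\<close>

text \<open>
  The structure sheaf of an integral scheme \<open>X\<close> embeds canonically into the constant sheaf with
  value \<open>Rat(X)\<close>: for a nonempty open \<open>U\<close>, the ring \<open>O(U)\<close> is a subring of \<open>Rat(X)\<close>, and the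
  restriction maps are inclusions.  An integral scheme is therefore given by its underlying
  space, its field of rational functions and the subrings \<open>O(U)\<close>.  The value of \<^term>\<open>sections\<close>
  at the empty set carries no information.
\<close>

record ('x, 'f) ratspace =
  space_of :: "'x topology"
  rat_field :: "'f set"
  sections :: "'x set \<Rightarrow> 'f set"

abbreviation points :: "('x, 'f) ratspace \<Rightarrow> 'x set" where
  "points X \<equiv> topspace (space_of X)"

abbreviation nonempty_open :: "('x, 'f) ratspace \<Rightarrow> 'x set \<Rightarrow> bool" where
  "nonempty_open X U \<equiv> openin (space_of X) U \<and> U \<noteq> {}"

text \<open>
  On an irreducible space any two nonempty open sets meet, so sections that agree on overlaps
  are one and the same element of \<open>Rat(X)\<close>; the sheaf axioms amount to the last condition.
\<close>

definition integral_ringed_space :: "('x, 'f::field) ratspace \<Rightarrow> bool" where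
  "integral_ringed_space X \<longleftrightarrow>
     points X \<noteq> {} \<and>
     (\<forall>U V. nonempty_open X U \<and> nonempty_open X V \<longrightarrow> U \<inter> V \<noteq> {}) \<and>
     subfield (rat_field X) ring_of_type_algebra \<and>
     (\<forall>U. nonempty_open X U \<longrightarrow>
        subring (sections X U) ring_of_type_algebra \<and> sections X U \<subseteq> rat_field X) \<and>
     (\<forall>\<U>. \<U> \<noteq> {} \<and> (\<forall>U\<in>\<U>. nonempty_open X U) \<longrightarrow>
        sections X (\<Union>\<U>) = (\<Inter>U\<in>\<U>. sections X U))"

text \<open>Since the restriction maps are inclusions, the colimit defining a stalk is a union.\<close>

definition stalk :: "('x, 'f) ratspace \<Rightarrow> 'x \<Rightarrow> 'f set" where
  "stalk X x = \<Union>{sections X U |U. openin (space_of X) U \<and> x \<in> U}"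

definition open_subspace :: "('x, 'f) ratspace \<Rightarrow> 'x set \<Rightarrow> ('x, 'f) ratspace" where
  "open_subspace X U = X \<lparr>space_of := subtopology (space_of X) U\<rparr>"

text \<open>Isomorphisms that are the identity on the common field of rational functions.\<close>

definition iso_over_rat_field ::
    "('x, 'f) ratspace \<Rightarrow> ('y, 'f) ratspace \<Rightarrow> ('x \<Rightarrow> 'y) \<Rightarrow> bool" where
  "iso_over_rat_field X Y h \<longleftrightarrow>
     rat_field X = rat_field Y \<and> homeomorphic_map (space_of X) (space_of Y) h \<and>
     (\<forall>U. nonempty_open X U \<longrightarrow> sections Y (h ` U) = sections X U)"

definition Spec :: "'f::field set \<Rightarrow> ('f set, 'f) ratspace" where
  "Spec A =
     \<lparr>space_of = topology_generated_by
        ((\<lambda>f. {P. primeideal P (ring_on A) \<and> f \<notin> P}) ` A),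
      rat_field = frac_field A,
      sections = (\<lambda>U. \<Inter>P\<in>U. localization_at A P)\<rparr>"

definition integral_scheme :: "('x, 'f::field) ratspace \<Rightarrow> bool" where
  "integral_scheme X \<longleftrightarrow>
     integral_ringed_space X \<and>
     (\<forall>x\<in>points X. \<exists>U h. openin (space_of X) U \<and> x \<in> U \<and>
        iso_over_rat_field (open_subspace X U) (Spec (sections X U)) h)"

definition normal_scheme :: "('x, 'f::field) ratspace \<Rightarrow> bool" where
  "normal_scheme X \<longleftrightarrow> (\<forall>x\<in>points X. integrally_closed (stalk X x))"

section \<open>Proj and projective schemes\<close>

definition proj_points :: "'f::field poly set \<Rightarrow> 'f poly set set" where
  "proj_points S =
     {P. primeideal P (ring_on S) \<and> homogeneous P \<and>
         \<not> {p \<in> S. Polynomial.coeff p 0 = 0} \<subseteq> P}"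

text \<open>
  The degree zero part of the localization of \<open>S\<close> at the homogeneous elements outside \<open>P\<close>,
  inside the field of coefficients: \<open>(a T^n) / (b T^n) = a / b\<close>.
\<close>

definition homogeneous_localization :: "'f::field poly set \<Rightarrow> 'f poly set \<Rightarrow> 'f set" where
  "homogeneous_localization S P =
     {a / b |a b n. Polynomial.monom a n \<in> S \<and> Polynomial.monom b n \<in> S - P}"

definition Proj :: "'f::field poly set \<Rightarrow> ('f poly set, 'f) ratspace" where
  "Proj S =
     \<lparr>space_of = topology_generated_by
        {{P \<in> proj_points S. Polynomial.monom a n \<notin> P} |a n. n \<ge> 1 \<and> Polynomial.monom a n \<in> S},
      rat_field = homogeneous_localization S {0},
      sections = (\<lambda>U. \<Inter>P\<in>U. homogeneous_localization S P)\<rparr>"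

text \<open>
  A \<open>k\<close>-scheme is projective iff it is isomorphic to \<open>Proj S\<close> with \<open>S\<close> graded, \<open>S\<^sub>0 = k\<close> and \<open>S\<close>
  generated by a finite dimensional \<open>S\<^sub>1\<close>.  If it is integral, \<open>S\<close> may be taken to be a domain
  (the homogeneous coordinate ring), and after division of \<open>S\<^sub>n\<close> by the \<open>n\<close>-th power of a nonzero
  element of \<open>S\<^sub>1\<close> it is a graded subring of \<open>Rat(X)[T]\<close>.
\<close>

definition projective_over :: "'f::field set \<Rightarrow> ('x, 'f) ratspace \<Rightarrow> bool" where
  "projective_over k X \<longleftrightarrow>
     (\<exists>S h. graded_linear_series (rat_field X) k S \<and> generated_in_degree_one k S \<and>
        iso_over_rat_field X (Proj S) h)"

section \<open>Weil divisors with rational coefficients\<close>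

definition codim1_points :: "('x, 'f::field) ratspace \<Rightarrow> 'x set" where
  "codim1_points X = {x \<in> points X. krull_dim (stalk X x) = 1}"

definition Q_Weil_divisors :: "('x, 'f::field) ratspace \<Rightarrow> ('x \<Rightarrow> rat) set" where
  "Q_Weil_divisors X = {D. finite {x. D x \<noteq> 0} \<and> {x. D x \<noteq> 0} \<subseteq> codim1_points X}"

definition effective :: "('x, 'f::field) ratspace \<Rightarrow> ('x \<Rightarrow> rat) \<Rightarrow> bool" where
  "effective X D \<longleftrightarrow> (\<forall>x\<in>codim1_points X. D x \<ge> 0)"

definition principal_divisor :: "('x, 'f::field) ratspace \<Rightarrow> 'f \<Rightarrow> 'x \<Rightarrow> rat" where
  "principal_divisor X \<phi> x =
     (if x \<in> codim1_points X then of_int (dvr_ord (stalk X x) \<phi>) else 0)"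

definition H0 :: "('x, 'f::field) ratspace \<Rightarrow> ('x \<Rightarrow> rat) \<Rightarrow> 'f set" where
  "H0 X D =
     {\<phi> \<in> rat_field X - {0}. effective X (\<lambda>x. D x + principal_divisor X \<phi> x)} \<union> {0}"

end

theory Submission
  imports Defs
begin

text \<open>
  The subring \<open>W \<inter> K'[T]\<close> need not be finitely generated, so the poles of its elements cannot be read off from
  generators.  What saves the argument is that \<open>W\<close> is finitely generated: the poles of
  \<open>W\<^sub>n \<inter> K'\<close> grow at most linearly in \<open>n\<close> with a slope that vanishes at almost all points.

  Let \<open>E = k(W \<inter> K'[T])\<close>.  Because \<open>1 \<in> W\<^sub>1\<close>, the space \<open>W\<^sub>n \<inter> K'\<close> lies in \<open>E\<close> for \<open>n \<ge> 1\<close>, and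
  every \<open>\<phi>\<close> in \<open>H\<^sup>0(X, nD)\<close> lies in \<open>E\<close> by definition.  It remains to find natural numbers \<open>c(x)\<close>, almost all
  of them zero, such that \<open>ord\<^sub>x(f) \<ge> - n c(x)\<close> for all nonzero \<open>f \<in> W\<^sub>n \<inter> K'\<close> and all \<open>x\<close> of
  codimension one; then \<open>D\<close> is the sum of the \<open>c(x) x\<close>.

  If each \<open>ord\<^sub>x\<close> extended to a discrete valuation of \<open>E(W\<^sub>1)\<close>, the largest pole of a basis of \<open>W\<^sub>1\<close> would
  serve as \<open>c(x)\<close>, since \<open>W\<^sub>n\<close> is spanned over \<open>k\<close> by products of \<open>n\<close> basis elements.  A weaker kind of extension is
  enough and makes it possible to treat all \<open>x\<close> at the same time.  Basis elements transcendental over \<open>E\<close> are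
  adjoined one by one with the Gauss extensions of all \<open>ord\<^sub>x\<close>; only finitely many \<open>x\<close> matter for each
  nonzero element of the larger field \<open>F\<close> too.  The remaining basis elements are algebraic over \<open>F\<close> and
  act on a finite dimensional \<open>F\<close>-space with a basis containing \<open>1\<close>.  The elements whose coordinates have value at least
  \<open>m\<close> form lattices \<open>L m\<close>, and the orders of the poles at \<open>x\<close> of the finitely many matrix entries of this
  action add up to a suitable \<open>c(x)\<close>.  Then \<open>f = f 1\<close> lies in \<open>L (- n c(x))\<close>, and its coordinate at \<open>1\<close> is \<open>f\<close> itself.  This
  is the content of \<open>filtration_exists\<close> and \<open>valuations_linearly_bounded\<close>.

  The geometry enters through two facts on \<open>X\<close>: the local ring at a point of codimension one is a discrete
  valuation ring, and a nonzero rational function has finitely many zeros and poles.  Both follow from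
  an isomorphism of \<open>X\<close> with \<open>Proj S\<close>, which is covered by finitely many affine charts with
  noetherian coordinate rings (\<open>noetherian_chart\<close>, by Hilbert's basis theorem).  Normality and dimension one give a
  uniformizer (\<open>normal_dim1_uniformizer_exists\<close>).  The zeros of an element \<open>a\<close> of a chart are height one
  primes containing \<open>a\<close>, and such primes are among the finitely many minimal primes over \<open>a\<close>
  (\<open>noetherian_minimal_primes_finite\<close>).
\<close>

section \<open>Subrings, ideals and primes inside a field\<close>

lemma ring_of_type_algebra_sel [simp]:
  "carrier ring_of_type_algebra = UNIV"
  "x \<otimes>\<^bsub>ring_of_type_algebra\<^esub> y = x * y"
  "x \<oplus>\<^bsub>ring_of_type_algebra\<^esub> y = x + y"
  "\<one>\<^bsub>ring_of_type_algebra\<^esub> = 1"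
  "\<zero>\<^bsub>ring_of_type_algebra\<^esub> = 0"
  by (simp_all add: ring_of_type_algebra_def)

lemma a_inv_ring_of_type_algebra [simp]:
  fixes x :: "'a::comm_ring_1"
  shows "\<ominus>\<^bsub>ring_of_type_algebra\<^esub> x = - x"
proof -
  interpret ring "ring_of_type_algebra :: 'a ring"
    by (rule ring_from_type_algebra)
  show ?thesis
    by (rule minus_equality) auto
qed

lemma m_inv_ring_of_type_algebra [simp]:
  fixes x :: "'a::field"
  assumes "x \<noteq> 0"
  shows "inv\<^bsub>ring_of_type_algebra\<^esub> x = inverse x"
proof -
  interpret field "ring_of_type_algebra :: 'a ring"
    by (rule field_from_type_algebra)
  show ?thesis
    using assms by (intro comm_inv_char) auto
qed

abbreviation is_subring :: "'a::comm_ring_1 set \<Rightarrow> bool" where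
  "is_subring A \<equiv> subring A ring_of_type_algebra"

abbreviation is_subfield :: "'a::field set \<Rightarrow> bool" where
  "is_subfield F \<equiv> subfield F ring_of_type_algebra"

lemma is_subringI:
  fixes A :: "'a::comm_ring_1 set"
  assumes "1 \<in> A" "\<And>x. x \<in> A \<Longrightarrow> - x \<in> A"
    and "\<And>x y. x \<in> A \<Longrightarrow> y \<in> A \<Longrightarrow> x * y \<in> A" "\<And>x y. x \<in> A \<Longrightarrow> y \<in> A \<Longrightarrow> x + y \<in> A"
  shows "is_subring A"
  using assms by (intro ring.subringI ring_from_type_algebra) auto

lemma is_subringD:
  fixes A :: "'a::comm_ring_1 set"
  assumes "is_subring A"
  shows "0 \<in> A" "1 \<in> A" "x \<in> A \<Longrightarrow> - x \<in> A"
    and "x \<in> A \<Longrightarrow> y \<in> A \<Longrightarrow> x + y \<in> A" "x \<in> A \<Longrightarrow> y \<in> A \<Longrightarrow> x - y \<in> A"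
    and "x \<in> A \<Longrightarrow> y \<in> A \<Longrightarrow> x * y \<in> A" "x \<in> A \<Longrightarrow> x ^ n \<in> A"
proof -
  note c = subringE[OF assms, simplified]
  show *: "0 \<in> A" "1 \<in> A" "x \<in> A \<Longrightarrow> - x \<in> A"
    "x \<in> A \<Longrightarrow> y \<in> A \<Longrightarrow> x + y \<in> A" "x \<in> A \<Longrightarrow> y \<in> A \<Longrightarrow> x * y \<in> A" for x y
    using c by auto
  show "x \<in> A \<Longrightarrow> y \<in> A \<Longrightarrow> x - y \<in> A"
    using *(4)[of x "- y"] *(3)[of y] by simp
  show "x \<in> A \<Longrightarrow> x ^ n \<in> A"
    by (induction n) (use * in auto)
qed

lemma is_subring_sum:
  assumes "is_subring A" "\<And>i. i \<in> I \<Longrightarrow> f i \<in> A"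
  shows "sum f I \<in> A"
  using assms(2) by (induction I rule: infinite_finite_induct) (auto simp: is_subringD[OF assms(1)])

lemma is_subfieldD:
  assumes "is_subfield F"
  shows "is_subring F" "x \<in> F \<Longrightarrow> inverse x \<in> F" "x \<in> F \<Longrightarrow> y \<in> F \<Longrightarrow> x / y \<in> F"
proof -
  show F: "is_subring F"
    by (rule subfieldE(1)[OF assms])
  show *: "x \<in> F \<Longrightarrow> inverse x \<in> F" for x
  proof (cases "x = 0")
    case False
    assume "x \<in> F"
    then have "inv\<^bsub>ring_of_type_algebra\<^esub> x \<in> F - {0}"
      using ring.subfield_m_inv(1)[OF ring_from_type_algebra assms] False by simp
    then show ?thesis
      using False by simp
  qed (use is_subringD[OF F] in auto)
  show "x \<in> F \<Longrightarrow> y \<in> F \<Longrightarrow> x / y \<in> F"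
    using *[of y] is_subringD(6)[OF F] by (simp add: divide_inverse)
qed

lemma is_subfieldI:
  fixes F :: "'a::field set"
  assumes "is_subring F" "\<And>x. x \<in> F \<Longrightarrow> x \<noteq> 0 \<Longrightarrow> inverse x \<in> F"
  shows "is_subfield F"
  using assms by (intro field.subfieldI' field_from_type_algebra) auto

lemma ring_ring_on:
  fixes A :: "'a::comm_ring_1 set"
  assumes "is_subring A"
  shows "ring (ring_on A)"
  using ring.subring_is_ring[OF ring_from_type_algebra assms] by simp

lemma cring_ring_on:
  fixes A :: "'a::comm_ring_1 set"
  assumes "is_subring A"
  shows "cring (ring_on A)"
  by (rule cring.intro[OF ring_ring_on[OF assms]], unfold_locales)
     (auto simp: is_subringD[OF assms] mult.assoc mult.commute)

lemma ideal_ring_on_iff: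
  fixes A :: "'a::comm_ring_1 set"
  assumes A: "is_subring A"
  shows "ideal I (ring_on A) \<longleftrightarrow>
    I \<subseteq> A \<and> 0 \<in> I \<and> (\<forall>x\<in>I. \<forall>y\<in>I. x + y \<in> I) \<and> (\<forall>r\<in>A. \<forall>x\<in>I. r * x \<in> I)"
    (is "_ \<longleftrightarrow> ?rhs")
proof
  assume "ideal I (ring_on A)"
  then interpret ideal I "ring_on A" .
  show ?rhs
    using I_l_closed a_subset additive_subgroup.a_closed[OF is_additive_subgroup]
      additive_subgroup.zero_closed[OF is_additive_subgroup]
    by auto
next
  assume I: ?rhs
  interpret ring "ring_on A"
    by (rule ring_ring_on[OF A])
  have neg: "\<ominus>\<^bsub>ring_on A\<^esub> x = - x" if "x \<in> A" for x
    using that by (intro minus_equality) (auto simp: is_subringD[OF A])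
  have "- x \<in> I" if "x \<in> I" for x
    using I that is_subringD(2,3)[OF A] by (metis mult_minus1)
  then have "subgroup I (add_monoid (ring_on A))"
    using I neg by (intro add.subgroupI) (auto simp: subset_iff)
  moreover have "r * x \<in> I" "x * r \<in> I" if "x \<in> I" "r \<in> A" for x r
    using I that by (simp_all add: mult.commute[of x r])
  ultimately show "ideal I (ring_on A)"
    by (intro idealI ring_ring_on[OF A]) auto
qed

lemma idealD:
  fixes A :: "'a::comm_ring_1 set"
  assumes "ideal I (ring_on A)" "is_subring A"
  shows "x \<in> I \<Longrightarrow> x \<in> A" "0 \<in> I" "x \<in> I \<Longrightarrow> y \<in> I \<Longrightarrow> x + y \<in> I"
    and "r \<in> A \<Longrightarrow> x \<in> I \<Longrightarrow> r * x \<in> I" "x \<in> I \<Longrightarrow> - x \<in> I"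
    and "x \<in> I \<Longrightarrow> y \<in> I \<Longrightarrow> x - y \<in> I"
proof -
  have I: "I \<subseteq> A" "0 \<in> I" "\<forall>x\<in>I. \<forall>y\<in>I. x + y \<in> I" "\<forall>r\<in>A. \<forall>x\<in>I. r * x \<in> I"
    using assms ideal_ring_on_iff by metis+
  then show "x \<in> I \<Longrightarrow> x \<in> A" "0 \<in> I" "x \<in> I \<Longrightarrow> y \<in> I \<Longrightarrow> x + y \<in> I"
    "r \<in> A \<Longrightarrow> x \<in> I \<Longrightarrow> r * x \<in> I"
    by auto
  show neg: "x \<in> I \<Longrightarrow> - x \<in> I" for x
    using I(4) is_subringD(2,3)[OF assms(2)] by (metis mult_minus1)
  show "x \<in> I \<Longrightarrow> y \<in> I \<Longrightarrow> x - y \<in> I"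
    using I(3) neg[of y] by (metis diff_conv_add_uminus)
qed

lemma idealI':
  fixes A :: "'a::comm_ring_1 set"
  assumes "is_subring A" "I \<subseteq> A" "0 \<in> I" "\<And>x y. x \<in> I \<Longrightarrow> y \<in> I \<Longrightarrow> x + y \<in> I"
    and "\<And>r x. r \<in> A \<Longrightarrow> x \<in> I \<Longrightarrow> r * x \<in> I"
  shows "ideal I (ring_on A)"
  using assms ideal_ring_on_iff by metis

lemma primeideal_ring_on_iff:
  fixes A :: "'a::comm_ring_1 set"
  assumes A: "is_subring A"
  shows "primeideal P (ring_on A) \<longleftrightarrow>
    ideal P (ring_on A) \<and> 1 \<notin> P \<and> (\<forall>x\<in>A. \<forall>y\<in>A. x * y \<in> P \<longrightarrow> x \<in> P \<or> y \<in> P)"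
proof
  assume "primeideal P (ring_on A)"
  then interpret primeideal P "ring_on A" .
  have "ideal P (ring_on A)"
    by unfold_locales
  moreover have "1 \<notin> P"
  proof
    assume "1 \<in> P"
    then have "x \<in> P" if "x \<in> A" for x
      using idealD(4)[OF is_ideal A that, of 1] by simp
    then show False
      using I_notcarr idealD(1)[OF is_ideal A] by auto
  qed
  ultimately show "ideal P (ring_on A) \<and> 1 \<notin> P \<and>
      (\<forall>x\<in>A. \<forall>y\<in>A. x * y \<in> P \<longrightarrow> x \<in> P \<or> y \<in> P)"
    using I_prime by auto
next
  assume "ideal P (ring_on A) \<and> 1 \<notin> P \<and>
    (\<forall>x\<in>A. \<forall>y\<in>A. x * y \<in> P \<longrightarrow> x \<in> P \<or> y \<in> P)"
  then show "primeideal P (ring_on A)"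
    using is_subringD(2)[OF A] by (intro primeidealI cring_ring_on[OF A]) auto
qed

lemma primeidealD:
  fixes A :: "'a::comm_ring_1 set"
  assumes "primeideal P (ring_on A)" "is_subring A"
  shows "ideal P (ring_on A)" "1 \<notin> P"
    and "x \<in> A \<Longrightarrow> y \<in> A \<Longrightarrow> x * y \<in> P \<Longrightarrow> x \<in> P \<or> y \<in> P"
    and "x \<in> A - P \<Longrightarrow> y \<in> A - P \<Longrightarrow> x * y \<in> A - P"
  using primeideal_ring_on_iff[OF assms(2)] assms is_subringD(6)[OF assms(2)] by auto

lemma Units_ring_on:
  fixes A :: "'a::field set"
  shows "Units (ring_on A) = {u \<in> A. u \<noteq> 0 \<and> inverse u \<in> A}"
proof (intro Set.set_eqI iffI)
  fix u assume "u \<in> Units (ring_on A)"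
  then obtain v where v: "u \<in> A" "v \<in> A" "u * v = 1"
    by (auto simp: Units_def)
  moreover have "v = inverse u" "u \<noteq> 0"
    using inverse_unique[OF v(3)] v(3) by auto
  ultimately show "u \<in> {u \<in> A. u \<noteq> 0 \<and> inverse u \<in> A}"
    by simp
next
  fix u assume "u \<in> {u \<in> A. u \<noteq> 0 \<and> inverse u \<in> A}"
  then show "u \<in> Units (ring_on A)"
    by (auto simp: Units_def intro!: bexI[of _ "inverse u"])
qed

lemma is_subring_polys_over:
  assumes "is_subring A"
  shows "is_subring (polys_over A)"
  using assms
  by (intro is_subringI)
     (auto simp: polys_over_def coeff_mult is_subringD intro!: is_subring_sum)

lemma poly_polys_over_closed:
  assumes "is_subring B" "A \<subseteq> B" "w \<in> B" "p \<in> polys_over A"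
  shows "poly p w \<in> B"
  using assms unfolding poly_altdef polys_over_def
  by (intro is_subring_sum) (auto intro!: is_subringD)

section \<open>Noetherian subrings\<close>

text \<open>
  The maximal condition is the form of the ascending chain condition that all arguments below use:
  a counterexample is chosen as a maximal one.
\<close>

definition noetherian :: "'a::field set \<Rightarrow> bool" where
  "noetherian A \<longleftrightarrow>
     (\<forall>C. C \<noteq> {} \<and> (\<forall>I\<in>C. ideal I (ring_on A)) \<longrightarrow> (\<exists>I\<in>C. \<forall>J\<in>C. I \<subseteq> J \<longrightarrow> J = I))"

lemma noetherianE:
  assumes "noetherian A" "I0 \<in> C" "\<And>I. I \<in> C \<Longrightarrow> ideal I (ring_on A)"
  obtains I where "I \<in> C" "\<And>J. J \<in> C \<Longrightarrow> I \<subseteq> J \<Longrightarrow> J = I"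
  using assms unfolding noetherian_def by (metis empty_iff)

lemma noetherian_subfield:
  assumes F: "is_subfield F"
  shows "noetherian F"
  unfolding noetherian_def
proof (intro allI impI, elim conjE)
  fix C assume C: "C \<noteq> {}" "\<forall>I\<in>C. ideal I (ring_on F)"
  note Fr = is_subfieldD(1)[OF F]
  have dich: "I = {0} \<or> I = F" if "I \<in> C" for I
  proof (rule ccontr)
    assume no: "\<not> ?thesis"
    have I: "ideal I (ring_on F)"
      using C that by auto
    with no obtain x where x: "x \<in> I" "x \<noteq> 0"
      using idealD(2)[OF I Fr] by auto
    have "y \<in> I" if "y \<in> F" for y
      using idealD(4)[OF I Fr, of "y / x" x] x that is_subfieldD(3)[OF F that, of x]
        idealD(1)[OF I Fr x(1)] by simp
    then show False
      using no idealD(1)[OF I Fr] by auto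
  qed
  show "\<exists>I\<in>C. \<forall>J\<in>C. I \<subseteq> J \<longrightarrow> J = I"
  proof (cases "F \<in> C")
    case True
    have "J = F" if "J \<in> C" "F \<subseteq> J" for J
      using dich[OF that(1)] that(2) is_subringD(2)[OF Fr] by auto
    then show ?thesis
      using True by blast
  next
    case False
    then show ?thesis
      using C(1) dich by (metis equals0I)
  qed
qed

lemma is_subring_poly_image:
  assumes A: "is_subring A"
  shows "is_subring ((\<lambda>p. poly p w) ` polys_over A)"
proof (rule is_subringI)
  note P = is_subringD[OF is_subring_polys_over[OF A]]
  show "1 \<in> (\<lambda>p. poly p w) ` polys_over A"
    using P(2) by (intro image_eqI[of _ _ 1]) auto
  fix x assume "x \<in> (\<lambda>p. poly p w) ` polys_over A"
  then obtain p where p: "p \<in> polys_over A" "x = poly p w"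
    by auto
  show "- x \<in> (\<lambda>p. poly p w) ` polys_over A"
    using P(3)[OF p(1)] p by (intro image_eqI[of _ _ "- p"]) auto
  fix y assume "y \<in> (\<lambda>p. poly p w) ` polys_over A"
  then obtain q where q: "q \<in> polys_over A" "y = poly q w"
    by auto
  show "x * y \<in> (\<lambda>p. poly p w) ` polys_over A"
    using P(6)[OF p(1) q(1)] p q by (intro image_eqI[of _ _ "p * q"]) auto
  show "x + y \<in> (\<lambda>p. poly p w) ` polys_over A"
    using P(4)[OF p(1) q(1)] p q by (intro image_eqI[of _ _ "p + q"]) auto
qed

lemma const_in_polys_over: "is_subring A \<Longrightarrow> a \<in> A \<Longrightarrow> [:a:] \<in> polys_over A"
  by (auto simp: polys_over_def coeff_pCons is_subringD split: nat.split)

lemma monom_in_polys_over: "is_subring A \<Longrightarrow> a \<in> A \<Longrightarrow> Polynomial.monom a n \<in> polys_over A"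
  by (auto simp: polys_over_def is_subringD)

text \<open>
  Hilbert's basis theorem.  An ideal of \<open>A[w]\<close> is determined, inside a larger ideal, by its ideals
  of leading coefficients \<open>L n I\<close> of degree \<open>n\<close>.  These increase with \<open>n\<close> and \<open>I\<close>, so they become
  constant from a maximal one on, which leaves only finitely many degrees to be maximized one
  after the other.
\<close>

lemma noetherian_adjoin:
  fixes A :: "'a::field set"
  assumes A: "is_subring A" and noeth: "noetherian A"
  shows "noetherian ((\<lambda>p. poly p w) ` polys_over A)"
  unfolding noetherian_def
proof (intro allI impI, elim conjE)
  let ?B = "(\<lambda>p. poly p w) ` polys_over A"
  fix C assume "C \<noteq> {}" and idC: "\<forall>I\<in>C. ideal I (ring_on ?B)"
  note B = is_subring_poly_image[OF A, of w]
  note P = is_subringD[OF is_subring_polys_over[OF A]]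
  define L where "L n I =
    {a. \<exists>p\<in>polys_over A. degree p \<le> n \<and> Polynomial.coeff p n = a \<and> poly p w \<in> I}" for n I
  have idL: "ideal (L n I) (ring_on A)" if "I \<in> C" for n I
  proof (rule idealI'[OF A])
    have I: "ideal I (ring_on ?B)"
      using idC that by auto
    note I' = idealD[OF I B]
    show "L n I \<subseteq> A"
      by (auto simp: L_def polys_over_def)
    show "0 \<in> L n I"
      unfolding L_def using I'(2) P(1) by (auto intro!: bexI[of _ 0])
    fix x assume "x \<in> L n I"
    then obtain p where p: "p \<in> polys_over A" "degree p \<le> n" "Polynomial.coeff p n = x" "poly p w \<in> I"
      by (auto simp: L_def)
    {
      fix y assume "y \<in> L n I"
      then obtain q where q: "q \<in> polys_over A" "degree q \<le> n" "Polynomial.coeff q n = y" "poly q w \<in> I"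
        by (auto simp: L_def)
      show "x + y \<in> L n I"
        unfolding L_def using p q P(4) I'(3) by (auto intro!: bexI[of _ "p + q"] degree_add_le)
    }
    fix r assume r: "r \<in> A"
    have "[:r:] \<in> polys_over A"
      by (rule const_in_polys_over[OF A r])
    then have "[:r:] * p \<in> polys_over A" "r \<in> ?B"
      using P(6) p(1) by (blast, force)
    then have "smult r p \<in> polys_over A" "r * poly p w \<in> I"
      using I'(4) p(4) by auto
    then show "r * x \<in> L n I"
      unfolding L_def using p by (auto intro!: bexI[of _ "smult r p"])
  qed
  have mono: "L n I \<subseteq> L m J" if "I \<in> C" "n \<le> m" "I \<subseteq> J" for n m I J
  proof
    fix x assume "x \<in> L n I"
    then obtain p where p: "p \<in> polys_over A" "degree p \<le> n" "Polynomial.coeff p n = x" "poly p w \<in> I"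
      by (auto simp: L_def)
    have I: "ideal I (ring_on ?B)"
      using idC that by auto
    let ?X = "Polynomial.monom 1 (m - n) :: 'a poly"
    have X: "?X \<in> polys_over A"
      by (intro monom_in_polys_over A is_subringD)
    have "poly (?X * p) w \<in> I"
      using idealD(4)[OF I B, of "poly ?X w" "poly p w"] X p(4) by auto
    moreover have "degree (?X * p) \<le> m"
      using degree_mult_le[of ?X p] degree_monom_le[of "1::'a" "m - n"] p(2) that(2) by linarith
    moreover have "Polynomial.coeff (?X * p) m = x"
      using p(3) that(2) by (simp add: coeff_monom_mult)
    ultimately show "x \<in> L m J"
      unfolding L_def using P(6)[OF X p(1)] that(3) by blast
  qed
  \<comment> \<open>Subtracting an element of \<open>I\<close> with the same leading coefficient lowers the degree.\<close>
  have sub: "J = I" if IJ: "I \<in> C" "J \<in> C" "I \<subseteq> J" and eq: "\<And>n. L n J = L n I" for I J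
  proof -
    have I: "ideal I (ring_on ?B)" and J: "ideal J (ring_on ?B)"
      using idC IJ by auto
    have "poly p w \<in> I" if "p \<in> polys_over A" "degree p \<le> n" "poly p w \<in> J" for p n
      using that
    proof (induction n arbitrary: p)
      case (0 p)
      then have "Polynomial.coeff p 0 \<in> L 0 I"
        unfolding eq[symmetric] by (auto simp: L_def)
      then obtain q where "degree q \<le> 0" "Polynomial.coeff q 0 = Polynomial.coeff p 0" "poly q w \<in> I"
        by (auto simp: L_def)
      with 0 show ?case
        by (auto elim!: degree_eq_zeroE)
    next
      case (Suc n p)
      then have "Polynomial.coeff p (Suc n) \<in> L (Suc n) I"
        unfolding eq[symmetric] by (auto simp: L_def)
      then obtain q where q: "q \<in> polys_over A" "degree q \<le> Suc n"
        "Polynomial.coeff q (Suc n) = Polynomial.coeff p (Suc n)" "poly q w \<in> I"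
        by (auto simp: L_def)
      have "degree (p - q) \<le> n"
        using Suc.prems(2) q(2,3)
        by (intro degree_le allI impI) (metis Suc_lessI coeff_diff coeff_eq_0 diff_self le_less_trans)
      moreover have "poly (p - q) w \<in> J"
        using idealD(6)[OF J B Suc.prems(3), of "poly q w"] q(4) IJ(3) by auto
      ultimately have "poly (p - q) w \<in> I"
        using Suc.IH[of "p - q"] P(5) Suc.prems(1) q(1) by blast
      then show ?case
        using idealD(3)[OF I B _ q(4)] by fastforce
    qed
    then show ?thesis
      using idealD(1)[OF J B] IJ(3) by blast
  qed
  obtain I1 where "I1 \<in> C"
    using \<open>C \<noteq> {}\<close> by auto
  obtain M where M: "M \<in> {L n I |n I. I \<in> C}" "\<And>M'. M' \<in> {L n I |n I. I \<in> C} \<Longrightarrow> M \<subseteq> M' \<Longrightarrow> M' = M"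
    by (rule noetherianE[OF noeth, of "L 0 I1" "{L n I |n I. I \<in> C}"]) (use \<open>I1 \<in> C\<close> idL in auto)
  then obtain n0 I0 where I0: "M = L n0 I0" "I0 \<in> C"
    by auto
  \<comment> \<open>The degrees below \<open>m\<close> are settled; enlarging \<open>I\<close> further maximizes the ideal in degree \<open>m\<close>.\<close>
  have stable: "\<exists>I\<in>C. I0 \<subseteq> I \<and> (\<forall>n<m. \<forall>J\<in>C. I \<subseteq> J \<longrightarrow> L n J = L n I)" for m
  proof (induction m)
    case (Suc m)
    then obtain I where I: "I \<in> C" "I0 \<subseteq> I" and "\<forall>n<m. \<forall>J\<in>C. I \<subseteq> J \<longrightarrow> L n J = L n I"
      by blast
    then have eq: "L n J = L n I" if "n < m" "J \<in> C" "I \<subseteq> J" for n J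
      using that by blast
    obtain N where N: "N \<in> {L m J |J. J \<in> C \<and> I \<subseteq> J}"
      "\<And>N'. N' \<in> {L m J |J. J \<in> C \<and> I \<subseteq> J} \<Longrightarrow> N \<subseteq> N' \<Longrightarrow> N' = N"
      by (rule noetherianE[OF noeth, of "L m I" "{L m J |J. J \<in> C \<and> I \<subseteq> J}"]) (use I(1) idL in auto)
    then obtain J where J: "N = L m J" "J \<in> C" "I \<subseteq> J"
      by auto
    have "L n J' = L n J" if "n < Suc m" "J' \<in> C" "J \<subseteq> J'" for n J'
    proof (cases "n = m")
      case True
      then show ?thesis
        using N(2)[of "L m J'"] that J mono[of J m m J'] by auto
    next
      case False
      then have "n < m"
        using that(1) by simp
      then show ?thesis
        using eq[of n J'] eq[of n J] that J by auto
    qed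
    then have "I0 \<subseteq> J \<and> (\<forall>n<Suc m. \<forall>J'\<in>C. J \<subseteq> J' \<longrightarrow> L n J' = L n J)"
      using J(3) I(2) by (intro conjI allI impI ballI) simp_all
    then show ?case
      using J(2) by (rule rev_bexI[rotated])
  qed (use I0 in auto)
  obtain I where I: "I \<in> C" "I0 \<subseteq> I" and "\<forall>n<n0. \<forall>J\<in>C. I \<subseteq> J \<longrightarrow> L n J = L n I"
    using stable[of n0] by blast
  then have low: "L n J = L n I" if "n < n0" "J \<in> C" "I \<subseteq> J" for n J
    using that by blast
  have high: "L n J = M" if "n0 \<le> n" "J \<in> C" "I \<subseteq> J" for n J
    using M(2)[of "L n J"] mono[of I0 n0 n J] I0 I(2) that by auto
  have "J = I" if "J \<in> C" "I \<subseteq> J" for J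
  proof (rule sub[OF I(1) that])
    show "L n J = L n I" for n
      using low[of n J] high[of n J] high[of n I] I(1) that by (cases "n < n0") auto
  qed
  then show "\<exists>I\<in>C. \<forall>J\<in>C. I \<subseteq> J \<longrightarrow> J = I"
    using I(1) by blast
qed

lemma is_subring_generate_ring:
  fixes H :: "'a::comm_ring_1 set"
  shows "is_subring (generate_ring ring_of_type_algebra H)"
  by (intro ring.generate_ring_is_subring ring_from_type_algebra) auto

lemma generate_ring_least:
  fixes H :: "'a::comm_ring_1 set"
  assumes "is_subring B" "H \<subseteq> B"
  shows "generate_ring ring_of_type_algebra H \<subseteq> B"
  using ring.generate_ring_min_subring1[OF ring_from_type_algebra _ assms] by auto

text \<open>
  Adjoining one element turns a generated ring into the image of a polynomial ring, which is what the
  basis theorem needs.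
\<close>

lemma generate_ring_insert:
  fixes H :: "'a::field set"
  shows "generate_ring ring_of_type_algebra (insert w H) =
    (\<lambda>p. poly p w) ` polys_over (generate_ring ring_of_type_algebra H)"
    (is "?L = _ ` polys_over ?A")
proof
  have A: "is_subring ?A"
    by (rule is_subring_generate_ring)
  have "insert w H \<subseteq> (\<lambda>p. poly p w) ` polys_over ?A"
  proof
    fix x assume "x \<in> insert w H"
    then consider "x = w" | "x \<in> H"
      by auto
    then show "x \<in> (\<lambda>p. poly p w) ` polys_over ?A"
    proof cases
      case 1
      then show ?thesis
        using monom_in_polys_over[OF A is_subringD(2)[OF A], of 1]
        by (intro image_eqI[of _ _ "Polynomial.monom 1 1"]) (auto simp: poly_monom)
    next
      case 2
      then show ?thesis
        using const_in_polys_over[OF A, of x]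
        by (intro image_eqI[of _ _ "[:x:]"]) (auto intro: generate_ring.incl)
    qed
  qed
  then show "?L \<subseteq> (\<lambda>p. poly p w) ` polys_over ?A"
    by (intro generate_ring_least is_subring_poly_image A)
  have "?A \<subseteq> ?L"
    by (rule generate_ring_least[OF is_subring_generate_ring]) (auto intro: generate_ring.incl)
  moreover have "w \<in> ?L"
    by (auto intro: generate_ring.incl)
  ultimately show "(\<lambda>p. poly p w) ` polys_over ?A \<subseteq> ?L"
    using poly_polys_over_closed[OF is_subring_generate_ring] by blast
qed

lemma noetherian_finitely_generated:
  assumes k: "is_subfield k" and "finite S"
  shows "noetherian (generate_ring ring_of_type_algebra (k \<union> S))"
  using assms(2)
proof (induction S rule: finite_induct)
  case empty
  have "generate_ring ring_of_type_algebra k = k"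
    using generate_ring_least[OF is_subfieldD(1)[OF k], of k] by (auto intro: generate_ring.incl)
  then show ?case
    using noetherian_subfield[OF k] by simp
next
  case (insert w S)
  then show ?case
    using noetherian_adjoin[OF is_subring_generate_ring] generate_ring_insert[of w "k \<union> S"] by simp
qed

lemma ideal_extend:
  fixes A :: "'a::comm_ring_1 set"
  assumes A: "is_subring A" and I: "ideal I (ring_on A)" and a: "a \<in> A"
  shows "ideal {x + r * a |x r. x \<in> I \<and> r \<in> A} (ring_on A)"
    and "I \<subseteq> {x + r * a |x r. x \<in> I \<and> r \<in> A}" "a \<in> {x + r * a |x r. x \<in> I \<and> r \<in> A}"
proof -
  let ?J = "{x + r * a |x r. x \<in> I \<and> r \<in> A}"
  note Ar = is_subringD[OF A]
  note Ir = idealD[OF I A]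
  show "I \<subseteq> ?J"
    using Ar(1) by force
  show "a \<in> ?J"
    using Ar(2) Ir(2) by force
  show "ideal ?J (ring_on A)"
  proof (rule idealI'[OF A])
    show "?J \<subseteq> A"
      using Ir(1) Ar a by auto
    show "0 \<in> ?J"
      using Ir(2) Ar(1) by force
  next
    fix x y assume "x \<in> ?J" "y \<in> ?J"
    then obtain x1 r1 x2 r2 where "x = x1 + r1 * a" "y = x2 + r2 * a"
      "x1 \<in> I" "x2 \<in> I" "r1 \<in> A" "r2 \<in> A"
      by auto
    then have "x + y = (x1 + x2) + (r1 + r2) * a" "x1 + x2 \<in> I" "r1 + r2 \<in> A"
      using Ir Ar by (auto simp: algebra_simps)
    then show "x + y \<in> ?J"
      by blast
  next
    fix r x assume "r \<in> A" "x \<in> ?J"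
    then obtain x1 r1 where "x = x1 + r1 * a" "x1 \<in> I" "r1 \<in> A"
      by auto
    then have "r * x = r * x1 + (r * r1) * a" "r * x1 \<in> I" "r * r1 \<in> A"
      using Ir(4) Ar \<open>r \<in> A\<close> by (auto simp: algebra_simps)
    then show "r * x \<in> ?J"
      by blast
  qed
qed

text \<open>
  A noetherian ring has finitely many primes minimal over an ideal: an ideal that is maximal among
  the counterexamples is not prime, and the primes above it lie above one of two larger ideals.
\<close>

lemma noetherian_minimal_primes_finite:
  fixes A :: "'a::field set"
  assumes A: "is_subring A" and noeth: "noetherian A" and I: "ideal I (ring_on A)"
  shows "\<exists>\<P>. finite \<P> \<and> (\<forall>P\<in>\<P>. primeideal P (ring_on A) \<and> I \<subseteq> P) \<and>
           (\<forall>Q. primeideal Q (ring_on A) \<and> I \<subseteq> Q \<longrightarrow> (\<exists>P\<in>\<P>. P \<subseteq> Q))"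
proof (rule ccontr)
  define good where "good I \<longleftrightarrow> (\<exists>\<P>. finite \<P> \<and> (\<forall>P\<in>\<P>. primeideal P (ring_on A) \<and> I \<subseteq> P) \<and>
    (\<forall>Q. primeideal Q (ring_on A) \<and> I \<subseteq> Q \<longrightarrow> (\<exists>P\<in>\<P>. P \<subseteq> Q)))" for I
  assume "\<not> (\<exists>\<P>. finite \<P> \<and> (\<forall>P\<in>\<P>. primeideal P (ring_on A) \<and> I \<subseteq> P) \<and>
           (\<forall>Q. primeideal Q (ring_on A) \<and> I \<subseteq> Q \<longrightarrow> (\<exists>P\<in>\<P>. P \<subseteq> Q)))"
  then have "I \<in> {I. ideal I (ring_on A) \<and> \<not> good I}"
    using I by (simp add: good_def)
  then obtain M where M: "ideal M (ring_on A)" "\<not> good M"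
    and max: "\<And>J. ideal J (ring_on A) \<Longrightarrow> \<not> good J \<Longrightarrow> M \<subseteq> J \<Longrightarrow> J = M"
    by (rule noetherianE[OF noeth]) auto
  note Mr = idealD[OF M(1) A]
  have "\<not> primeideal M (ring_on A)"
  proof
    assume "primeideal M (ring_on A)"
    then have "good M"
      unfolding good_def by (intro exI[of _ "{M}"]) auto
    then show False
      using M(2) by simp
  qed
  moreover have "1 \<notin> M"
  proof
    assume "1 \<in> M"
    then have "good M"
      unfolding good_def by (intro exI[of _ "{}"]) (auto dest: primeidealD(2)[OF _ A])
    then show False
      using M(2) by simp
  qed
  ultimately obtain a b where ab: "a \<in> A" "b \<in> A" "a * b \<in> M" "a \<notin> M" "b \<notin> M"
    using M(1) primeideal_ring_on_iff[OF A] by blast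
  let ?J = "\<lambda>c. {x + r * c |x r. x \<in> M \<and> r \<in> A}"
  have "good (?J c)" if "c \<in> A" "c \<notin> M" for c
    using max[of "?J c"] ideal_extend[OF A M(1) that(1)] that(2) by blast
  then have "good (?J a)" "good (?J b)"
    using ab by simp_all
  obtain \<P>a where Pa: "finite \<P>a" "\<forall>P\<in>\<P>a. primeideal P (ring_on A) \<and> ?J a \<subseteq> P"
      "\<forall>Q. primeideal Q (ring_on A) \<and> ?J a \<subseteq> Q \<longrightarrow> (\<exists>P\<in>\<P>a. P \<subseteq> Q)"
    using \<open>good (?J a)\<close> unfolding good_def by (elim exE conjE)
  obtain \<P>b where Pb: "finite \<P>b" "\<forall>P\<in>\<P>b. primeideal P (ring_on A) \<and> ?J b \<subseteq> P"
      "\<forall>Q. primeideal Q (ring_on A) \<and> ?J b \<subseteq> Q \<longrightarrow> (\<exists>P\<in>\<P>b. P \<subseteq> Q)"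
    using \<open>good (?J b)\<close> unfolding good_def by (elim exE conjE)
  have "good M"
    unfolding good_def
  proof (intro exI[of _ "\<P>a \<union> \<P>b"] conjI allI impI ballI)
    fix Q assume Q: "primeideal Q (ring_on A) \<and> M \<subseteq> Q"
    then have "ideal Q (ring_on A)"
      using primeidealD(1)[OF _ A] by auto
    note Qr = idealD[OF this A]
    have "?J c \<subseteq> Q" if "c \<in> Q" for c
      using Q that Qr(3,4) by auto
    moreover have "a \<in> Q \<or> b \<in> Q"
      using primeidealD(3)[OF _ A, of Q a b] Q ab by auto
    ultimately show "\<exists>P\<in>\<P>a \<union> \<P>b. P \<subseteq> Q"
      using Pa(3) Pb(3) Q by (meson UnI1 UnI2)
  next
    fix P assume P: "P \<in> \<P>a \<union> \<P>b"
    then show "primeideal P (ring_on A)"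
      using Pa(2) Pb(2) by auto
    show "M \<subseteq> P"
      using P Pa(2) Pb(2) ideal_extend(2)[OF A M(1) ab(1)] ideal_extend(2)[OF A M(1) ab(2)]
      by (meson UnE subset_trans)
  qed (use Pa Pb in auto)
  then show False
    using M(2) by simp
qed

section \<open>Localization\<close>

lemma localization_atE:
  assumes "x \<in> localization_at A P"
  obtains a b where "a \<in> A" "b \<in> A" "b \<notin> P" "x = a / b"
  using assms by (auto simp: localization_at_def)

lemma localization_atI: "a \<in> A \<Longrightarrow> b \<in> A \<Longrightarrow> b \<notin> P \<Longrightarrow> a / b \<in> localization_at A P"
  by (auto simp: localization_at_def)

context
  fixes A P :: "'a::field set"
  assumes A: "is_subring A" and P: "primeideal P (ring_on A)"
begin

lemma notin_prime_nonzero: "b \<notin> P \<Longrightarrow> b \<noteq> 0"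
  using idealD(2)[OF primeidealD(1)[OF P A] A] by auto

lemma subset_localization: "A \<subseteq> localization_at A P"
  using localization_atI[of _ A 1 P] is_subringD(2)[OF A] primeidealD(2)[OF P A] by fastforce

lemma is_subring_localization: "is_subring (localization_at A P)"
proof (rule is_subringI)
  show "1 \<in> localization_at A P"
    using subset_localization is_subringD(2)[OF A] by auto
  fix x assume "x \<in> localization_at A P"
  then obtain a b where x: "a \<in> A" "b \<in> A" "b \<notin> P" "x = a / b"
    by (rule localization_atE)
  show "- x \<in> localization_at A P"
    using localization_atI[of "- a" A b P] x is_subringD(3)[OF A] by auto
  fix y assume "y \<in> localization_at A P"
  then obtain c d where y: "c \<in> A" "d \<in> A" "d \<notin> P" "y = c / d"
    by (rule localization_atE)
  have bd: "b * d \<in> A" "b * d \<notin> P"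
    using primeidealD(4)[OF P A, of b d] x y by auto
  show "x * y \<in> localization_at A P"
    using localization_atI[of "a * c" A "b * d" P] bd x y is_subringD(6)[OF A] by auto
  have "x + y = (a * d + b * c) / (b * d)"
    using x y notin_prime_nonzero by (auto simp: field_simps)
  then show "x + y \<in> localization_at A P"
    using localization_atI[of "a * d + b * c" A "b * d" P] bd x y is_subringD[OF A] by auto
qed

text \<open>
  An ideal of the localization is generated by its contraction to \<open>A\<close>, so contraction loses no
  strict inclusion.
\<close>

lemma noetherian_localization:
  assumes noeth: "noetherian A"
  shows "noetherian (localization_at A P)"
  unfolding noetherian_def
proof (intro allI impI, elim conjE)
  fix C assume C: "C \<noteq> {}" "\<forall>I\<in>C. ideal I (ring_on (localization_at A P))"
  note R = is_subring_localization
  have id: "ideal (I \<inter> A) (ring_on A)" if "I \<in> C" for I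
  proof -
    have I: "ideal I (ring_on (localization_at A P))"
      using C that by auto
    show ?thesis
      using idealD[OF I R] is_subringD[OF A] subset_localization by (intro idealI'[OF A]) auto
  qed
  obtain I0 where "I0 \<in> C"
    using C by auto
  then obtain M where M: "M \<in> (\<lambda>I. I \<inter> A) ` C" "\<And>M'. M' \<in> (\<lambda>I. I \<inter> A) ` C \<Longrightarrow> M \<subseteq> M' \<Longrightarrow> M' = M"
    by (rule noetherianE[OF noeth imageI]) (use id in auto)
  then obtain I where I: "M = I \<inter> A" "I \<in> C"
    by auto
  have "J \<subseteq> I" if J: "J \<in> C" "I \<subseteq> J" for J
  proof
    fix x assume x: "x \<in> J"
    have idI: "ideal I (ring_on (localization_at A P))" and idJ: "ideal J (ring_on (localization_at A P))"
      using C I J by auto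
    obtain a b where ab: "a \<in> A" "b \<in> A" "b \<notin> P" "x = a / b"
      using idealD(1)[OF idJ R x] by (rule localization_atE)
    then have b: "b \<noteq> 0"
      using notin_prime_nonzero by auto
    have "b * x \<in> J"
      using idealD(4)[OF idJ R _ x, of b] ab(2) subset_localization by auto
    then have "a \<in> J \<inter> A"
      using ab b by simp
    also have "J \<inter> A = I \<inter> A"
      using M(2)[of "J \<inter> A"] I J by auto
    finally have "a \<in> I"
      by simp
    moreover have "1 / b \<in> localization_at A P"
      using ab is_subringD(2)[OF A] by (intro localization_atI)
    ultimately have "1 / b * a \<in> I"
      using idealD(4)[OF idI R] by blast
    then show "x \<in> I"
      using ab by simp
  qed
  then show "\<exists>I\<in>C. \<forall>J\<in>C. I \<subseteq> J \<longrightarrow> J = I"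
    using I(2) by blast
qed

lemma localization_Units_iff:
  assumes "a \<in> A" "b \<in> A" "b \<notin> P"
  shows "a / b \<in> Units (ring_on (localization_at A P)) \<longleftrightarrow> a \<notin> P"
proof
  assume "a / b \<in> Units (ring_on (localization_at A P))"
  then have ab: "a \<noteq> 0" "b / a \<in> localization_at A P"
    by (auto simp: Units_ring_on)
  then obtain c d where cd: "c \<in> A" "d \<in> A" "d \<notin> P" "b / a = c / d"
    by (auto elim: localization_atE)
  then have "b * d = a * c"
    using ab notin_prime_nonzero by (auto simp: field_simps)
  moreover have "b * d \<notin> P"
    using primeidealD(4)[OF P A] cd assms by auto
  ultimately show "a \<notin> P"
    using idealD(4)[OF primeidealD(1)[OF P A] A cd(1), of a] by (auto simp: mult.commute)
next
  assume "a \<notin> P"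
  then show "a / b \<in> Units (ring_on (localization_at A P))"
    using assms localization_atI[of a A b P] localization_atI[of b A a P] notin_prime_nonzero
    by (auto simp: Units_ring_on)
qed

end

section \<open>Discrete valuation rings\<close>

text \<open>
  Integrality without determinants: the ideals generated by \<open>x, x z, \<dots>, x z\<^sup>n\<close> become constant, and
  the resulting expression of \<open>x z\<^bsup>n+1\<^esup>\<close> can be divided by \<open>x\<close>.
\<close>

lemma noetherian_integral_if_bounded_powers:
  fixes R :: "'a::field set"
  assumes R: "is_subring R" and noeth: "noetherian R"
    and x: "x \<noteq> 0" and powers: "\<And>i. x * z ^ i \<in> R"
  shows "integral_over R z"
proof -
  note Rr = is_subringD[OF R]
  note P = is_subringD[OF is_subring_polys_over[OF R]]
  define I where "I n = {x * poly p z |p. p \<in> polys_over R \<and> degree p \<le> n}" for n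
  have idI: "ideal (I n) (ring_on R)" for n
  proof (rule idealI'[OF R])
    show "I n \<subseteq> R"
    proof
      fix y assume "y \<in> I n"
      then obtain p where p: "p \<in> polys_over R" "y = x * poly p z"
        by (auto simp: I_def)
      then have "y = (\<Sum>i\<le>degree p. Polynomial.coeff p i * (x * z ^ i))"
        by (simp add: poly_altdef sum_distrib_left algebra_simps)
      also have "\<dots> \<in> R"
        using p(1) Rr(6) powers by (intro is_subring_sum[OF R]) (simp add: polys_over_def)
      finally show "y \<in> R" .
    qed
    show "0 \<in> I n"
      using P(1) by (auto simp: I_def intro!: exI[of _ 0])
    fix y assume "y \<in> I n"
    then obtain p where p: "p \<in> polys_over R" "degree p \<le> n" "y = x * poly p z"
      by (auto simp: I_def)
    show "y + y' \<in> I n" if y': "y' \<in> I n" for y'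
    proof -
      obtain q where q: "q \<in> polys_over R" "degree q \<le> n" "y' = x * poly q z"
        using y' by (auto simp: I_def)
      then have "p + q \<in> polys_over R" "degree (p + q) \<le> n" "y + y' = x * poly (p + q) z"
        using p P(4) by (auto intro: degree_add_le simp: algebra_simps)
      then show ?thesis
        unfolding I_def by blast
    qed
    fix r assume "r \<in> R"
    then have "smult r p \<in> polys_over R"
      using p(1) Rr(6) by (auto simp: polys_over_def)
    moreover have "degree (smult r p) \<le> n" "r * y = x * poly (smult r p) z"
      using p by auto
    ultimately show "r * y \<in> I n"
      unfolding I_def by blast
  qed
  obtain M where M: "M \<in> range I" "\<And>J. J \<in> range I \<Longrightarrow> M \<subseteq> J \<Longrightarrow> J = M"
    by (rule noetherianE[OF noeth, of "I 0" "range I"]) (use idI in auto)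
  then obtain n where n: "M = I n"
    by auto
  have "I n \<subseteq> I (Suc n)"
    by (auto simp: I_def intro: le_SucI)
  then have "I (Suc n) = I n"
    using M(2)[of "I (Suc n)"] n by auto
  moreover have "x * z ^ Suc n \<in> I (Suc n)"
    unfolding I_def using monom_in_polys_over[OF R Rr(2), of "Suc n"]
    by (intro CollectI exI[of _ "Polynomial.monom 1 (Suc n)"]) (auto simp: poly_monom degree_monom_eq)
  ultimately obtain p where p: "p \<in> polys_over R" "degree p \<le> n" "z ^ Suc n = poly p z"
    using x by (auto simp: I_def)
  let ?q = "Polynomial.monom 1 (Suc n) - p"
  have c: "Polynomial.coeff ?q (Suc n) = 1"
    using p(2) by (simp add: coeff_eq_0)
  have "degree ?q \<le> Suc n"
    using p(2) by (intro degree_diff_le) (auto simp: degree_monom_eq)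
  then have "degree ?q = Suc n"
    using c le_degree[of ?q "Suc n"] by auto
  then have "lead_coeff ?q = 1"
    using c by simp
  moreover have "\<forall>i. Polynomial.coeff ?q i \<in> R"
    using P(5)[OF monom_in_polys_over[OF R Rr(2)] p(1)] unfolding polys_over_def by blast
  moreover have "poly ?q z = 0"
    using p(3) by (simp add: poly_monom)
  ultimately show ?thesis
    unfolding integral_over_def by blast
qed

text \<open>
  A maximal ideal \<open>(a : b)\<close> with \<open>b \<notin> aR\<close> is prime, hence it is the maximal ideal \<open>m\<close>.  So
  \<open>z = b / a\<close> maps \<open>m\<close> into \<open>R\<close>; it does not map \<open>m\<close> into itself because \<open>z \<notin> R\<close> is not
  integral, so some multiple of \<open>z\<close> by an element of \<open>m\<close> is a unit and \<open>m\<close> is generated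
  by \<open>a / b\<close>.
\<close>

lemma normal_dim1_uniformizer_exists:
  fixes R :: "'a::field set"
  defines "m \<equiv> R - Units (ring_on R)"
  assumes R: "is_subring R" and noeth: "noetherian R" and normal: "integrally_closed R"
    and local: "ideal m (ring_on R)" and nonzero: "m \<noteq> {0}"
    and dim1: "\<And>Q. primeideal Q (ring_on R) \<Longrightarrow> Q \<noteq> {0} \<Longrightarrow> Q = m"
  shows "\<exists>t. t \<noteq> 0 \<and> uniformizer R t"
proof -
  note Rr = is_subringD[OF R]
  note mr = idealD[OF local R]
  obtain a where a: "a \<in> m" "a \<noteq> 0"
    using nonzero mr(2) by blast
  then have aR: "a \<in> R"
    by (simp add: m_def)
  define quo where "quo b = {r \<in> R. \<exists>s\<in>R. r * b = a * s}" for b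
  define aRset where "aRset = (*) a ` R"
  have quo_ideal: "ideal (quo b) (ring_on R)" if "b \<in> R" for b
  proof (rule idealI'[OF R])
    show "0 \<in> quo b"
      using Rr(1) by (auto simp: quo_def)
    fix x assume "x \<in> quo b"
    then obtain s where s: "x \<in> R" "s \<in> R" "x * b = a * s"
      by (auto simp: quo_def)
    show "x + y \<in> quo b" if y: "y \<in> quo b" for y
    proof -
      obtain s' where s': "y \<in> R" "s' \<in> R" "y * b = a * s'"
        using y by (auto simp: quo_def)
      have "(x + y) * b = a * (s + s')"
        using s s' by (simp add: algebra_simps)
      then show ?thesis
        using s s' Rr(4) unfolding quo_def by blast
    qed
    fix r assume r: "r \<in> R"
    have "(r * x) * b = a * (r * s)"
      using s by (simp add: algebra_simps)
    then show "r * x \<in> quo b"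
      using s r Rr(6) unfolding quo_def by blast
  qed (auto simp: quo_def)
  have "1 \<notin> aRset"
  proof
    assume "1 \<in> aRset"
    then obtain s where "s \<in> R" "1 = a * s"
      by (auto simp: aRset_def)
    then have "a \<in> Units (ring_on R)"
      using aR a(2) inverse_unique[of a s] by (auto simp: Units_ring_on)
    then show False
      using a(1) by (simp add: m_def)
  qed
  then have one: "quo 1 \<in> {quo b |b. b \<in> R - aRset}"
    using Rr(2) by auto
  obtain M where M: "M \<in> {quo b |b. b \<in> R - aRset}"
    "\<And>J. J \<in> {quo b |b. b \<in> R - aRset} \<Longrightarrow> M \<subseteq> J \<Longrightarrow> J = M"
    by (rule noetherianE[OF noeth one]) (use quo_ideal in auto)
  then obtain b where b: "M = quo b" "b \<in> R" "b \<notin> aRset"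
    by auto
  have "primeideal M (ring_on R)"
    unfolding primeideal_ring_on_iff[OF R]
  proof (intro conjI ballI impI)
    show "ideal M (ring_on R)"
      using b quo_ideal by simp
    show "1 \<notin> M"
      using b by (auto simp: quo_def aRset_def)
    fix x y assume xy: "x \<in> R" "y \<in> R" "x * y \<in> M"
    show "x \<in> M \<or> y \<in> M"
    proof (cases "y \<in> M")
      case False
      then have "y * b \<in> R - aRset"
        using xy b Rr(6) by (auto simp: quo_def aRset_def)
      moreover have "M \<subseteq> quo (y * b)"
      proof
        fix r assume "r \<in> M"
        then obtain s where s: "r \<in> R" "s \<in> R" "r * b = a * s"
          by (auto simp: quo_def b(1))
        then have "r * (y * b) = a * (y * s)"
          by (metis mult.assoc mult.commute)
        then show "r \<in> quo (y * b)"
          using s(1) Rr(6)[OF xy(2) s(2)] unfolding quo_def by blast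
      qed
      ultimately have "quo (y * b) = M"
        using M(2)[of "quo (y * b)"] by auto
      moreover have "x \<in> quo (y * b)"
        using xy b(1) by (auto simp: quo_def mult.assoc)
      ultimately show ?thesis
        by simp
    qed simp
  qed
  moreover have "a \<in> M"
    using aR b by (auto simp: quo_def)
  ultimately have Mm: "M = m"
    using dim1 a(2) by blast
  define z where "z = b / a"
  have zm: "z * x \<in> R" if "x \<in> m" for x
  proof -
    obtain s where "s \<in> R" "x * b = a * s"
      using \<open>x \<in> m\<close> unfolding Mm[symmetric] b(1) by (auto simp: quo_def)
    then have "z * x = s"
      using a(2) by (simp add: z_def field_simps)
    then show ?thesis
      using \<open>s \<in> R\<close> by simp
  qed
  have "z \<notin> R"
  proof
    assume "z \<in> R"
    then have "b \<in> aRset"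
      using a(2) by (auto simp: aRset_def z_def intro!: image_eqI[of _ _ "b / a"])
    then show False
      using b(3) by simp
  qed
  have "\<exists>x\<in>m. z * x \<notin> m"
  proof (rule ccontr)
    assume "\<not> ?thesis"
    then have zm': "z * x \<in> m" if "x \<in> m" for x
      using that by auto
    have "a * z ^ i \<in> m" for i
    proof (induction i)
      case (Suc i)
      then show ?case
        using zm'[of "a * z ^ i"] by (simp add: algebra_simps)
    qed (use a in simp)
    then have "integral_over R z"
      using noetherian_integral_if_bounded_powers[OF R noeth a(2)] by (auto simp: m_def)
    moreover have "z \<in> frac_field R"
      using a(2) aR b(2) by (auto simp: frac_field_def z_def)
    ultimately show False
      using normal \<open>z \<notin> R\<close> by (simp add: integrally_closed_def)
  qed
  then obtain x where x: "x \<in> m" "z * x \<in> R" "z * x \<notin> m"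
    using zm by auto
  then have u: "z * x \<noteq> 0" "inverse (z * x) \<in> R"
    by (auto simp: m_def Units_ring_on)
  define t where "t = inverse z"
  have t: "t = inverse (z * x) * x"
    using u by (simp add: t_def)
  have tm: "t \<in> m"
    unfolding t using mr(4) u x(1) by blast
  have "(*) t ` R = m"
  proof (intro Set.set_eqI iffI)
    fix y assume "y \<in> (*) t ` R"
    then show "y \<in> m"
      using mr(4) tm by (auto simp: mult.commute)
  next
    fix y assume "y \<in> m"
    then have "z * y \<in> R" "y = t * (z * y)"
      using zm u(1) by (auto simp: t_def)
    then show "y \<in> (*) t ` R"
      by blast
  qed
  moreover have "t \<in> R"
    using mr(1) tm .
  ultimately have "uniformizer R t"
    by (simp add: uniformizer_def m_def)
  moreover have "t \<noteq> 0"
    using u(1) by (simp add: t_def)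
  ultimately show ?thesis
    by blast
qed

lemma Units_ring_on_mult:
  fixes R :: "'a::field set"
  assumes "is_subring R" "u \<in> Units (ring_on R)" "w \<in> Units (ring_on R)"
  shows "u * w \<in> Units (ring_on R)" "inverse u \<in> Units (ring_on R)" "u / w \<in> Units (ring_on R)"
proof -
  have *: "u * w \<in> Units (ring_on R)"
    if "u \<in> Units (ring_on R)" "w \<in> Units (ring_on R)" for u w
    using that is_subringD(6)[OF assms(1)] by (auto simp: Units_ring_on)
  have inv: "inverse u \<in> Units (ring_on R)" if "u \<in> Units (ring_on R)" for u
    using that by (auto simp: Units_ring_on)
  show "u * w \<in> Units (ring_on R)" "inverse u \<in> Units (ring_on R)" "u / w \<in> Units (ring_on R)"
    unfolding divide_inverse by (intro * inv assms)+
qed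

lemma Units_ring_on_power_int:
  fixes R :: "'a::field set"
  assumes R: "is_subring R" and u: "u \<in> Units (ring_on R)"
  shows "u powi n \<in> Units (ring_on R)"
proof -
  have *: "w ^ j \<in> Units (ring_on R)" if "w \<in> Units (ring_on R)" for w and j
    using that is_subringD(7)[OF R] by (auto simp: Units_ring_on power_inverse[symmetric])
  show ?thesis
    using * u Units_ring_on_mult(2)[OF R u u] by (auto simp: power_int_def)
qed

text \<open>
  The data that make \<^const>\<open>dvr_ord\<close> a valuation: a noetherian ring whose nonunits are the multiples
  of one nonzero element.
\<close>

locale dvr =
  fixes R :: "'a::field set" and t :: 'a
  assumes R: "is_subring R" and noeth: "noetherian R"
    and t: "uniformizer R t" and t_nonzero: "t \<noteq> 0"
begin

lemma t_in: "t \<in> R" and t_not_unit: "t \<notin> Units (ring_on R)"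
proof -
  show "t \<in> R"
    using t by (simp add: uniformizer_def)
  have "t * 1 \<in> (*) t ` R"
    using is_subringD(2)[OF R] by blast
  then show "t \<notin> Units (ring_on R)"
    using t unfolding uniformizer_def by (metis Diff_iff mult.right_neutral)
qed

lemma nonunitE:
  assumes "x \<in> R" "x \<notin> Units (ring_on R)"
  obtains y where "y \<in> R" "x = t * y"
  using assms t by (auto simp: uniformizer_def)

text \<open>
  Powers of \<open>t\<close> can be split off only finitely often, because the principal ideals generated by
  the cofactors increase strictly.
\<close>

lemma unit_times_power:
  assumes r: "r \<in> R" "r \<noteq> 0"
  shows "\<exists>u n. u \<in> Units (ring_on R) \<and> r = u * t ^ n"
proof -
  note Rr = is_subringD[OF R]
  define C where "C = {(*) c ` R |c. c \<in> R \<and> (\<exists>n. r = c * t ^ n)}"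
  have idC: "ideal ((*) c ` R) (ring_on R)" if "c \<in> R" for c
  proof (rule idealI'[OF R])
    fix x y assume "x \<in> (*) c ` R" "y \<in> (*) c ` R"
    then show "x + y \<in> (*) c ` R"
      using Rr(4) by (auto simp: distrib_left[symmetric])
  next
    fix s x assume "s \<in> R" "x \<in> (*) c ` R"
    then obtain y where "y \<in> R" "s * x = c * (s * y)"
      by auto
    then show "s * x \<in> (*) c ` R"
      using Rr(6) \<open>s \<in> R\<close> by blast
  qed (use Rr(1,6) that in auto)
  have "(*) r ` R \<in> C"
    unfolding C_def using r by (intro CollectI exI[of _ r]) (auto intro: exI[of _ 0])
  then obtain M where M: "M \<in> C" "\<And>J. J \<in> C \<Longrightarrow> M \<subseteq> J \<Longrightarrow> J = M"
    by (rule noetherianE[OF noeth]) (use idC in \<open>auto simp: C_def\<close>)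
  then obtain c n where c: "M = (*) c ` R" "c \<in> R" "r = c * t ^ n"
    by (auto simp: C_def)
  have "c \<in> Units (ring_on R)"
  proof (rule ccontr)
    assume "c \<notin> Units (ring_on R)"
    then obtain c' where c': "c' \<in> R" "c = t * c'"
      using c by (auto elim: nonunitE)
    have "r = c' * t ^ Suc n"
      using c c' by simp
    then have "(*) c' ` R \<in> C"
      using c'(1) unfolding C_def by blast
    moreover have "M \<subseteq> (*) c' ` R"
      using c(1) c' Rr(6) t_in by (auto simp: mult.assoc mult.left_commute)
    ultimately have "(*) c' ` R = M"
      using M(2) by blast
    moreover have "c' \<in> (*) c' ` R"
      using Rr(2) by (auto intro!: image_eqI[of _ _ 1])
    ultimately obtain s where s: "s \<in> R" "c' = c * s"
      using c(1) by auto
    have "c' \<noteq> 0"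
      using c c' r by auto
    moreover have "c' = c' * (t * s)"
      using s(2) unfolding c'(2) by (simp add: mult.assoc mult.left_commute)
    ultimately have "t * s = 1"
      by simp
    then have "t \<in> Units (ring_on R)"
      using t_in s(1) t_nonzero inverse_unique[of t s] by (auto simp: Units_ring_on)
    then show False
      using t_not_unit by simp
  qed
  then show ?thesis
    using c(3) by blast
qed

lemma unit_times_power_int:
  assumes "\<phi> \<in> frac_field R" "\<phi> \<noteq> 0"
  shows "\<exists>u n. u \<in> Units (ring_on R) \<and> \<phi> = u * t powi n"
proof -
  obtain a b where ab: "\<phi> = a / b" "a \<in> R" "b \<in> R" "b \<noteq> 0"
    using assms(1) by (auto simp: frac_field_def)
  then have "a \<noteq> 0"
    using assms(2) by auto
  obtain u n where u: "u \<in> Units (ring_on R)" "a = u * t ^ n"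
    using unit_times_power[OF ab(2) \<open>a \<noteq> 0\<close>] by auto
  obtain w m where w: "w \<in> Units (ring_on R)" "b = w * t ^ m"
    using unit_times_power[OF ab(3,4)] by auto
  have "\<phi> = (u / w) * t powi (int n - int m)"
    using ab(1) u w t_nonzero by (simp add: power_int_diff)
  then show ?thesis
    using Units_ring_on_mult(3)[OF R u(1) w(1)] by blast
qed

lemma power_int_unit_iff: "t powi n \<in> Units (ring_on R) \<longleftrightarrow> n = 0"
proof
  have pos: False if "j \<noteq> 0" and unit: "t ^ j \<in> Units (ring_on R)" for j :: nat
  proof -
    obtain i where j: "j = Suc i"
      using \<open>j \<noteq> 0\<close> not0_implies_Suc by blast
    have "t * (t ^ i * inverse (t ^ j)) = 1"
      using t_nonzero unfolding j by (simp add: field_simps)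
    from inverse_unique[OF this] have "inverse t = t ^ i * inverse (t ^ j)" .
    also have "\<dots> \<in> R"
      using unit is_subringD(6,7)[OF R] t_in by (auto simp: Units_ring_on)
    finally have "t \<in> Units (ring_on R)"
      using t_in t_nonzero by (simp add: Units_ring_on)
    then show False
      using t_not_unit by simp
  qed
  assume n: "t powi n \<in> Units (ring_on R)"
  then have n': "t powi (- n) \<in> Units (ring_on R)"
    using Units_ring_on_mult(2)[OF R n n] by (simp add: power_int_minus)
  show "n = 0"
    using pos[of "nat n"] pos[of "nat (- n)"] n n' by (cases n "0::int" rule: linorder_cases) (auto simp: power_int_def)
qed (use is_subringD(2)[OF R] in \<open>auto simp: Units_ring_on\<close>)

text \<open>
  Two uniformizers generate the same ideal and thus differ by a unit, so the exponent of a uniformizer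
  in \<open>\<phi>\<close> does not depend on its choice.
\<close>

lemma dvr_ord_eqI:
  assumes u: "u \<in> Units (ring_on R)" and \<phi>: "\<phi> = u * t powi n"
  shows "dvr_ord R \<phi> = n"
  unfolding dvr_ord_def
proof (rule the_equality)
  show "\<exists>t u. uniformizer R t \<and> u \<in> Units (ring_on R) \<and> \<phi> = u * t powi n"
    using t u \<phi> by blast
  fix n' assume "\<exists>t u. uniformizer R t \<and> u \<in> Units (ring_on R) \<and> \<phi> = u * t powi n'"
  then obtain t' u' where t': "uniformizer R t'" and u': "u' \<in> Units (ring_on R)" and \<phi>': "\<phi> = u' * t' powi n'"
    by blast
  have mem: "s \<in> (*) s ` R" for s
    using is_subringD(2)[OF R] by (auto intro!: image_eqI[of _ _ 1])
  have "(*) t ` R = (*) t' ` R"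
    using t t' by (simp add: uniformizer_def)
  then obtain w w' where w: "w \<in> R" "w' \<in> R" "t' = t * w" "t = t' * w'"
    using mem[of t] mem[of t'] by blast
  then have "w * w' = 1"
    using t_nonzero by (metis mult.assoc mult.right_neutral mult_left_cancel)
  then have wU: "w \<in> Units (ring_on R)"
    using w inverse_unique[of w w'] by (auto simp: Units_ring_on)
  have nz: "u \<noteq> 0" "u' \<noteq> 0" "w \<noteq> 0"
    using u u' wU by (auto simp: Units_ring_on)
  have "u * t powi n = u' * w powi n' * t powi n'"
    using \<phi> \<phi>' w(3) by (simp add: power_int_mult_distrib algebra_simps)
  then have "t powi (n - n') = u' * w powi n' / u"
    using nz t_nonzero by (simp add: power_int_diff field_simps)
  also have "\<dots> \<in> Units (ring_on R)"
    by (intro Units_ring_on_mult R u u' Units_ring_on_power_int wU)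
  finally show "n' = n"
    using power_int_unit_iff by simp
qed

lemma dvr_ord_unit: "u \<in> Units (ring_on R) \<Longrightarrow> dvr_ord R u = 0"
  by (rule dvr_ord_eqI[of u]) auto

lemma dvr_ord_mult:
  assumes "\<phi> \<in> frac_field R" "\<psi> \<in> frac_field R" "\<phi> \<noteq> 0" "\<psi> \<noteq> 0"
  shows "dvr_ord R (\<phi> * \<psi>) = dvr_ord R \<phi> + dvr_ord R \<psi>"
proof -
  obtain u n w m where "u \<in> Units (ring_on R)" "\<phi> = u * t powi n"
      "w \<in> Units (ring_on R)" "\<psi> = w * t powi m"
    using unit_times_power_int assms by metis
  moreover from this have "\<phi> * \<psi> = (u * w) * t powi (n + m)"
    using t_nonzero by (simp add: power_int_add algebra_simps)
  ultimately show ?thesis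
    using dvr_ord_eqI Units_ring_on_mult(1)[OF R] by metis
qed

lemma dvr_ord_add:
  assumes "\<phi> \<in> frac_field R" "\<psi> \<in> frac_field R" "\<phi> \<noteq> 0" "\<psi> \<noteq> 0" "\<phi> + \<psi> \<noteq> 0"
  shows "min (dvr_ord R \<phi>) (dvr_ord R \<psi>) \<le> dvr_ord R (\<phi> + \<psi>)"
proof -
  have *: "dvr_ord R \<phi> \<le> dvr_ord R (\<phi> + \<psi>)"
    if nz: "\<phi> \<in> frac_field R" "\<psi> \<in> frac_field R" "\<phi> \<noteq> 0" "\<psi> \<noteq> 0" "\<phi> + \<psi> \<noteq> 0"
      and le: "dvr_ord R \<phi> \<le> dvr_ord R \<psi>" for \<phi> \<psi>
  proof -
    obtain u n w m where u: "u \<in> Units (ring_on R)" "\<phi> = u * t powi n"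
        and w: "w \<in> Units (ring_on R)" "\<psi> = w * t powi m"
      using unit_times_power_int nz by metis
    have nm: "n \<le> m" "dvr_ord R \<phi> = n"
      using le dvr_ord_eqI[OF u] dvr_ord_eqI[OF w] by auto
    define r where "r = u + w * t ^ nat (m - n)"
    have "t powi m = t powi n * t ^ nat (m - n)"
      using nm(1) t_nonzero power_int_add[of t n "m - n"] by (simp add: power_int_def[of t "m - n"])
    then have sum: "\<phi> + \<psi> = r * t powi n"
      by (simp add: u(2) w(2) r_def algebra_simps)
    have "r \<in> R" "r \<noteq> 0"
      using u w is_subringD[OF R] t_in nz(5) sum by (auto simp: r_def Units_ring_on)
    then obtain s j where s: "s \<in> Units (ring_on R)" "r = s * t ^ j"
      using unit_times_power by blast
    have "\<phi> + \<psi> = s * t powi (n + int j)"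
      using sum s t_nonzero by (simp add: power_int_add algebra_simps)
    then show ?thesis
      using dvr_ord_eqI[OF s(1)] nm(2) by simp
  qed
  show ?thesis
    using *[of \<phi> \<psi>] *[of \<psi> \<phi>] assms by (auto simp: add.commute min_def)
qed

end

section \<open>Local rings of dimension one\<close>

text \<open>
  Integer values leave no room for the value \<open>\<infinity>\<close> of \<open>0\<close>, hence the side conditions.
\<close>

definition valuation_on :: "'a::field set \<Rightarrow> ('a \<Rightarrow> int) \<Rightarrow> bool" where
  "valuation_on F v \<longleftrightarrow>
     (\<forall>x\<in>F. \<forall>y\<in>F. x \<noteq> 0 \<and> y \<noteq> 0 \<longrightarrow>
        v (x * y) = v x + v y \<and> (x + y \<noteq> 0 \<longrightarrow> min (v x) (v y) \<le> v (x + y)))"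

context dvr
begin

lemma valuation_on_frac_field: "valuation_on (frac_field R) (dvr_ord R)"
  using dvr_ord_mult dvr_ord_add by (simp add: valuation_on_def)

end

context
  fixes A P :: "'a::field set"
  assumes A: "is_subring A" and P: "primeideal P (ring_on A)"
begin

text \<open>
  The extension of \<open>Q\<close> to the localization at \<open>P\<close>.
\<close>

definition extended_ideal :: "'a set \<Rightarrow> 'a set" where
  "extended_ideal Q = {a / b |a b. a \<in> Q \<and> b \<in> A - P}"

context
  fixes Q
  assumes Q: "primeideal Q (ring_on A)" "Q \<subseteq> P"
begin

lemma in_extended_ideal_iff:
  assumes "a \<in> A" "b \<in> A - P"
  shows "a / b \<in> extended_ideal Q \<longleftrightarrow> a \<in> Q"
proof
  assume "a / b \<in> extended_ideal Q"
  then obtain c d where cd: "c \<in> Q" "d \<in> A - P" "a / b = c / d"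
    by (auto simp: extended_ideal_def)
  have "b \<noteq> 0" "d \<noteq> 0"
    using cd assms notin_prime_nonzero[OF A P] by auto
  then have "d * a = b * c"
    using cd(3) by (simp add: field_simps)
  also have "\<dots> \<in> Q"
    using idealD(4)[OF primeidealD(1)[OF Q(1) A] A] cd(1) assms by auto
  finally show "a \<in> Q"
    using primeidealD(3)[OF Q(1) A, of d a] cd assms Q(2) by auto
qed (use assms in \<open>auto simp: extended_ideal_def\<close>)

lemma primeideal_extended_ideal: "primeideal (extended_ideal Q) (ring_on (localization_at A P))"
proof -
  note R = is_subring_localization[OF A P]
  note Qi = idealD[OF primeidealD(1)[OF Q(1) A] A]
  note AP = primeidealD(4)[OF P A]
  have ideal: "ideal (extended_ideal Q) (ring_on (localization_at A P))"
  proof (rule idealI'[OF R])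
    show "extended_ideal Q \<subseteq> localization_at A P"
      using Qi(1) by (auto simp: extended_ideal_def localization_at_def)
    show "0 \<in> extended_ideal Q"
      using in_extended_ideal_iff[of 0 1] Qi(2) is_subringD(1,2)[OF A] primeidealD(2)[OF P A] by simp
    fix x assume "x \<in> extended_ideal Q"
    then obtain a b where x: "a \<in> Q" "b \<in> A - P" "x = a / b"
      by (auto simp: extended_ideal_def)
    then have b0: "b \<noteq> 0"
      using notin_prime_nonzero[OF A P] by auto
    show "x + y \<in> extended_ideal Q" if y: "y \<in> extended_ideal Q" for y
    proof -
      obtain c d where y: "c \<in> Q" "d \<in> A - P" "y = c / d"
        using y by (auto simp: extended_ideal_def)
      then have "x + y = (d * a + b * c) / (b * d)"
        using notin_prime_nonzero[OF A P, of d] b0 x by (auto simp: field_simps)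
      moreover have "d * a + b * c \<in> Q" "b * d \<in> A - P"
        using x y Qi(3,4) AP[of b d] by auto
      ultimately show ?thesis
        unfolding extended_ideal_def by blast
    qed
    fix r assume "r \<in> localization_at A P"
    then obtain c d where r: "c \<in> A" "d \<in> A - P" "r = c / d"
      by (auto simp: localization_at_def)
    then have "r * x = (c * a) / (d * b)" "c * a \<in> Q" "d * b \<in> A - P"
      using x Qi(4) AP[of d b] by auto
    then show "r * x \<in> extended_ideal Q"
      unfolding extended_ideal_def by blast
  qed
  moreover have "1 \<notin> extended_ideal Q"
    using in_extended_ideal_iff[of 1 1] is_subringD(2)[OF A] primeidealD(2)[OF P A] Q(2) by auto
  moreover have "x \<in> extended_ideal Q \<or> y \<in> extended_ideal Q"
    if xR: "x \<in> localization_at A P" and yR: "y \<in> localization_at A P"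
      and xy: "x * y \<in> extended_ideal Q" for x y
  proof -
    obtain a b where x: "a \<in> A" "b \<in> A - P" "x = a / b"
      using xR by (auto simp: localization_at_def)
    obtain c d where y: "c \<in> A" "d \<in> A - P" "y = c / d"
      using yR by (auto simp: localization_at_def)
    have "(a * c) / (b * d) \<in> extended_ideal Q"
      using xy x y by simp
    then have "a * c \<in> Q"
      using in_extended_ideal_iff[of "a * c" "b * d"] AP[of b d] x y is_subringD(6)[OF A] by blast
    then show ?thesis
      using primeidealD(3)[OF Q(1) A, of a c] in_extended_ideal_iff x y by blast
  qed
  ultimately show ?thesis
    using primeideal_ring_on_iff[OF R] by blast
qed

end

lemma nonunits_localization:
  "localization_at A P - Units (ring_on (localization_at A P)) = extended_ideal P"
proof (intro Set.set_eqI iffI)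
  fix x assume "x \<in> localization_at A P - Units (ring_on (localization_at A P))"
  then show "x \<in> extended_ideal P"
    using localization_Units_iff[OF A P] by (auto simp: localization_at_def extended_ideal_def)
next
  fix x assume "x \<in> extended_ideal P"
  then obtain a b where x: "a \<in> P" "b \<in> A" "b \<notin> P" "x = a / b"
    by (auto simp: extended_ideal_def)
  then show "x \<in> localization_at A P - Units (ring_on (localization_at A P))"
    using localization_Units_iff[OF A P, of a b] localization_atI[of a A b P]
      idealD(1)[OF primeidealD(1)[OF P A] A] by auto
qed

lemma zero_primeideal_localization: "primeideal {0} (ring_on (localization_at A P))"
proof -
  note R = is_subring_localization[OF A P]
  have "ideal {0} (ring_on (localization_at A P))"
    using is_subringD(1)[OF R] by (intro idealI'[OF R]) auto
  then show ?thesis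
    by (simp add: primeideal_ring_on_iff[OF R])
qed

context
  assumes dim: "krull_dim (localization_at A P) = 1"
begin

text \<open>
  Every prime \<open>Q\<close> lies in the ideal of nonunits, so a third prime would give the chain
  \<open>0 \<subset> Q \<subset> m\<close> of length two.
\<close>

lemma dim1_prime_unique:
  assumes Q: "primeideal Q (ring_on (localization_at A P))" "Q \<noteq> {0}"
  shows "Q = extended_ideal P"
proof (rule ccontr)
  note R = is_subring_localization[OF A P]
  note Qi = idealD[OF primeidealD(1)[OF Q(1) R] R]
  assume "Q \<noteq> extended_ideal P"
  moreover have "Q \<subseteq> extended_ideal P"
  proof
    fix x assume x: "x \<in> Q"
    have "x \<notin> Units (ring_on (localization_at A P))"
    proof
      assume "x \<in> Units (ring_on (localization_at A P))"
      then have "1 \<in> Q"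
        using Qi(4)[of "inverse x" x] x by (auto simp: Units_ring_on)
      then show False
        using primeidealD(2)[OF Q(1) R] by simp
    qed
    then show "x \<in> extended_ideal P"
      using nonunits_localization Qi(1)[OF x] by blast
  qed
  moreover have "{0} \<subset> Q"
    using Qi(2) Q(2) by blast
  moreover have "primeideal (extended_ideal P) (ring_on (localization_at A P))"
    by (rule primeideal_extended_ideal[OF P order_refl])
  ultimately have "prime_chain (localization_at A P) 2
      (\<lambda>i. if i = 0 then {0} else if i = 1 then Q else extended_ideal P)"
    using Q(1) zero_primeideal_localization
    by (auto simp: prime_chain_def less_Suc_eq numeral_2_eq_2)
  then have "enat 2 \<le> krull_dim (localization_at A P)"
    unfolding krull_dim_def by (intro Sup_upper) blast
  then show False
    by (simp add: dim one_enat_def)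
qed

lemma dim1_nonunits_nonzero: "extended_ideal P \<noteq> {0}"
proof
  assume P0: "extended_ideal P = {0}"
  have "n = 0" if chain: "prime_chain (localization_at A P) n Q" for n Q
  proof (rule ccontr)
    assume "n \<noteq> 0"
    then have "primeideal (Q 0) (ring_on (localization_at A P))"
      "primeideal (Q 1) (ring_on (localization_at A P))" "Q 0 \<subset> Q 1"
      using chain by (auto simp: prime_chain_def)
    then show False
      using dim1_prime_unique P0 by blast
  qed
  then have "krull_dim (localization_at A P) \<le> 0"
    unfolding krull_dim_def by (intro Sup_least) (auto simp: zero_enat_def)
  then show False
    by (simp add: dim)
qed

text \<open>
  The extension of \<open>Q\<close> to the local ring is a nonzero prime, so it is the maximal ideal, and \<open>Q\<close> is
  recovered from its extension by contraction.
\<close>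

lemma dim1_height_one:
  assumes Q: "primeideal Q (ring_on A)" "Q \<subseteq> P" "Q \<noteq> {0}"
  shows "Q = P"
proof -
  note Qi = idealD[OF primeidealD(1)[OF Q(1) A] A]
  obtain a where a: "a \<in> Q" "a \<noteq> 0"
    using Q(3) Qi(2) by auto
  have one: "1 \<in> A - P"
    using is_subringD(2)[OF A] primeidealD(2)[OF P A] by simp
  have "a / 1 \<in> extended_ideal Q"
    using in_extended_ideal_iff[OF Q(1,2) Qi(1)[OF a(1)] one] a(1) by simp
  then have "extended_ideal Q \<noteq> {0}"
    using a(2) by auto
  then have eq: "extended_ideal Q = extended_ideal P"
    by (intro dim1_prime_unique primeideal_extended_ideal Q)
  have "x \<in> Q" if "x \<in> P" for x
    using in_extended_ideal_iff[OF Q(1,2) _ one, of x] in_extended_ideal_iff[OF P order_refl _ one, of x]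
      idealD(1)[OF primeidealD(1)[OF P A] A that] that eq by simp
  then show ?thesis
    using Q(2) by auto
qed

lemma dim1_dvr:
  assumes "noetherian A" "integrally_closed (localization_at A P)"
  shows "\<exists>t. dvr (localization_at A P) t"
proof -
  note R = is_subring_localization[OF A P]
  note noeth = noetherian_localization[OF A P assms(1)]
  have "\<exists>t. t \<noteq> 0 \<and> uniformizer (localization_at A P) t"
  proof (rule normal_dim1_uniformizer_exists[OF R noeth assms(2)], unfold nonunits_localization)
    show "ideal (extended_ideal P) (ring_on (localization_at A P))"
      by (rule primeidealD(1)[OF primeideal_extended_ideal[OF P order_refl] R])
  qed (use dim1_nonunits_nonzero dim1_prime_unique in auto)
  then show ?thesis
    using R noeth by (auto intro: dvr.intro)
qed

end

end

section \<open>Charts of a projective scheme\<close>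

lemma finite_dimension_spanning_set:
  fixes k V :: "'a::field set"
  assumes "ring.finite_dimension ring_of_type_algebra k V" and k: "is_subring k"
  shows "\<exists>T\<subseteq>V. finite T \<and> (\<forall>a\<in>V. \<exists>c. (\<forall>t\<in>T. c t \<in> k) \<and> a = (\<Sum>t\<in>T. c t * t))"
proof -
  interpret ring "ring_of_type_algebra :: 'a ring"
    by (rule ring_from_type_algebra)
  obtain n where "dimension n k V"
    using assms unfolding finite_dimension_def by auto
  then have "0 \<in> V \<and> (\<exists>T\<subseteq>V. finite T \<and> (\<forall>a\<in>V. \<exists>c. (\<forall>t\<in>T. c t \<in> k) \<and> a = (\<Sum>t\<in>T. c t * t)))"
    using k
  proof (induction rule: dimension.induct)
    case (zero_dim K)
    show ?case
      by (auto intro: exI[of _ "{}"])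
  next
    case (Suc_dim v E n K)
    then obtain T where T: "0 \<in> E" "T \<subseteq> E" "finite T"
      "\<forall>a\<in>E. \<exists>c. (\<forall>t\<in>T. c t \<in> K) \<and> a = (\<Sum>t\<in>T. c t * t)"
      by blast
    note Kr = is_subringD[OF Suc_dim.prems]
    have mem: "u \<in> line_extension K v E \<longleftrightarrow> (\<exists>c\<in>K. \<exists>e\<in>E. u = c * v + e)" for u
      by (simp add: line_extension_mem_iff)
    have "e \<in> line_extension K v E" if "e \<in> E" for e
      unfolding mem using that Kr(1) by (intro bexI[of _ 0] bexI[of _ e]) auto
    moreover have "v \<in> line_extension K v E"
      unfolding mem using T(1) Kr(2) by (intro bexI[of _ 1] bexI[of _ 0]) auto
    ultimately have "0 \<in> line_extension K v E" "insert v T \<subseteq> line_extension K v E"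
      using T(1,2) by auto
    moreover have "\<exists>c. (\<forall>t\<in>insert v T. c t \<in> K) \<and> a = (\<Sum>t\<in>insert v T. c t * t)"
      if a: "a \<in> line_extension K v E" for a
    proof -
      obtain c0 e where e: "c0 \<in> K" "e \<in> E" "a = c0 * v + e"
        using a mem by blast
      obtain c where c: "\<forall>t\<in>T. c t \<in> K" "e = (\<Sum>t\<in>T. c t * t)"
        using T(4) e(2) by blast
      have "v \<notin> T"
        using Suc_dim.hyps(2) T(2) by auto
      then have "(\<Sum>t\<in>T. (c(v := c0)) t * t) = e"
        unfolding c(2) by (intro sum.cong) auto
      then have "(\<Sum>t\<in>insert v T. (c(v := c0)) t * t) = a"
        using e(3) T(3) \<open>v \<notin> T\<close> by simp
      moreover have "\<forall>t\<in>insert v T. (c(v := c0)) t \<in> K"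
        using c(1) e(1) by simp
      ultimately show ?thesis
        by metis
    qed
    ultimately show ?case
      using T(3) by (intro conjI exI[of _ "insert v T"]) auto
  qed
  then show ?thesis ..
qed

text \<open>
  Homogeneous ideals are determined by their monomials.
\<close>

lemma monom_sum_in_ideal:
  fixes S :: "'a::field poly set"
  assumes S: "is_subring S" and I: "ideal I (ring_on S)"
    and "\<And>n. Polynomial.monom (Polynomial.coeff p n) n \<in> I"
  shows "p \<in> I"
proof -
  have "(\<Sum>i\<in>X. Polynomial.monom (Polynomial.coeff p i) i) \<in> I" for X
    by (induction X rule: infinite_finite_induct) (use idealD(2,3)[OF I S] assms(3) in auto)
  then show ?thesis
    using poly_as_sum_of_monoms[of p] by metis
qed

text \<open>
  A graded domain over a field, generated by a finite dimensional degree one part.  Both the series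
  \<open>W\<close> of the theorem and a homogeneous coordinate ring of \<open>X\<close> are of this kind.
\<close>

locale standard_graded =
  fixes F k :: "'a::field set" and S :: "'a poly set"
  assumes F: "is_subfield F" and k: "is_subfield k"
    and series: "graded_linear_series F k S" and generated: "generated_in_degree_one k S"
begin

lemma S: "is_subring S"
  using series by (simp add: graded_linear_series_def)

lemma piece_in_F: "Polynomial.monom a n \<in> S \<Longrightarrow> a \<in> F"
  using series unfolding graded_linear_series_def polys_over_def
  by (metis (mono_tags, lifting) coeff_monom mem_Collect_eq subsetD)

lemma piece_0: "Polynomial.monom c 0 \<in> S \<longleftrightarrow> c \<in> k"
  using series by (auto simp: graded_linear_series_def graded_piece_def)

lemma k_subset_F: "k \<subseteq> F"
  using piece_0 piece_in_F by blast

lemma monom_mult_in: 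
  "Polynomial.monom a m \<in> S \<Longrightarrow> Polynomial.monom b n \<in> S \<Longrightarrow> Polynomial.monom (a * b) (m + n) \<in> S"
  using is_subringD(6)[OF S] by (metis mult_monom)

lemma monom_power_in:
  "Polynomial.monom s 1 \<in> S \<Longrightarrow> Polynomial.monom (s ^ n) n \<in> S"
  using is_subringD(7)[OF S, of "Polynomial.monom s 1" n] by (simp add: monom_power)

lemma monom_shift:
  assumes "Polynomial.monom a m \<in> S" "Polynomial.monom s 1 \<in> S"
  shows "Polynomial.monom (a * s ^ n) (m + n) \<in> S"
  using monom_mult_in[OF assms(1) monom_power_in[OF assms(2)]] .

lemma S_induct [consumes 1, case_names one const linear uminus add mult]:
  assumes "p \<in> S"
    and "Q 1" "\<And>c. c \<in> k \<Longrightarrow> Q (Polynomial.monom c 0)"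
    and "\<And>a. Polynomial.monom a 1 \<in> S \<Longrightarrow> Q (Polynomial.monom a 1)"
    and "\<And>p. p \<in> S \<Longrightarrow> Q p \<Longrightarrow> Q (- p)"
    and "\<And>p q. p \<in> S \<Longrightarrow> q \<in> S \<Longrightarrow> Q p \<Longrightarrow> Q q \<Longrightarrow> Q (p + q)"
    and "\<And>p q. p \<in> S \<Longrightarrow> q \<in> S \<Longrightarrow> Q p \<Longrightarrow> Q q \<Longrightarrow> Q (p * q)"
  shows "Q p"
proof -
  have gen: "S = generate_ring ring_of_type_algebra
      ((\<lambda>c. Polynomial.monom c 0) ` k \<union> (\<lambda>a. Polynomial.monom a 1) ` graded_piece S 1)"
    using generated by (simp add: generated_in_degree_one_def)
  have "p \<in> generate_ring ring_of_type_algebra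
      ((\<lambda>c. Polynomial.monom c 0) ` k \<union> (\<lambda>a. Polynomial.monom a 1) ` graded_piece S 1)"
    using assms(1) gen by simp
  then have "Q p \<and> p \<in> S"
  proof (induction rule: generate_ring.induct)
    case (incl h)
    then have "h \<in> S"
      by (subst gen) (rule generate_ring.incl)
    then show ?case
      using incl assms(3,4) by (auto simp: graded_piece_def)
  qed (use assms is_subringD[OF S] in auto)
  then show ?thesis ..
qed

text \<open>A finite set spanning the degree one part.\<close>

definition T :: "'a set" where
  "T = (SOME T. T \<subseteq> graded_piece S 1 \<and> finite T \<and>
     (\<forall>a\<in>graded_piece S 1. \<exists>c. (\<forall>t\<in>T. c t \<in> k) \<and> a = (\<Sum>t\<in>T. c t * t)))"

lemma T: "T \<subseteq> graded_piece S 1" "finite T"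
    "Polynomial.monom a 1 \<in> S \<Longrightarrow> \<exists>c. (\<forall>t\<in>T. c t \<in> k) \<and> a = (\<Sum>t\<in>T. c t * t)"
proof -
  have "ring.finite_dimension ring_of_type_algebra k (graded_piece S 1)"
    using series by (simp add: graded_linear_series_def)
  from finite_dimension_spanning_set[OF this is_subfieldD(1)[OF k]]
  have "\<exists>T. T \<subseteq> graded_piece S 1 \<and> finite T \<and>
     (\<forall>a\<in>graded_piece S 1. \<exists>c. (\<forall>t\<in>T. c t \<in> k) \<and> a = (\<Sum>t\<in>T. c t * t))"
    by auto
  from someI_ex[OF this, folded T_def]
  show "T \<subseteq> graded_piece S 1" "finite T"
    "Polynomial.monom a 1 \<in> S \<Longrightarrow> \<exists>c. (\<forall>t\<in>T. c t \<in> k) \<and> a = (\<Sum>t\<in>T. c t * t)"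
    by (auto simp: graded_piece_def)
qed

text \<open>
  A homogeneous prime that contains \<open>T\<close> contains \<open>S\<^sub>1\<close> and therefore all of positive degree,
  because \<open>S\<close> is generated in degree one.  So the finitely many charts for \<open>s \<in> T\<close> cover \<open>Proj S\<close>.
\<close>

lemma proj_point_outside_irrelevant:
  assumes P: "P \<in> proj_points S"
  shows "\<exists>s\<in>T. Polynomial.monom s 1 \<notin> P"
proof (rule ccontr)
  assume "\<not> ?thesis"
  then have TP: "Polynomial.monom s 1 \<in> P" if "s \<in> T" for s
    using that by auto
  have "ideal P (ring_on S)"
    using P primeidealD(1)[OF _ S] by (auto simp: proj_points_def)
  note Pi = idealD[OF this S]
  have lin: "Polynomial.monom a 1 \<in> P" if a: "Polynomial.monom a 1 \<in> S" for a
  proof -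
    obtain c where c: "\<forall>t\<in>T. c t \<in> k" "a = (\<Sum>t\<in>T. c t * t)"
      using T(3)[OF a] by auto
    have "Polynomial.monom (\<Sum>t\<in>X. c t * t) 1 \<in> P" if "finite X" "X \<subseteq> T" for X
      using that
    proof (induction X rule: finite_induct)
      case (insert t X)
      have "Polynomial.monom (c t) 0 * Polynomial.monom t 1 \<in> P"
        using insert.prems c(1) TP piece_0 by (intro Pi(4)) auto
      then show ?case
        using insert Pi(3) by (simp add: mult_monom add_monom[symmetric])
    qed (use Pi(2) in simp)
    then show ?thesis
      using c(2) T(2) by auto
  qed
  have const: "Polynomial.monom (Polynomial.coeff p 0) 0 \<in> S" if "p \<in> S" for p
    using series that by (auto simp: graded_linear_series_def homogeneous_def)
  have "p - Polynomial.monom (Polynomial.coeff p 0) 0 \<in> P" if "p \<in> S" for p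
    using that
  proof (induction rule: S_induct)
    case (mult p q)
    let ?c = "Polynomial.monom (Polynomial.coeff p 0) 0" and ?d = "Polynomial.monom (Polynomial.coeff q 0) 0"
    have "q * (p - ?c) + ?c * (q - ?d) \<in> P"
      using mult const by (intro Pi(3,4)) auto
    then show ?case
      by (simp add: algebra_simps coeff_mult mult_monom)
  next
    case (add p q)
    then have "(p - Polynomial.monom (Polynomial.coeff p 0) 0) + (q - Polynomial.monom (Polynomial.coeff q 0) 0) \<in> P"
      by (intro Pi(3))
    then show ?case
      by (simp add: algebra_simps add_monom[symmetric])
  next
    case (uminus p)
    then have "- (p - Polynomial.monom (Polynomial.coeff p 0) 0) \<in> P"
      by (intro Pi(5))
    then show ?case
      by (simp add: minus_monom[symmetric])
  qed (use lin Pi(2) in \<open>auto simp: monom_0 one_pCons\<close>)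
  then have "{p \<in> S. Polynomial.coeff p 0 = 0} \<subseteq> P"
    by fastforce
  then show False
    using P by (simp add: proj_points_def)
qed

text \<open>
  The coordinate ring of the affine open set of \<open>Proj S\<close> where \<open>s \<in> S\<^sub>1\<close> does not vanish, and the prime
  of this ring that belongs to the homogeneous prime \<open>P\<close>.
\<close>

definition chart :: "'a \<Rightarrow> 'a set" where
  "chart s = {a / s ^ n |a n. Polynomial.monom a n \<in> S}"

definition chart_prime :: "'a \<Rightarrow> 'a poly set \<Rightarrow> 'a set" where
  "chart_prime s P = {a / s ^ n |a n. Polynomial.monom a n \<in> P}"

lemma chartI: "Polynomial.monom a n \<in> S \<Longrightarrow> a / s ^ n \<in> chart s"
  by (auto simp: chart_def)

context
  fixes s assumes s: "Polynomial.monom s 1 \<in> S" "s \<noteq> 0"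
begin

lemma is_subring_chart: "is_subring (chart s)"
proof (rule is_subringI)
  show "1 \<in> chart s"
    using chartI[of 1 0 s] is_subringD(2)[OF S] by simp
  fix x assume "x \<in> chart s"
  then obtain a n where x: "Polynomial.monom a n \<in> S" "x = a / s ^ n"
    by (auto simp: chart_def)
  show "- x \<in> chart s"
    using chartI[of "- a" n s] is_subringD(3)[OF S x(1)] x by (simp add: minus_monom)
  fix y assume "y \<in> chart s"
  then obtain b m where y: "Polynomial.monom b m \<in> S" "y = b / s ^ m"
    by (auto simp: chart_def)
  show "x * y \<in> chart s"
    using chartI[OF monom_mult_in[OF x(1) y(1)]] x y by (simp add: power_add)
  have "Polynomial.monom (a * s ^ m + b * s ^ n) (n + m) \<in> S"
    using is_subringD(4)[OF S monom_shift[OF x(1) s(1), of m] monom_shift[OF y(1) s(1), of n]]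
    by (simp add: add.commute add_monom)
  then have "(a * s ^ m + b * s ^ n) / s ^ (n + m) \<in> chart s"
    by (rule chartI)
  then show "x + y \<in> chart s"
    using x y s(2) by (simp add: power_add add_frac_eq)
qed

lemma k_subset_chart: "k \<subseteq> chart s"
  using chartI[of _ 0 s] piece_0 by auto

text \<open>
  The chart is generated over \<open>k\<close> by the finitely many quotients \<open>t / s\<close> with \<open>t \<in> T\<close>.
\<close>

lemma noetherian_chart: "noetherian (chart s)"
proof -
  let ?B = "generate_ring ring_of_type_algebra (k \<union> (\<lambda>t. t / s) ` T)"
  note B = is_subringD[OF is_subring_generate_ring[of "k \<union> (\<lambda>t. t / s) ` T"]]
  have kB: "c \<in> ?B" if "c \<in> k" for c
    using that by (auto intro: generate_ring.incl)
  have coeffs: "\<forall>n. Polynomial.coeff p n / s ^ n \<in> ?B" if "p \<in> S" for p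
    using that
  proof (induction rule: S_induct)
    case one
    then show ?case
      using B(1,2) by (simp add: coeff_1)
  next
    case (const c)
    then show ?case
      using B(1) kB by simp
  next
    case (linear a)
    then obtain c where c: "\<forall>t\<in>T. c t \<in> k" "a = (\<Sum>t\<in>T. c t * t)"
      using T(3) by blast
    have tB: "t / s \<in> ?B" if "t \<in> T" for t
      using that by (auto intro: generate_ring.incl)
    have "a / s = (\<Sum>t\<in>T. c t * (t / s))"
      unfolding c(2) by (simp add: sum_divide_distrib)
    also have "\<dots> \<in> ?B"
      using c(1) kB tB by (intro is_subring_sum is_subring_generate_ring B(6)) blast+
    finally show ?case
      using B(1) by simp
  next
    case (uminus p)
    then show ?case
      using B(3) by simp
  next
    case (add p q)
    then show ?case
      using B(4) by (simp add: add_divide_distrib)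
  next
    case (mult p q)
    have "Polynomial.coeff (p * q) n / s ^ n =
        (\<Sum>i\<le>n. (Polynomial.coeff p i / s ^ i) * (Polynomial.coeff q (n - i) / s ^ (n - i)))" for n
      unfolding coeff_mult sum_divide_distrib
      by (intro sum.cong) (auto simp flip: power_add)
    then show ?case
      using mult by (simp only:) (intro allI is_subring_sum is_subring_generate_ring B(6); simp)
  qed
  have "a / s ^ n \<in> ?B" if "Polynomial.monom a n \<in> S" for a n
    using coeffs[OF that, THEN spec[of _ n]] by simp
  then have "chart s \<subseteq> ?B"
    unfolding chart_def by blast
  moreover have "?B \<subseteq> chart s"
  proof (rule generate_ring_least[OF is_subring_chart])
    have "t / s \<in> chart s" if "t \<in> T" for t
      using chartI[of t 1 s] T(1) that by (auto simp: graded_piece_def)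
    then show "k \<union> (\<lambda>t. t / s) ` T \<subseteq> chart s"
      using k_subset_chart by auto
  qed
  ultimately show ?thesis
    using noetherian_finitely_generated[OF k, of "(\<lambda>t. t / s) ` T"] T(2) by simp
qed

lemma frac_field_chart: "homogeneous_localization S {0} \<subseteq> frac_field (chart s)"
proof
  fix x assume "x \<in> homogeneous_localization S {0}"
  then obtain a b n where x: "x = a / b" "Polynomial.monom a n \<in> S" "Polynomial.monom b n \<in> S" "b \<noteq> 0"
    by (auto simp: homogeneous_localization_def)
  then have "x = (a / s ^ n) / (b / s ^ n)" "b / s ^ n \<noteq> 0"
    using s(2) by auto
  then show "x \<in> frac_field (chart s)"
    using chartI x(2,3) unfolding frac_field_def by blast
qed

context
  fixes P assumes P: "P \<in> proj_points S" and sP: "Polynomial.monom s 1 \<notin> P"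
begin

lemma P_prime: "primeideal P (ring_on S)" and P_ideal: "ideal P (ring_on S)"
  using P primeidealD(1)[OF _ S] by (auto simp: proj_points_def)

lemma power_notin_P: "Polynomial.monom (s ^ n) n \<notin> P"
proof (induction n)
  case 0
  then show ?case
    using primeidealD(2)[OF P_prime S] by (simp add: monom_0 one_pCons)
next
  case (Suc n)
  then have "Polynomial.monom s 1 * Polynomial.monom (s ^ n) n \<notin> P"
    using primeidealD(3)[OF P_prime S] sP s(1) monom_power_in by blast
  then show ?case
    by (simp add: mult_monom)
qed

text \<open>
  Membership does not depend on how an element is written as a fraction, since \<open>s \<notin> P\<close> can be
  cancelled from an element of \<open>P\<close>.
\<close>

lemma in_chart_prime_iff:
  assumes a: "Polynomial.monom a n \<in> S"
  shows "a / s ^ n \<in> chart_prime s P \<longleftrightarrow> Polynomial.monom a n \<in> P"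
proof
  assume "a / s ^ n \<in> chart_prime s P"
  then obtain b m where b: "Polynomial.monom b m \<in> P" "a / s ^ n = b / s ^ m"
    by (auto simp: chart_prime_def)
  then have "Polynomial.monom a n * Polynomial.monom (s ^ m) m = Polynomial.monom (s ^ n) n * Polynomial.monom b m"
    using s(2) by (simp add: mult_monom field_simps)
  also have "\<dots> \<in> P"
    using b(1) monom_power_in[OF s(1)] idealD(4)[OF P_ideal S] by blast
  finally show "Polynomial.monom a n \<in> P"
    using primeidealD(3)[OF P_prime S a monom_power_in[OF s(1)]] power_notin_P by blast
qed (auto simp: chart_prime_def)

lemma primeideal_chart_prime: "primeideal (chart_prime s P) (ring_on (chart s))"
  unfolding primeideal_ring_on_iff[OF is_subring_chart]
proof (intro conjI ballI impI)
  note Pi = idealD[OF P_ideal S]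
  show "ideal (chart_prime s P) (ring_on (chart s))"
  proof (rule idealI'[OF is_subring_chart])
    show "chart_prime s P \<subseteq> chart s"
      using Pi(1) by (auto simp: chart_prime_def chart_def)
    show "0 \<in> chart_prime s P"
      using in_chart_prime_iff[of 0 0] Pi(2) is_subringD(1)[OF S] by simp
    fix x assume "x \<in> chart_prime s P"
    then obtain a n where x: "Polynomial.monom a n \<in> P" "x = a / s ^ n"
      by (auto simp: chart_prime_def)
    show "x + y \<in> chart_prime s P" if y: "y \<in> chart_prime s P" for y
    proof -
      obtain b m where y: "Polynomial.monom b m \<in> P" "y = b / s ^ m"
        using y by (auto simp: chart_prime_def)
      have "Polynomial.monom (s ^ m) m * Polynomial.monom a n
          + Polynomial.monom (s ^ n) n * Polynomial.monom b m \<in> P"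
        using x y monom_power_in[OF s(1)] by (intro Pi(3,4)) auto
      then have "Polynomial.monom (a * s ^ m + b * s ^ n) (n + m) \<in> P"
        by (simp add: mult_monom add_monom ac_simps)
      then have "(a * s ^ m + b * s ^ n) / s ^ (n + m) \<in> chart_prime s P"
        by (auto simp: chart_prime_def)
      then show ?thesis
        using x y s(2) by (simp add: power_add add_frac_eq)
    qed
    fix r assume "r \<in> chart s"
    then obtain b m where r: "Polynomial.monom b m \<in> S" "r = b / s ^ m"
      by (auto simp: chart_def)
    then have "Polynomial.monom (b * a) (m + n) \<in> P"
      using Pi(4)[OF r(1) x(1)] by (simp add: mult_monom)
    then have "(b * a) / s ^ (m + n) \<in> chart_prime s P"
      by (auto simp: chart_prime_def)
    then show "r * x \<in> chart_prime s P"
      using r x by (simp add: power_add)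
  qed
  show "1 \<notin> chart_prime s P"
    using in_chart_prime_iff[of 1 0] is_subringD(2)[OF S] primeidealD(2)[OF P_prime S]
    by (simp add: monom_0 one_pCons)
  fix x y assume "x \<in> chart s" "y \<in> chart s" and xy: "x * y \<in> chart_prime s P"
  then obtain a n b m where x: "Polynomial.monom a n \<in> S" "x = a / s ^ n"
    and y: "Polynomial.monom b m \<in> S" "y = b / s ^ m"
    by (auto simp: chart_def)
  have "(a * b) / s ^ (n + m) \<in> chart_prime s P"
    using xy x y by (simp add: power_add)
  then have "Polynomial.monom a n * Polynomial.monom b m \<in> P"
    using in_chart_prime_iff[OF monom_mult_in[OF x(1) y(1)]] by (simp add: mult_monom)
  then show "x \<in> chart_prime s P \<or> y \<in> chart_prime s P"
    using primeidealD(3)[OF P_prime S x(1) y(1)] in_chart_prime_iff x y by blast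
qed

text \<open>
  This presents the local rings of \<open>Proj S\<close> as localizations of noetherian rings.
\<close>

lemma homogeneous_localization_eq:
  "homogeneous_localization S P = localization_at (chart s) (chart_prime s P)"
proof (intro Set.set_eqI iffI)
  fix x assume "x \<in> homogeneous_localization S P"
  then obtain a b n where x: "x = a / b" "Polynomial.monom a n \<in> S" "Polynomial.monom b n \<in> S - P"
    by (auto simp: homogeneous_localization_def)
  then have "x = (a / s ^ n) / (b / s ^ n)"
    using s(2) by simp
  then show "x \<in> localization_at (chart s) (chart_prime s P)"
    using chartI x(2,3) in_chart_prime_iff[of b n] by (metis DiffD1 DiffD2 localization_atI)
next
  fix x assume "x \<in> localization_at (chart s) (chart_prime s P)"
  then obtain a n b m where x: "x = (a / s ^ n) / (b / s ^ m)" "Polynomial.monom a n \<in> S"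
    "Polynomial.monom b m \<in> S" "b / s ^ m \<notin> chart_prime s P"
    by (auto simp: localization_at_def chart_def)
  then have "Polynomial.monom (s ^ n) n * Polynomial.monom b m \<notin> P"
    using primeidealD(3)[OF P_prime S monom_power_in[OF s(1)] x(3)] power_notin_P in_chart_prime_iff[OF x(3)]
    by blast
  moreover have "Polynomial.monom (s ^ n) n * Polynomial.monom b m = Polynomial.monom (b * s ^ n) (m + n)"
    by (simp add: mult_monom mult.commute add.commute)
  ultimately have "Polynomial.monom (b * s ^ n) (m + n) \<in> S - P"
    using monom_shift[OF x(3) s(1)] by simp
  moreover have "Polynomial.monom (a * s ^ m) (m + n) \<in> S"
    using monom_shift[OF x(2) s(1), of m] by (simp add: ac_simps)
  moreover have "x = (a * s ^ m) / (b * s ^ n)"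
    using x(1) by simp
  ultimately show "x \<in> homogeneous_localization S P"
    unfolding homogeneous_localization_def by blast
qed

end

lemma chart_prime_inject:
  assumes P: "P \<in> proj_points S" "Polynomial.monom s 1 \<notin> P"
    and Q: "Q \<in> proj_points S" "Polynomial.monom s 1 \<notin> Q"
    and eq: "chart_prime s P = chart_prime s Q"
  shows "P = Q"
proof -
  have *: "P \<subseteq> Q" if P: "P \<in> proj_points S" "Polynomial.monom s 1 \<notin> P"
    and Q: "Q \<in> proj_points S" "Polynomial.monom s 1 \<notin> Q"
    and eq: "chart_prime s P = chart_prime s Q" for P Q
  proof
    fix p assume p: "p \<in> P"
    show "p \<in> Q"
    proof (rule monom_sum_in_ideal[OF S P_ideal[OF Q]])
      fix n
      have m: "Polynomial.monom (Polynomial.coeff p n) n \<in> P"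
        using P(1) p by (auto simp: proj_points_def homogeneous_def)
      then have "Polynomial.monom (Polynomial.coeff p n) n \<in> S"
        using idealD(1)[OF P_ideal[OF P] S] by blast
      then show "Polynomial.monom (Polynomial.coeff p n) n \<in> Q"
        using in_chart_prime_iff[OF P] in_chart_prime_iff[OF Q] m eq by blast
    qed
  qed
  show ?thesis
    using *[OF P Q eq] *[OF Q P eq[symmetric]] by blast
qed

end

lemma topspace_Proj: "points (Proj S) \<subseteq> proj_points S"
  by (auto simp: Proj_def topology_generated_by_topspace)

lemma stalk_Proj:
  assumes P: "P \<in> points (Proj S)"
  shows "stalk (Proj S) P = homogeneous_localization S P"
proof (intro Set.set_eqI iffI)
  fix x assume "x \<in> stalk (Proj S) P"
  then show "x \<in> homogeneous_localization S P"
    by (auto simp: stalk_def Proj_def)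
next
  fix x assume "x \<in> homogeneous_localization S P"
  then obtain a b n where x: "x = a / b" "Polynomial.monom a n \<in> S" "Polynomial.monom b n \<in> S" "Polynomial.monom b n \<notin> P"
    by (auto simp: homogeneous_localization_def)
  have PP: "P \<in> proj_points S"
    using P topspace_Proj by blast
  obtain s where "s \<in> T" and sP: "Polynomial.monom s 1 \<notin> P"
    using proj_point_outside_irrelevant[OF PP] by blast
  have sS: "Polynomial.monom s 1 \<in> S"
    using T(1) \<open>s \<in> T\<close> by (auto simp: graded_piece_def)
  have "primeideal P (ring_on S)"
    using PP by (simp add: proj_points_def)
  note Pr = primeidealD[OF this S]
  have "s \<noteq> 0"
    using sP idealD(2)[OF Pr(1) S] by auto
  \<comment> \<open>Expanding the fraction by \<open>s\<close> makes the degree positive, as the basic open sets require.\<close>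
  have bs: "Polynomial.monom (b * s) (n + 1) \<notin> P"
    using Pr(3)[OF x(3) sS] x(4) sP by (auto simp: mult_monom)
  have abS: "Polynomial.monom (a * s) (n + 1) \<in> S" "Polynomial.monom (b * s) (n + 1) \<in> S"
    using monom_mult_in[OF x(2) sS] monom_mult_in[OF x(3) sS] by auto
  let ?U = "{Q \<in> proj_points S. Polynomial.monom (b * s) (n + 1) \<notin> Q}"
  have "x = (a * s) / (b * s)"
    using x(1) \<open>s \<noteq> 0\<close> by simp
  then have "x \<in> homogeneous_localization S Q" if "Q \<in> ?U" for Q
    using abS that unfolding homogeneous_localization_def by blast
  then have "x \<in> sections (Proj S) ?U"
    by (simp add: Proj_def)
  moreover have "openin (space_of (Proj S)) ?U"
    using abS(2) unfolding Proj_def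
    by (auto intro!: topology_generated_by_Basis exI[of _ "b * s"] exI[of _ "n + 1"])
  ultimately show "x \<in> stalk (Proj S) P"
    using PP bs unfolding stalk_def by blast
qed

end

lemma stalk_iso:
  assumes h: "iso_over_rat_field X Y h" and x: "x \<in> points X"
  shows "stalk X x = stalk Y (h x)"
proof -
  have hom: "homeomorphic_map (space_of X) (space_of Y) h"
    and sec: "\<And>U. nonempty_open X U \<Longrightarrow> sections Y (h ` U) = sections X U"
    using h by (auto simp: iso_over_rat_field_def)
  have inj: "inj_on h (points X)" and surj: "h ` points X = points Y"
    using homeomorphic_imp_injective_map[OF hom] homeomorphic_imp_surjective_map[OF hom] .
  show ?thesis
  proof (intro Set.set_eqI iffI)
    fix y assume "y \<in> stalk X x"
    then obtain U where U: "openin (space_of X) U" "x \<in> U" "y \<in> sections X U"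
      by (auto simp: stalk_def)
    have "openin (space_of Y) (h ` U)"
      using homeomorphic_map_openness[OF hom] U(1) openin_subset by blast
    moreover have "sections Y (h ` U) = sections X U"
      using sec U by blast
    ultimately show "y \<in> stalk Y (h x)"
      using U unfolding stalk_def by blast
  next
    fix y assume "y \<in> stalk Y (h x)"
    then obtain V where V: "openin (space_of Y) V" "h x \<in> V" "y \<in> sections Y V"
      by (auto simp: stalk_def)
    define U where "U = {z \<in> points X. h z \<in> V}"
    have "h ` U = V"
      using surj openin_subset[OF V(1)] by (auto simp: U_def)
    moreover have "openin (space_of X) U"
      using homeomorphic_map_openness[OF hom, of U] V(1) \<open>h ` U = V\<close> by (auto simp: U_def)
    moreover have "x \<in> U"
      using x V(2) by (simp add: U_def)
    ultimately have "y \<in> sections X U" "openin (space_of X) U" "x \<in> U"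
      using sec[of U] V(3) by auto
    then show "y \<in> stalk X x"
      unfolding stalk_def by blast
  qed
qed

section \<open>The orders of vanishing of a normal projective scheme\<close>

lemma valuation_on_subset: "valuation_on F v \<Longrightarrow> E \<subseteq> F \<Longrightarrow> valuation_on E v"
  unfolding valuation_on_def by blast

locale normal_projective =
  fixes X :: "('x, 'b::field) ratspace" and k :: "'b set" and S :: "'b poly set" and h
  assumes integral: "integral_scheme X" and normal: "normal_scheme X"
    and k: "is_subfield k"
    and series: "graded_linear_series (rat_field X) k S"
    and generated: "generated_in_degree_one k S"
    and iso: "iso_over_rat_field X (Proj S) h"
begin

sublocale standard_graded "rat_field X" k S
proof (rule standard_graded.intro)
  show "is_subfield (rat_field X)"
    using integral unfolding integral_scheme_def integral_ringed_space_def by (elim conjE)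
qed (fact k series generated)+

lemma h_inj: "inj_on h (points X)"
  using iso homeomorphic_imp_injective_map by (auto simp: iso_over_rat_field_def)

lemma h_proj_point: "x \<in> points X \<Longrightarrow> h x \<in> points (Proj S)"
  using iso homeomorphic_imp_surjective_map[of "space_of X" "space_of (Proj S)" h]
  by (auto simp: iso_over_rat_field_def)

text \<open>The points of codimension one in the chart where the section \<open>s\<close> does not vanish.\<close>

definition chart_points :: "'b \<Rightarrow> 'x set" where
  "chart_points s = {x \<in> codim1_points X. Polynomial.monom s 1 \<notin> h x}"

lemma codim1_covered: "codim1_points X = (\<Union>s\<in>T. chart_points s)"
proof -
  have "\<exists>s\<in>T. Polynomial.monom s 1 \<notin> h x" if "x \<in> codim1_points X" for x
  proof (rule proj_point_outside_irrelevant)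
    show "h x \<in> proj_points S"
      using that h_proj_point[of x] topspace_Proj by (auto simp: codim1_points_def)
  qed
  then show ?thesis
    by (auto simp: chart_points_def)
qed

context
  fixes s x
  assumes s: "s \<in> T" and x: "x \<in> chart_points s"
begin

lemma chart_point:
  shows "Polynomial.monom s 1 \<in> S" "s \<noteq> 0" "h x \<in> proj_points S" "Polynomial.monom s 1 \<notin> h x"
    and "x \<in> points X"
proof -
  show X: "x \<in> points X" and nx: "Polynomial.monom s 1 \<notin> h x"
    using x by (auto simp: chart_points_def codim1_points_def)
  show P: "h x \<in> proj_points S"
    using h_proj_point[OF X] topspace_Proj by auto
  show "Polynomial.monom s 1 \<in> S"
    using s T(1) by (auto simp: graded_piece_def)
  have "0 \<in> h x"
    using P idealD(2)[OF primeidealD(1)[OF _ S] S] by (auto simp: proj_points_def)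
  then show "s \<noteq> 0"
    using nx by auto
qed

lemma chart_prime: "primeideal (chart_prime s (h x)) (ring_on (chart s))"
  by (rule primeideal_chart_prime) (use chart_point in auto)

lemma stalk_eq: "stalk X x = localization_at (chart s) (chart_prime s (h x))"
  using stalk_iso[OF iso chart_point(5)] stalk_Proj[OF h_proj_point[OF chart_point(5)]]
    homogeneous_localization_eq[OF chart_point(1-4)] by simp

lemma dim_stalk: "krull_dim (localization_at (chart s) (chart_prime s (h x))) = 1"
  using x stalk_eq by (simp add: chart_points_def codim1_points_def)

lemma stalk_dvr: "\<exists>t. dvr (stalk X x) t"
  unfolding stalk_eq
proof (rule dim1_dvr[OF is_subring_chart chart_prime dim_stalk noetherian_chart])
  show "integrally_closed (localization_at (chart s) (chart_prime s (h x)))"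
    using normal chart_point(5) unfolding normal_scheme_def stalk_eq[symmetric] by blast
qed (use chart_point in auto)

lemma chart_subset_stalk: "chart s \<subseteq> stalk X x"
  unfolding stalk_eq by (rule subset_localization[OF is_subring_chart chart_prime]) (use chart_point in auto)

lemma rat_field_eq: "rat_field X = homogeneous_localization S {0}"
  using iso by (simp add: iso_over_rat_field_def Proj_def)

lemma rat_field_chart: "rat_field X \<subseteq> frac_field (chart s)"
  using frac_field_chart[OF chart_point(1,2)] rat_field_eq by simp

lemma chart_unit:
  assumes "a \<in> chart s" "a \<notin> chart_prime s (h x)"
  shows "a \<in> Units (ring_on (stalk X x))"
  unfolding stalk_eq
  using localization_Units_iff[OF is_subring_chart chart_prime, of a 1] assms chart_point(1,2)
    is_subringD(2)[OF is_subring_chart] primeidealD(2)[OF chart_prime is_subring_chart] by simp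

lemma valuation_stalk: "valuation_on (rat_field X) (dvr_ord (stalk X x))"
proof -
  obtain t where "dvr (stalk X x) t"
    using stalk_dvr by blast
  then have "valuation_on (frac_field (stalk X x)) (dvr_ord (stalk X x))"
    by (rule dvr.valuation_on_frac_field)
  moreover have "frac_field (chart s) \<subseteq> frac_field (stalk X x)"
    using chart_subset_stalk unfolding frac_field_def by blast
  ultimately show ?thesis
    using rat_field_chart valuation_on_subset by blast
qed

lemma ord_chart_zero:
  assumes "a \<in> chart s" "a \<notin> chart_prime s (h x)"
  shows "dvr_ord (stalk X x) a = 0"
  using stalk_dvr dvr.dvr_ord_unit chart_unit[OF assms] by blast

lemma ord_constant:
  assumes c: "c \<in> k" "c \<noteq> 0"
  shows "dvr_ord (stalk X x) c = 0"
proof (rule ord_chart_zero)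
  note A = is_subring_chart[OF chart_point(1,2)]
  have ck: "c \<in> chart s" "inverse c \<in> chart s"
    using k_subset_chart[OF chart_point(1,2)] c is_subfieldD(2)[OF k] by auto
  then show "c \<in> chart s"
    by simp
  show "c \<notin> chart_prime s (h x)"
  proof
    assume "c \<in> chart_prime s (h x)"
    then have "inverse c * c \<in> chart_prime s (h x)"
      by (rule idealD(4)[OF primeidealD(1)[OF chart_prime A] A ck(2)])
    then show False
      using c(2) primeidealD(2)[OF chart_prime A] by simp
  qed
qed

end

text \<open>
  A point of codimension one where \<open>a\<close> vanishes corresponds to a height one prime of the chart
  containing \<open>a\<close>, that is, to one of the finitely many minimal primes over \<open>a\<close>.
\<close>

lemma finite_chart_zeros:
  assumes s: "s \<in> T" and a: "a \<in> chart s" "a \<noteq> 0"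
  shows "finite {x \<in> chart_points s. dvr_ord (stalk X x) a \<noteq> 0}"
proof (cases "chart_points s = {}")
  case False
  then obtain x0 where "x0 \<in> chart_points s"
    by auto
  note sS = chart_point(1,2)[OF s this]
  note A = is_subring_chart[OF sS]
  let ?I = "{0 + r * a |r. r \<in> chart s}"
  have I: "ideal ?I (ring_on (chart s))" "a \<in> ?I"
  proof -
    have "ideal {0} (ring_on (chart s))"
      using is_subringD(1)[OF A] by (intro idealI'[OF A]) auto
    from ideal_extend(1,3)[OF A this a(1)]
    show "ideal ?I (ring_on (chart s))" "a \<in> ?I"
      by simp_all
  qed
  obtain \<P> where fin: "finite \<P>"
    and \<P>: "\<forall>P\<in>\<P>. primeideal P (ring_on (chart s)) \<and> ?I \<subseteq> P"
      "\<forall>Q. primeideal Q (ring_on (chart s)) \<and> ?I \<subseteq> Q \<longrightarrow> (\<exists>P\<in>\<P>. P \<subseteq> Q)"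
    using noetherian_minimal_primes_finite[OF A noetherian_chart[OF sS] I(1)] by (elim exE conjE)
  let ?Z = "{x \<in> chart_points s. dvr_ord (stalk X x) a \<noteq> 0}"
  have "chart_prime s (h x) \<in> \<P>" if x: "x \<in> ?Z" for x
  proof -
    have xs: "x \<in> chart_points s"
      using x by simp
    note prime = chart_prime[OF s xs]
    have "a \<in> chart_prime s (h x)"
      using x ord_chart_zero[OF s xs a(1)] by auto
    then have "?I \<subseteq> chart_prime s (h x)"
      using idealD(4)[OF primeidealD(1)[OF prime A] A] by auto
    then obtain P where P: "P \<in> \<P>" "P \<subseteq> chart_prime s (h x)"
      using \<P>(2) prime by blast
    have "primeideal P (ring_on (chart s))" "P \<noteq> {0}"
      using \<P>(1) P(1) I(2) a(2) by blast+
    then have "P = chart_prime s (h x)"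
      using dim1_height_one[OF A prime dim_stalk[OF s xs]] P(2) by blast
    then show ?thesis
      using P(1) by simp
  qed
  moreover have "inj_on (\<lambda>x. chart_prime s (h x)) ?Z"
  proof (rule inj_onI)
    fix x y assume xy: "x \<in> ?Z" "y \<in> ?Z" "chart_prime s (h x) = chart_prime s (h y)"
    then have x: "x \<in> chart_points s" and y: "y \<in> chart_points s"
      by auto
    have "h x = h y"
      using chart_prime_inject[OF sS chart_point(3,4)[OF s x] chart_point(3,4)[OF s y] xy(3)] .
    then show "x = y"
      using h_inj chart_point(5)[OF s x] chart_point(5)[OF s y] by (auto dest: inj_onD)
  qed
  ultimately show ?thesis
    using fin by (intro inj_on_finite[of _ ?Z \<P>]) auto
qed simp

lemma valuation_ord: "x \<in> codim1_points X \<Longrightarrow> valuation_on (rat_field X) (dvr_ord (stalk X x))"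
  using codim1_covered valuation_stalk by auto

lemma ord_constant_zero: "x \<in> codim1_points X \<Longrightarrow> c \<in> k \<Longrightarrow> c \<noteq> 0 \<Longrightarrow> dvr_ord (stalk X x) c = 0"
  using codim1_covered ord_constant by auto

text \<open>
  On each of the finitely many charts, \<open>\<phi>\<close> is a quotient \<open>a / b\<close> of elements of the chart, and its
  zeros and poles are among the zeros of \<open>a\<close> and \<open>b\<close>.
\<close>

lemma finite_zeros_poles:
  assumes \<phi>: "\<phi> \<in> rat_field X" "\<phi> \<noteq> 0"
  shows "finite {x \<in> codim1_points X. dvr_ord (stalk X x) \<phi> \<noteq> 0}"
proof -
  have "finite {x \<in> chart_points s. dvr_ord (stalk X x) \<phi> \<noteq> 0}" if s: "s \<in> T" for s
  proof (cases "chart_points s = {}")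
    case False
    then obtain x0 where x0: "x0 \<in> chart_points s"
      by auto
    obtain a b where ab: "\<phi> = a / b" "a \<in> chart s" "b \<in> chart s" "b \<noteq> 0"
      using rat_field_chart[OF s x0] \<phi>(1) by (auto simp: frac_field_def)
    have a: "a \<noteq> 0" "a = \<phi> * b"
      using ab \<phi>(2) by auto
    have "dvr_ord (stalk X x) \<phi> = 0"
      if x: "x \<in> chart_points s" "dvr_ord (stalk X x) a = 0" "dvr_ord (stalk X x) b = 0" for x
    proof -
      obtain t where t: "dvr (stalk X x) t"
        using stalk_dvr[OF s x(1)] by blast
      have sub: "frac_field (chart s) \<subseteq> frac_field (stalk X x)"
        using chart_subset_stalk[OF s x(1)] unfolding frac_field_def by blast
      have "1 \<in> chart s"
        using is_subringD(2)[OF is_subring_chart[OF chart_point(1,2)[OF s x(1)]]] .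
      then have "b \<in> frac_field (chart s)" "\<phi> \<in> frac_field (chart s)"
        using ab unfolding frac_field_def by (force, blast)
      then have "dvr_ord (stalk X x) (\<phi> * b) = dvr_ord (stalk X x) \<phi> + dvr_ord (stalk X x) b"
        using dvr.dvr_ord_mult[OF t] sub \<phi>(2) ab(4) by blast
      then show ?thesis
        using x(2,3) a(2) by simp
    qed
    then have "{x \<in> chart_points s. dvr_ord (stalk X x) \<phi> \<noteq> 0} \<subseteq>
        {x \<in> chart_points s. dvr_ord (stalk X x) a \<noteq> 0} \<union>
        {x \<in> chart_points s. dvr_ord (stalk X x) b \<noteq> 0}"
      by blast
    then show ?thesis
      using finite_chart_zeros[OF s ab(2) a(1)] finite_chart_zeros[OF s ab(3,4)]
      by (auto intro: finite_subset)
  qed simp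
  moreover have "{x \<in> codim1_points X. dvr_ord (stalk X x) \<phi> \<noteq> 0} =
      (\<Union>s\<in>T. {x \<in> chart_points s. dvr_ord (stalk X x) \<phi> \<noteq> 0})"
    using codim1_covered by auto
  ultimately show ?thesis
    using T(2) by simp
qed

end

section \<open>Gauss extensions of valuations\<close>

text \<open>
  The elements of value at least \<open>m\<close>, where \<open>0\<close> has infinite value.
\<close>

definition vball :: "('a::field \<Rightarrow> int) \<Rightarrow> int \<Rightarrow> 'a set" where
  "vball v m = {z. z = 0 \<or> m \<le> v z}"

lemma vball_antimono: "m \<le> n \<Longrightarrow> vball v n \<subseteq> vball v m"
  by (auto simp: vball_def)

lemma zero_in_vball [simp]: "0 \<in> vball v m"
  by (simp add: vball_def)

locale valued_field =
  fixes F :: "'a::field set" and v :: "'a \<Rightarrow> int"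
  assumes F: "is_subfield F" and v: "valuation_on F v"
begin

lemmas Fr = is_subringD[OF is_subfieldD(1)[OF F]]

lemma v_mult: "x \<in> F \<Longrightarrow> y \<in> F \<Longrightarrow> x \<noteq> 0 \<Longrightarrow> y \<noteq> 0 \<Longrightarrow> v (x * y) = v x + v y"
  using v by (simp add: valuation_on_def)

lemma v_add: "x \<in> F \<Longrightarrow> y \<in> F \<Longrightarrow> x \<noteq> 0 \<Longrightarrow> y \<noteq> 0 \<Longrightarrow> x + y \<noteq> 0 \<Longrightarrow> min (v x) (v y) \<le> v (x + y)"
  using v by (simp add: valuation_on_def)

lemma v_one: "v 1 = 0"
  using v_mult[of 1 1] Fr(2) by simp

lemma v_uminus: "x \<in> F \<Longrightarrow> v (- x) = v x"
proof (cases "x = 0")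
  case False
  assume x: "x \<in> F"
  have "v (- 1) = 0"
    using v_mult[of "- 1" "- 1"] v_one Fr(2,3) by simp
  then show ?thesis
    using v_mult[of "- 1" x] x Fr(2,3) False by simp
qed simp

lemma vball_mult: "x \<in> F \<Longrightarrow> y \<in> F \<Longrightarrow> x \<in> vball v m \<Longrightarrow> y \<in> vball v n \<Longrightarrow> x * y \<in> vball v (m + n)"
  using v_mult[of x y] by (auto simp: vball_def)

lemma vball_add: "x \<in> F \<Longrightarrow> y \<in> F \<Longrightarrow> x \<in> vball v m \<Longrightarrow> y \<in> vball v m \<Longrightarrow> x + y \<in> vball v m"
  using v_add[of x y] by (cases "x = 0 \<or> y = 0 \<or> x + y = 0") (auto simp: vball_def)

lemma vball_uminus: "x \<in> F \<Longrightarrow> x \<in> vball v m \<Longrightarrow> - x \<in> vball v m"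
  using v_uminus[of x] by (auto simp: vball_def)

lemma vball_sum:
  "(\<And>i. i \<in> X \<Longrightarrow> f i \<in> F \<inter> vball v m) \<Longrightarrow> sum f X \<in> F \<inter> vball v m"
  by (induction X rule: infinite_finite_induct) (use Fr vball_add in auto)

text \<open>
  The Gauss valuation of a nonzero polynomial: the least value of a nonzero coefficient.
\<close>

definition gauss :: "'a poly \<Rightarrow> int" where
  "gauss p = Min ((\<lambda>i. v (Polynomial.coeff p i)) ` {i. Polynomial.coeff p i \<noteq> 0})"

lemma
  assumes "p \<noteq> 0"
  shows gauss_le: "Polynomial.coeff p i \<in> vball v (gauss p)"
    and gauss_attained: "\<exists>i. Polynomial.coeff p i \<noteq> 0 \<and> v (Polynomial.coeff p i) = gauss p"
proof -
  let ?M = "(\<lambda>i. v (Polynomial.coeff p i)) ` {i. Polynomial.coeff p i \<noteq> 0}"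
  have "finite {i. Polynomial.coeff p i \<noteq> 0}"
    using MOST_coeff_eq_0[of p] by (simp add: MOST_iff_cofinite)
  then have fin: "finite ?M"
    by simp
  show "Polynomial.coeff p i \<in> vball v (gauss p)"
    unfolding vball_def gauss_def using fin by (auto intro!: Min_le)
  have "lead_coeff p \<noteq> 0"
    using assms by simp
  then have "?M \<noteq> {}"
    by blast
  then have "gauss p \<in> ?M"
    unfolding gauss_def by (rule Min_in[OF fin])
  then show "\<exists>i. Polynomial.coeff p i \<noteq> 0 \<and> v (Polynomial.coeff p i) = gauss p"
    by auto
qed

lemma gauss_geI:
  assumes "p \<noteq> 0" "\<And>i. Polynomial.coeff p i \<in> vball v m"
  shows "m \<le> gauss p"
proof -
  obtain i where "Polynomial.coeff p i \<noteq> 0" "v (Polynomial.coeff p i) = gauss p"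
    using gauss_attained[OF assms(1)] by blast
  then show ?thesis
    using assms(2)[of i] by (simp add: vball_def)
qed

lemma gauss_const: "c \<noteq> 0 \<Longrightarrow> gauss [:c:] = v c"
proof -
  assume "c \<noteq> 0"
  then have "{i. Polynomial.coeff [:c:] i \<noteq> 0} = {0}"
    by (auto simp flip: monom_0)
  then show ?thesis
    by (simp add: gauss_def)
qed

lemma gauss_add:
  assumes "p \<in> polys_over F" "q \<in> polys_over F" "p \<noteq> 0" "q \<noteq> 0" "p + q \<noteq> 0"
  shows "min (gauss p) (gauss q) \<le> gauss (p + q)"
proof (rule gauss_geI[OF assms(5)])
  fix i
  show "Polynomial.coeff (p + q) i \<in> vball v (min (gauss p) (gauss q))"
    using assms(1,2) gauss_le[OF assms(3), of i] gauss_le[OF assms(4), of i]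
      vball_antimono[of "min (gauss p) (gauss q)" "gauss p" v]
      vball_antimono[of "min (gauss p) (gauss q)" "gauss q" v]
    by (auto simp: polys_over_def intro!: vball_add)
qed

text \<open>
  Gauss's lemma: where the first coefficients of minimal value of \<open>p\<close> and \<open>q\<close> meet, the coefficient
  of \<open>p q\<close> has exactly the sum of the two values, since all other terms have larger value.
\<close>

lemma gauss_mult:
  assumes p: "p \<in> polys_over F" "p \<noteq> 0" and q: "q \<in> polys_over F" "q \<noteq> 0"
  shows "gauss (p * q) = gauss p + gauss q"
proof (rule antisym)
  let ?a = "Polynomial.coeff p" and ?b = "Polynomial.coeff q"
  have F: "?a i \<in> F" "?b i \<in> F" for i
    using p q by (auto simp: polys_over_def)
  have pq: "p * q \<noteq> 0"
    using p q by simp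
  show "gauss p + gauss q \<le> gauss (p * q)"
  proof (rule gauss_geI[OF pq])
    fix n
    show "Polynomial.coeff (p * q) n \<in> vball v (gauss p + gauss q)"
      unfolding coeff_mult
      using vball_sum[of "{..n}" "\<lambda>i. ?a i * ?b (n - i)" "gauss p + gauss q"]
        vball_mult F gauss_le p(2) q(2) Fr(6) by blast
  qed
  define i where "i = (LEAST i. ?a i \<noteq> 0 \<and> v (?a i) = gauss p)"
  define j where "j = (LEAST j. ?b j \<noteq> 0 \<and> v (?b j) = gauss q)"
  have i: "?a i \<noteq> 0" "v (?a i) = gauss p"
    using LeastI_ex[OF gauss_attained[OF p(2)]] by (simp_all add: i_def)
  have j: "?b j \<noteq> 0" "v (?b j) = gauss q"
    using LeastI_ex[OF gauss_attained[OF q(2)]] by (simp_all add: j_def)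
  have lti: "?a l \<in> vball v (gauss p + 1)" if "l < i" for l
    using not_less_Least[OF that[unfolded i_def]] gauss_le[OF p(2), of l] by (auto simp: vball_def)
  have ltj: "?b l \<in> vball v (gauss q + 1)" if "l < j" for l
    using not_less_Least[OF that[unfolded j_def]] gauss_le[OF q(2), of l] by (auto simp: vball_def)
  have "?a l * ?b (i + j - l) \<in> F \<inter> vball v (gauss p + gauss q + 1)" if l: "l \<in> {..i + j} - {i}" for l
  proof (cases "l < i")
    case True
    then show ?thesis
      using vball_mult[OF F lti[OF True] gauss_le[OF q(2)]] F Fr(6) by (simp add: ac_simps)
  next
    case False
    then have "i + j - l < j"
      using l by auto
    then show ?thesis
      using vball_mult[OF F gauss_le[OF p(2)] ltj] F Fr(6) by (simp add: ac_simps)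
  qed
  then have rest: "(\<Sum>l\<in>{..i + j} - {i}. ?a l * ?b (i + j - l)) \<in> F \<inter> vball v (gauss p + gauss q + 1)"
    by (rule vball_sum)
  have split: "Polynomial.coeff (p * q) (i + j) =
      ?a i * ?b j + (\<Sum>l\<in>{..i + j} - {i}. ?a l * ?b (i + j - l))"
    unfolding coeff_mult by (subst sum.remove[of _ i]) auto
  have ab: "v (?a i * ?b j) = gauss p + gauss q" "?a i * ?b j \<noteq> 0" "?a i * ?b j \<in> F"
    using v_mult[OF F i(1) j(1)] i j F Fr(6) by auto
  have "Polynomial.coeff (p * q) (i + j) \<notin> vball v (gauss p + gauss q + 1)"
  proof
    assume "Polynomial.coeff (p * q) (i + j) \<in> vball v (gauss p + gauss q + 1)"
    moreover have "Polynomial.coeff (p * q) (i + j) \<in> F"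
      using split ab rest Fr(4) by simp
    ultimately have "Polynomial.coeff (p * q) (i + j)
        + - (\<Sum>l\<in>{..i + j} - {i}. ?a l * ?b (i + j - l)) \<in> vball v (gauss p + gauss q + 1)"
      using rest Fr(3) by (intro vball_add vball_uminus) auto
    then have "?a i * ?b j \<in> vball v (gauss p + gauss q + 1)"
      unfolding split by simp
    then show False
      using ab by (simp add: vball_def)
  qed
  then show "gauss (p * q) \<le> gauss p + gauss q"
    using gauss_le[OF pq, of "i + j"] by (auto simp: vball_def)
qed

end

definition transcendental_over :: "'a::field set \<Rightarrow> 'a \<Rightarrow> bool" where
  "transcendental_over F w \<longleftrightarrow> (\<forall>p\<in>polys_over F. poly p w = 0 \<longrightarrow> p = 0)"

lemma is_subfield_frac_field:
  assumes A: "is_subring A"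
  shows "is_subfield (frac_field A)"
proof (rule is_subfieldI)
  note Ar = is_subringD[OF A]
  show "is_subring (frac_field A)"
  proof (rule is_subringI)
    show "1 \<in> frac_field A"
      using Ar(2) unfolding frac_field_def by (intro CollectI exI[of _ 1]) simp
    fix x assume "x \<in> frac_field A"
    then obtain a b where x: "x = a / b" "a \<in> A" "b \<in> A" "b \<noteq> 0"
      by (auto simp: frac_field_def)
    have "- x = (- a) / b"
      using x by simp
    then show "- x \<in> frac_field A"
      using x Ar(3) unfolding frac_field_def by blast
    fix y assume "y \<in> frac_field A"
    then obtain c d where y: "y = c / d" "c \<in> A" "d \<in> A" "d \<noteq> 0"
      by (auto simp: frac_field_def)
    have bd: "b * d \<in> A" "b * d \<noteq> 0"
      using x y Ar(6) by auto
    have "x * y = (a * c) / (b * d)" "x + y = (a * d + c * b) / (b * d)"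
      using x y by (simp_all add: add_frac_eq)
    then show "x * y \<in> frac_field A" "x + y \<in> frac_field A"
      using bd x y Ar(4,6) unfolding frac_field_def by blast+
  qed
  fix x assume "x \<in> frac_field A" "x \<noteq> 0"
  then obtain a b where x: "x = a / b" "a \<in> A" "b \<in> A" "b \<noteq> 0"
    by (auto simp: frac_field_def)
  then have "inverse x = b / a" "a \<noteq> 0"
    using \<open>x \<noteq> 0\<close> by auto
  then show "inverse x \<in> frac_field A"
    using x unfolding frac_field_def by blast
qed

definition rational_functions :: "'a::field set \<Rightarrow> 'a \<Rightarrow> 'a set" where
  "rational_functions F w = frac_field ((\<lambda>p. poly p w) ` polys_over F)"

context valued_field
begin

text \<open>
  All representations of \<open>z\<close> as a quotient give the same difference, by Gauss's lemma.
\<close>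

definition gauss_extension :: "'a \<Rightarrow> 'a \<Rightarrow> int" where
  "gauss_extension w z = (SOME n. \<exists>p\<in>polys_over F. \<exists>q\<in>polys_over F.
     p \<noteq> 0 \<and> q \<noteq> 0 \<and> z = poly p w / poly q w \<and> n = gauss p - gauss q)"

context
  fixes w assumes w: "transcendental_over F w"
begin

lemmas Pr = is_subringD[OF is_subring_polys_over[OF is_subfieldD(1)[OF F]]]

lemma poly_nonzero: "p \<in> polys_over F \<Longrightarrow> p \<noteq> 0 \<Longrightarrow> poly p w \<noteq> 0"
  using w by (auto simp: transcendental_over_def)

lemma rational_functionsE:
  assumes "z \<in> rational_functions F w" "z \<noteq> 0"
  obtains p q where "p \<in> polys_over F" "q \<in> polys_over F" "p \<noteq> 0" "q \<noteq> 0" "z = poly p w / poly q w"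
  using assms unfolding rational_functions_def frac_field_def by (auto; metis div_0 poly_0)

lemma gauss_extension_eq:
  assumes "p \<in> polys_over F" "q \<in> polys_over F" "p \<noteq> 0" "q \<noteq> 0"
  shows "gauss_extension w (poly p w / poly q w) = gauss p - gauss q"
  unfolding gauss_extension_def
proof (rule some_equality)
  show "\<exists>p'\<in>polys_over F. \<exists>q'\<in>polys_over F. p' \<noteq> 0 \<and> q' \<noteq> 0 \<and>
      poly p w / poly q w = poly p' w / poly q' w \<and> gauss p - gauss q = gauss p' - gauss q'"
    using assms by blast
  fix n assume "\<exists>p'\<in>polys_over F. \<exists>q'\<in>polys_over F. p' \<noteq> 0 \<and> q' \<noteq> 0 \<and>
      poly p w / poly q w = poly p' w / poly q' w \<and> n = gauss p' - gauss q'"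
  then obtain p' q' where pq': "p' \<in> polys_over F" "q' \<in> polys_over F" "p' \<noteq> 0" "q' \<noteq> 0"
    "poly p w / poly q w = poly p' w / poly q' w" "n = gauss p' - gauss q'"
    by blast
  have "poly (p * q' - p' * q) w = 0"
    using pq'(5) poly_nonzero[OF assms(2,4)] poly_nonzero[OF pq'(2,4)] by (simp add: frac_eq_eq)
  moreover have "p * q' - p' * q \<in> polys_over F"
    using Pr(5,6) assms pq' by blast
  ultimately have "p * q' = p' * q"
    using poly_nonzero by fastforce
  then have "gauss p + gauss q' = gauss p' + gauss q"
    using gauss_mult assms pq'(1-4) by metis
  then show "n = gauss p - gauss q"
    using pq'(6) by simp
qed

lemma gauss_extension_extends:
  assumes "c \<in> F" "c \<noteq> 0"
  shows "gauss_extension w c = v c"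
proof -
  have "[:c:] \<in> polys_over F" "[:1:] \<in> polys_over F"
    using const_in_polys_over[OF is_subfieldD(1)[OF F]] assms Fr(2) by auto
  then show ?thesis
    using gauss_extension_eq[of "[:c:]" "[:1:]"] assms gauss_const[of c] gauss_const[of 1] v_one by simp
qed

lemma generator_in: "w \<in> rational_functions F w" and gauss_extension_generator: "gauss_extension w w = 0"
proof -
  let ?X = "Polynomial.monom 1 1 :: 'a poly"
  have X: "?X \<in> polys_over F" "[:1:] \<in> polys_over F"
    using monom_in_polys_over[of F] const_in_polys_over[of F] is_subfieldD(1)[OF F] Fr(2) by auto
  have "poly [:1:] w \<noteq> 0"
    by simp
  then have "poly ?X w / poly [:1:] w \<in> rational_functions F w"
    using X unfolding rational_functions_def frac_field_def by blast
  then show "w \<in> rational_functions F w"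
    by (simp add: poly_monom)
  have "{i. Polynomial.coeff ?X i \<noteq> 0} = {1}"
    by auto
  then have "gauss ?X = 0"
    using v_one by (simp add: gauss_def)
  moreover have "?X \<noteq> 0"
    by (simp add: monom_eq_0_iff)
  ultimately show "gauss_extension w w = 0"
    using gauss_extension_eq[OF X] gauss_const[of 1] v_one by (simp add: poly_monom)
qed

lemma valuation_on_gauss_extension: "valuation_on (rational_functions F w) (gauss_extension w)"
  unfolding valuation_on_def
proof (intro ballI impI, elim conjE)
  fix y z assume yz: "y \<in> rational_functions F w" "z \<in> rational_functions F w" "y \<noteq> 0" "z \<noteq> 0"
  obtain p q where y: "p \<in> polys_over F" "q \<in> polys_over F" "p \<noteq> 0" "q \<noteq> 0" "y = poly p w / poly q w"
    by (rule rational_functionsE[OF yz(1,3)])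
  obtain r s where z: "r \<in> polys_over F" "s \<in> polys_over F" "r \<noteq> 0" "s \<noteq> 0" "z = poly r w / poly s w"
    by (rule rational_functionsE[OF yz(2,4)])
  have nz: "poly q w \<noteq> 0" "poly s w \<noteq> 0"
    using poly_nonzero y z by auto
  have qs: "q * s \<in> polys_over F" "q * s \<noteq> 0" "gauss (q * s) = gauss q + gauss s"
    using y z Pr(6) gauss_mult[of q s] by auto
  have "y * z = poly (p * r) w / poly (q * s) w"
    using y z by simp
  then have "gauss_extension w (y * z) = gauss_extension w y + gauss_extension w z"
    using gauss_extension_eq[of "p * r" "q * s"] gauss_extension_eq[of p q] gauss_extension_eq[of r s]
      y z qs Pr(6) gauss_mult[of p r] by simp
  moreover have "min (gauss_extension w y) (gauss_extension w z) \<le> gauss_extension w (y + z)"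
    if "y + z \<noteq> 0"
  proof -
    have sum: "y + z = poly (p * s + r * q) w / poly (q * s) w"
      using y z nz by (simp add: add_frac_eq)
    have ps: "p * s \<in> polys_over F" "r * q \<in> polys_over F" "p * s \<noteq> 0" "r * q \<noteq> 0"
      "gauss (p * s) = gauss p + gauss s" "gauss (r * q) = gauss r + gauss q"
      using y z Pr(6) gauss_mult by auto
    have "p * s + r * q \<noteq> 0"
    proof
      assume "p * s + r * q = 0"
      then show False
        using sum that by simp
    qed
    then show ?thesis
      using gauss_add[OF ps(1-4)] gauss_extension_eq[of "p * s + r * q" "q * s"]
        gauss_extension_eq[of p q] gauss_extension_eq[of r s] sum y z ps qs Pr(4) by auto
  qed
  ultimately show "gauss_extension w (y * z) = gauss_extension w y + gauss_extension w z \<and>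
      (y + z \<noteq> 0 \<longrightarrow> min (gauss_extension w y) (gauss_extension w z) \<le> gauss_extension w (y + z))"
    by simp
qed

end

end

text \<open>
  The finiteness condition is the one that holds for the orders of vanishing along the points of
  codimension one: a nonzero element has only finitely many zeros and poles.
\<close>

definition valuation_family :: "'a::field set \<Rightarrow> 'x set \<Rightarrow> ('x \<Rightarrow> 'a \<Rightarrow> int) \<Rightarrow> bool" where
  "valuation_family F I v \<longleftrightarrow> (\<forall>x\<in>I. valuation_on F (v x)) \<and>
     (\<forall>z\<in>F. z \<noteq> 0 \<longrightarrow> finite {x\<in>I. v x z \<noteq> 0})"

text \<open>
  Finiteness is inherited because the Gauss valuation of \<open>z = p(w) / q(w)\<close> vanishes as soon as all nonzero
  coefficients of \<open>p\<close> and \<open>q\<close> have value \<open>0\<close>.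
\<close>

lemma valuation_family_gauss_extension:
  assumes F: "is_subfield F" and fam: "valuation_family F I v" and w: "transcendental_over F w"
  shows "valuation_family (rational_functions F w) I (\<lambda>x. valued_field.gauss_extension F (v x) w)"
  unfolding valuation_family_def
proof (intro conjI ballI impI)
  have vf: "valued_field F (v x)" if "x \<in> I" for x
    using F fam that by (auto simp: valuation_family_def intro: valued_field.intro)
  show "valuation_on (rational_functions F w) (valued_field.gauss_extension F (v x) w)" if "x \<in> I" for x
    by (rule valued_field.valuation_on_gauss_extension[OF vf[OF that] w])
  fix z assume z: "z \<in> rational_functions F w" "z \<noteq> 0"
  show "finite {x \<in> I. valued_field.gauss_extension F (v x) w z \<noteq> 0}"
  proof (cases "I = {}")
    case False
    then obtain x0 where "x0 \<in> I"
      by auto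
    from valued_field.rational_functionsE[OF vf[OF this] w z]
    obtain p q where pq: "p \<in> polys_over F" "q \<in> polys_over F" "p \<noteq> 0" "q \<noteq> 0" "z = poly p w / poly q w" .
    define C where "C = range (Polynomial.coeff p) \<union> range (Polynomial.coeff q) - {0}"
    have "C \<subseteq> F"
      using pq(1,2) by (auto simp: C_def polys_over_def)
    have "finite C"
      unfolding C_def range_coeff by simp
    have gauss0: "valued_field.gauss (v x) r = 0"
      if x: "x \<in> I" and r: "r \<noteq> 0" "\<forall>i. Polynomial.coeff r i \<noteq> 0 \<longrightarrow> v x (Polynomial.coeff r i) = 0" for x r
      using valued_field.gauss_attained[OF vf[OF x] r(1)] r(2) by auto
    have inC: "Polynomial.coeff r i \<in> C" if "r = p \<or> r = q" "Polynomial.coeff r i \<noteq> 0" for r i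
      using that by (auto simp: C_def)
    have "{x \<in> I. valued_field.gauss_extension F (v x) w z \<noteq> 0} \<subseteq> (\<Union>c\<in>C. {x \<in> I. v x c \<noteq> 0})"
    proof (rule subsetI, rule ccontr)
      fix x assume "x \<in> {x \<in> I. valued_field.gauss_extension F (v x) w z \<noteq> 0}"
        and no: "x \<notin> (\<Union>c\<in>C. {x \<in> I. v x c \<noteq> 0})"
      then have x: "x \<in> I" "valued_field.gauss_extension F (v x) w z \<noteq> 0"
        by auto
      have "valued_field.gauss (v x) p = 0" "valued_field.gauss (v x) q = 0"
        using gauss0[OF x(1)] pq(3,4) inC no x(1) by blast+
      then show False
        using valued_field.gauss_extension_eq[OF vf[OF x(1)] w pq(1-4)] pq(5) x(2) by simp
    qed
    moreover have "finite (\<Union>c\<in>C. {x \<in> I. v x c \<noteq> 0})"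
      using fam \<open>C \<subseteq> F\<close> \<open>finite C\<close> by (auto simp: valuation_family_def C_def)
    ultimately show ?thesis
      by (rule finite_subset)
  qed simp
qed

section \<open>Bounding a family of valuations on a finitely generated extension\<close>

definition lspan :: "'a::field set \<Rightarrow> 'a set \<Rightarrow> 'a set" where
  "lspan F E = {\<Sum>e\<in>E. z e * e |z. \<forall>e\<in>E. z e \<in> F}"

definition linearly_independent :: "'a::field set \<Rightarrow> 'a set \<Rightarrow> bool" where
  "linearly_independent F E \<longleftrightarrow>
     (\<forall>z. (\<forall>e\<in>E. z e \<in> F) \<and> (\<Sum>e\<in>E. z e * e) = 0 \<longrightarrow> (\<forall>e\<in>E. z e = 0))"

context
  fixes F :: "'a::field set"
  assumes F: "is_subfield F"
begin

lemmas Fr = is_subringD[OF is_subfieldD(1)[OF F]]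

lemma lspan_zero: "0 \<in> lspan F E"
  unfolding lspan_def using Fr(1) by (intro CollectI exI[of _ "\<lambda>_. 0"]) auto

lemma lspan_add:
  assumes "x \<in> lspan F E" "y \<in> lspan F E"
  shows "x + y \<in> lspan F E"
proof -
  obtain z where z: "x = (\<Sum>e\<in>E. z e * e)" "\<forall>e\<in>E. z e \<in> F"
    using assms(1) by (auto simp: lspan_def)
  obtain z' where z': "y = (\<Sum>e\<in>E. z' e * e)" "\<forall>e\<in>E. z' e \<in> F"
    using assms(2) by (auto simp: lspan_def)
  have "x + y = (\<Sum>e\<in>E. (z e + z' e) * e)" "\<forall>e\<in>E. z e + z' e \<in> F"
    using z z' Fr(4) by (auto simp: sum.distrib distrib_right)
  then show ?thesis
    unfolding lspan_def by (intro CollectI exI[of _ "\<lambda>e. z e + z' e"] conjI)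
qed

lemma lspan_scale:
  assumes "a \<in> F" "x \<in> lspan F E"
  shows "a * x \<in> lspan F E"
proof -
  obtain z where z: "x = (\<Sum>e\<in>E. z e * e)" "\<forall>e\<in>E. z e \<in> F"
    using assms(2) by (auto simp: lspan_def)
  have "a * x = (\<Sum>e\<in>E. (a * z e) * e)" "\<forall>e\<in>E. a * z e \<in> F"
    using z assms(1) Fr(6) by (auto simp: sum_distrib_left mult.assoc)
  then show ?thesis
    unfolding lspan_def by (intro CollectI exI[of _ "\<lambda>e. a * z e"] conjI)
qed

lemma lspan_base:
  assumes "finite E" "e \<in> E"
  shows "e \<in> lspan F E"
proof -
  have "e = (\<Sum>e'\<in>E. (if e' = e then 1 else 0) * e')"
    using assms by (simp add: if_distrib[of "\<lambda>c. c * _"] cong: if_cong)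
  moreover have "\<forall>e'\<in>E. (if e' = e then 1 else 0) \<in> F"
    using Fr(1,2) by simp
  ultimately show ?thesis
    unfolding lspan_def by (intro CollectI exI[of _ "\<lambda>e'. if e' = e then 1 else 0"] conjI)
qed

lemma lspan_sum: "(\<And>i. i \<in> X \<Longrightarrow> f i \<in> lspan F E) \<Longrightarrow> sum f X \<in> lspan F E"
  by (induction X rule: infinite_finite_induct) (auto intro: lspan_zero lspan_add)

lemma lspan_mono:
  assumes "E \<subseteq> lspan F E'"
  shows "lspan F E \<subseteq> lspan F E'"
proof
  fix x assume "x \<in> lspan F E"
  then obtain z where z: "x = (\<Sum>e\<in>E. z e * e)" "\<forall>e\<in>E. z e \<in> F"
    by (auto simp: lspan_def)
  show "x \<in> lspan F E'"
    unfolding z(1) using z(2) assms by (intro lspan_sum lspan_scale) auto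
qed

lemma algebraic_top_power:
  assumes "\<not> transcendental_over F w"
  shows "\<exists>d q. 0 < d \<and> (\<forall>i. q i \<in> F) \<and> w ^ d = (\<Sum>i<d. q i * w ^ i)"
proof -
  obtain p where p: "p \<in> polys_over F" "p \<noteq> 0" "poly p w = 0"
    using assms by (auto simp: transcendental_over_def)
  let ?d = "degree p" and ?c = "lead_coeff p"
  have c: "?c \<noteq> 0"
    using p(2) by simp
  have d: "0 < ?d"
  proof (rule ccontr)
    assume "\<not> 0 < ?d"
    then obtain a where "p = [:a:]"
      using degree_eq_zeroE[of p] by auto
    then show False
      using p(2,3) by simp
  qed
  have "(\<Sum>i<?d. Polynomial.coeff p i * w ^ i) + ?c * w ^ ?d = 0"
    using p(3) unfolding poly_altdef by (simp add: lessThan_Suc_atMost[symmetric])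
  then have "w ^ ?d = - (\<Sum>i<?d. Polynomial.coeff p i * w ^ i) / ?c"
    using c by (simp add: field_simps eq_neg_iff_add_eq_0)
  also have "\<dots> = (\<Sum>i<?d. (- Polynomial.coeff p i / ?c) * w ^ i)"
    by (simp add: sum_negf[symmetric] sum_divide_distrib)
  finally show ?thesis
    using p(1) Fr(3) is_subfieldD(3)[OF F] d unfolding polys_over_def
    by (intro exI[of _ ?d] exI[of _ "\<lambda>i. - Polynomial.coeff p i / ?c"]) auto
qed

text \<open>
  If \<open>w\<^sup>d\<close> is a combination of lower powers of \<open>w\<close>, then a stable generating set for the other
  elements only has to be multiplied by \<open>1, w, \<dots>, w\<^bsup>d-1\<^esup>\<close>.
\<close>

lemma algebraic_stable_generators:
  assumes "finite Ws" "\<And>w. w \<in> Ws \<Longrightarrow> \<not> transcendental_over F w"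
  shows "\<exists>E. finite E \<and> 1 \<in> E \<and> (\<forall>w\<in>Ws. \<forall>e\<in>E. w * e \<in> lspan F E)"
  using assms
proof (induction Ws rule: finite_induct)
  case empty
  show ?case
    by (intro exI[of _ "{1}"]) simp
next
  case (insert w Ws)
  then obtain E0 where E0: "finite E0" "1 \<in> E0" "\<forall>w\<in>Ws. \<forall>e\<in>E0. w * e \<in> lspan F E0"
    by auto
  obtain d q where d: "0 < d" "\<forall>i. q i \<in> F" "w ^ d = (\<Sum>i<d. q i * w ^ i)"
    using algebraic_top_power insert.prems by blast
  define E where "E = (\<lambda>(e, j). e * w ^ j) ` (E0 \<times> {..<d})"
  have fin: "finite E"
    using E0(1) by (simp add: E_def)
  have mem: "e * w ^ j \<in> lspan F E" if "e \<in> E0" "j < d" for e j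
    using that by (intro lspan_base fin) (auto simp: E_def)
  have shift: "x * w ^ j \<in> lspan F E" if x: "x \<in> lspan F E0" and j: "j < d" for x j
  proof -
    obtain z where z: "x = (\<Sum>e\<in>E0. z e * e)" "\<forall>e\<in>E0. z e \<in> F"
      using x by (auto simp: lspan_def)
    have "x * w ^ j = (\<Sum>e\<in>E0. z e * (e * w ^ j))"
      unfolding z(1) by (simp add: sum_distrib_right mult.assoc)
    also have "\<dots> \<in> lspan F E"
      using z(2) mem j by (intro lspan_sum; intro lspan_scale[of "z _"]; simp)
    finally show ?thesis .
  qed
  have "1 \<in> E"
    using E0(2) d(1) by (auto simp: E_def intro!: image_eqI[of _ _ "(1, 0)"])
  moreover have "w' * (e * w ^ j) \<in> lspan F E" if "w' \<in> insert w Ws" "e \<in> E0" "j < d" for w' e j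
  proof (cases "w' = w")
    case False
    then show ?thesis
      using shift[of "w' * e" j] E0(3) that by (simp add: mult.assoc)
  next
    case w': True
    show ?thesis
    proof (cases "Suc j < d")
      case True
      then show ?thesis
        using mem[OF that(2) True] w' by (simp add: ac_simps)
    next
      case False
      then have "Suc j = d"
        using that(3) by simp
      then have "w' * (e * w ^ j) = e * w ^ d"
        using w' by auto
      also have "\<dots> = (\<Sum>i<d. q i * (e * w ^ i))"
        unfolding d(3) by (simp add: sum_distrib_left ac_simps)
      also have "\<dots> \<in> lspan F E"
        using d(2) mem that(2) by (intro lspan_sum; intro lspan_scale[of "q _"]; simp)
      finally show ?thesis .
    qed
  qed
  ultimately show ?case
    using fin by (intro exI[of _ E]) (auto simp: E_def)
qed

text \<open>
  A generating set of minimal size among those containing \<open>1\<close> is linearly independent: an element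
  other than \<open>1\<close> that occurs in a relation could be dropped.
\<close>

lemma exists_independent_generators:
  assumes "finite E0" "1 \<in> E0"
  shows "\<exists>E\<subseteq>E0. 1 \<in> E \<and> E0 \<subseteq> lspan F E \<and> linearly_independent F E"
proof -
  let ?P = "\<lambda>E. E \<subseteq> E0 \<and> 1 \<in> E \<and> E0 \<subseteq> lspan F E"
  have "?P E0"
    using assms lspan_base by auto
  then obtain E where E: "?P E" and min: "\<And>E'. ?P E' \<Longrightarrow> card E \<le> card E'"
    using ex_has_least_nat[of ?P E0 card] by blast
  have fin: "finite E"
    using E assms(1) finite_subset by blast
  have "linearly_independent F E"
    unfolding linearly_independent_def
  proof (rule allI, rule impI, elim conjE)
    fix z assume z: "\<forall>e\<in>E. z e \<in> F" "(\<Sum>e\<in>E. z e * e) = 0"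
    have others: "z e = 0" if e: "e \<in> E" "e \<noteq> 1" for e
    proof (rule ccontr)
      assume ze: "z e \<noteq> 0"
      have "z e * e + (\<Sum>e'\<in>E - {e}. z e' * e') = 0"
        using z(2) sum.remove[OF fin e(1), of "\<lambda>e. z e * e"] by simp
      then have "e = (- 1 / z e) * (\<Sum>e'\<in>E - {e}. z e' * e')"
        using ze by (simp add: field_simps eq_neg_iff_add_eq_0)
      moreover have "- 1 / z e \<in> F"
        using is_subfieldD(3)[OF F] Fr(2,3) z(1) e(1) by blast
      moreover have "(\<Sum>e'\<in>E - {e}. z e' * e') \<in> lspan F (E - {e})"
        unfolding lspan_def using z(1) by blast
      ultimately have "e \<in> lspan F (E - {e})"
        using lspan_scale by metis
      then have "E \<subseteq> lspan F (E - {e})"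
        using lspan_base[of "E - {e}"] fin by auto
      then have "?P (E - {e})"
        using E e(2) lspan_mono[of E "E - {e}"] by blast
      then have "card E \<le> card (E - {e})"
        by (rule min)
      then show False
        using card_Diff1_less[OF fin e(1)] by simp
    qed
    have "(\<Sum>e\<in>E. z e * e) = (\<Sum>e\<in>{1}. z e * e)"
      using E others fin by (intro sum.mono_neutral_right) auto
    then have "z 1 = 0"
      using z(2) by simp
    then show "\<forall>e\<in>E. z e = 0"
      using others by metis
  qed
  then show ?thesis
    using E by blast
qed

end

text \<open>
  A decreasing filtration \<open>L\<close> by subgroups of the ambient field that induces on \<open>F\<close> the filtration by
  the values of \<open>v\<close>, and whose index drops by at most \<open>c\<close> under multiplication by an element of \<open>Ws\<close>.
  It replaces an extension of \<open>v\<close> to the field generated by \<open>Ws\<close>: it need not be multiplicative, and for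
  this reason it is easy to construct.
\<close>

definition filtration ::
    "'a::field set \<Rightarrow> ('a \<Rightarrow> int) \<Rightarrow> 'a set \<Rightarrow> nat \<Rightarrow> (int \<Rightarrow> 'a set) \<Rightarrow> bool" where
  "filtration F v Ws c L \<longleftrightarrow>
     1 \<in> L 0 \<and>
     (\<forall>m. \<forall>y\<in>L m. \<forall>z\<in>L m. y + z \<in> L m) \<and>
     (\<forall>m j. \<forall>f\<in>F \<inter> vball v j. \<forall>z\<in>L m. f * z \<in> L (m + j)) \<and>
     (\<forall>w\<in>Ws. \<forall>m. \<forall>z\<in>L m. w * z \<in> L (m - int c)) \<and>
     (\<forall>m. F \<inter> L m \<subseteq> vball v m)"

text \<open>
  Over a valued field \<open>F\<close>, an independent set \<open>E\<close> containing \<open>1\<close> whose span is stable under \<open>Ws\<close> gives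
  the lattices \<open>L m\<close> of all combinations with coefficients of value at least \<open>m\<close>.  Since \<open>1 \<in> E\<close>, an
  element \<open>f\<close> of \<open>F\<close> is its own coefficient at \<open>1\<close>.  The entries of the matrices of \<open>Ws\<close> on \<open>E\<close> have
  value at least \<open>- c\<close> for \<open>c\<close> the sum of the orders of their poles.  These are finitely many elements of
  \<open>F\<close>, so \<open>c\<close> vanishes for almost all members of the family.
\<close>

lemma filtration_algebraic:
  fixes F :: "'a::field set" and v :: "'x \<Rightarrow> 'a \<Rightarrow> int"
  assumes F: "is_subfield F" and fam: "valuation_family F I v" and fin: "finite Ws"
    and alg: "\<And>w. w \<in> Ws \<Longrightarrow> \<not> transcendental_over F w"
  shows "\<exists>c L. finite {x \<in> I. c x \<noteq> 0} \<and> (\<forall>x\<in>I. filtration F (v x) Ws (c x) (L x))"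
proof -
  note Fr = is_subringD[OF is_subfieldD(1)[OF F]]
  obtain E0 where E0: "finite E0" "1 \<in> E0" "\<forall>w\<in>Ws. \<forall>e\<in>E0. w * e \<in> lspan F E0"
    using algebraic_stable_generators[OF F fin alg] by blast
  obtain E where E: "E \<subseteq> E0" "1 \<in> E" "E0 \<subseteq> lspan F E" and ind: "linearly_independent F E"
    using exists_independent_generators[OF F E0(1,2)] by blast
  have finE: "finite E"
    using E(1) E0(1) finite_subset by blast
  have "\<forall>w\<in>Ws. \<forall>e\<in>E. \<exists>M. (\<forall>e'\<in>E. M e' \<in> F) \<and> w * e = (\<Sum>e'\<in>E. M e' * e')"
  proof (intro ballI)
    fix w e assume "w \<in> Ws" "e \<in> E"
    then have "w * e \<in> lspan F E"
      using E0(3) E(1) lspan_mono[OF F E(3)] by blast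
    then show "\<exists>M. (\<forall>e'\<in>E. M e' \<in> F) \<and> w * e = (\<Sum>e'\<in>E. M e' * e')"
      by (auto simp: lspan_def)
  qed
  then obtain M where M: "\<And>w e e'. w \<in> Ws \<Longrightarrow> e \<in> E \<Longrightarrow> e' \<in> E \<Longrightarrow> M w e e' \<in> F"
      "\<And>w e. w \<in> Ws \<Longrightarrow> e \<in> E \<Longrightarrow> w * e = (\<Sum>e'\<in>E. M w e e' * e')"
    by metis
  \<comment> \<open>The nonzero entries of the matrices.\<close>
  define N where "N = (\<lambda>(w, e, e'). M w e e') ` (Ws \<times> E \<times> E) - {0}"
  have finN: "finite N" and NF: "N \<subseteq> F"
    using fin finE M(1) by (auto simp: N_def)
  define c where "c x = (\<Sum>a\<in>N. nat (- v x a))" for x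
  define L where "L x m = {\<Sum>e\<in>E. z e * e |z. \<forall>e\<in>E. z e \<in> F \<inter> vball (v x) m}" for x m
  have LI: "(\<Sum>e\<in>E. z e * e) \<in> L x m" if "\<And>e. e \<in> E \<Longrightarrow> z e \<in> F \<inter> vball (v x) m" for z x m
    unfolding L_def using that by blast
  have LE: "\<exists>z. y = (\<Sum>e\<in>E. z e * e) \<and> (\<forall>e\<in>E. z e \<in> F \<inter> vball (v x) m)" if "y \<in> L x m" for x y m
    using that unfolding L_def by blast
  have "{x \<in> I. c x \<noteq> 0} \<subseteq> (\<Union>a\<in>N. {x \<in> I. v x a \<noteq> 0})"
  proof (rule subsetI, rule ccontr)
    fix x assume x: "x \<in> {x \<in> I. c x \<noteq> 0}" "x \<notin> (\<Union>a\<in>N. {x \<in> I. v x a \<noteq> 0})"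
    then have "c x = 0"
      unfolding c_def by (intro sum.neutral) auto
    then show False
      using x(1) by simp
  qed
  moreover have "finite (\<Union>a\<in>N. {x \<in> I. v x a \<noteq> 0})"
  proof (rule finite_UN_I[OF finN])
    fix a assume "a \<in> N"
    then have "a \<in> F" "a \<noteq> 0"
      using NF by (blast, simp add: N_def)
    then show "finite {x \<in> I. v x a \<noteq> 0}"
      using fam by (simp add: valuation_family_def)
  qed
  ultimately have "finite {x \<in> I. c x \<noteq> 0}"
    by (rule finite_subset)
  moreover have "filtration F (v x) Ws (c x) (L x)" if "x \<in> I" for x
  proof -
    interpret valued_field F "v x"
      using F fam that by (auto simp: valuation_family_def intro: valued_field.intro)
    have single: "f = (\<Sum>e\<in>E. (if e = 1 then f else 0) * e)" for f
      using E(2) finE by (simp add: if_distrib[of "\<lambda>c. c * _"] cong: if_cong)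
    have one: "1 \<in> L x 0"
      by (subst single, rule LI) (use Fr(1,2) v_one in \<open>auto simp: vball_def\<close>)
    have add: "y + y' \<in> L x m" if y: "y \<in> L x m" "y' \<in> L x m" for y y' m
    proof -
      obtain z z' where z: "y = (\<Sum>e\<in>E. z e * e)" "\<forall>e\<in>E. z e \<in> F \<inter> vball (v x) m"
        and z': "y' = (\<Sum>e\<in>E. z' e * e)" "\<forall>e\<in>E. z' e \<in> F \<inter> vball (v x) m"
        using LE[OF y(1)] LE[OF y(2)] by blast
      have "y + y' = (\<Sum>e\<in>E. (z e + z' e) * e)"
        by (simp add: z z' sum.distrib distrib_right)
      also have "\<dots> \<in> L x m"
        using z(2) z'(2) Fr(4) vball_add by (intro LI) auto
      finally show ?thesis .
    qed
    have scale: "f * y \<in> L x (m + j)" if f: "f \<in> F \<inter> vball (v x) j" and y: "y \<in> L x m" for f y m j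
    proof -
      obtain z where z: "y = (\<Sum>e\<in>E. z e * e)" "\<forall>e\<in>E. z e \<in> F \<inter> vball (v x) m"
        using LE[OF y] by blast
      have "f * y = (\<Sum>e\<in>E. (z e * f) * e)"
        by (simp add: z(1) sum_distrib_left ac_simps)
      also have "\<dots> \<in> L x (m + j)"
        using z(2) f Fr(6) vball_mult by (intro LI) auto
      finally show ?thesis .
    qed
    have entry: "M w e e' \<in> F \<inter> vball (v x) (- int (c x))" if "w \<in> Ws" "e \<in> E" "e' \<in> E" for w e e'
    proof (cases "M w e e' = 0")
      case False
      then have "M w e e' \<in> N"
        using that by (auto simp: N_def intro!: image_eqI[of _ _ "(w, e, e')"])
      then have "nat (- v x (M w e e')) \<le> c x"
        unfolding c_def by (intro member_le_sum finN) auto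
      then show ?thesis
        using M(1) that by (auto simp: vball_def)
    qed (use Fr(1) in simp)
    have mult: "w * y \<in> L x (m - int (c x))" if w: "w \<in> Ws" and y: "y \<in> L x m" for w y m
    proof -
      obtain z where z: "y = (\<Sum>e\<in>E. z e * e)" "\<forall>e\<in>E. z e \<in> F \<inter> vball (v x) m"
        using LE[OF y] by blast
      have "w * y = (\<Sum>e\<in>E. z e * (w * e))"
        by (simp add: z(1) sum_distrib_left ac_simps)
      also have "\<dots> = (\<Sum>e\<in>E. \<Sum>e'\<in>E. (z e * M w e e') * e')"
        using M(2)[OF w] by (intro sum.cong refl) (simp add: sum_distrib_left mult.assoc)
      also have "\<dots> = (\<Sum>e'\<in>E. (\<Sum>e\<in>E. z e * M w e e') * e')"
        by (subst sum.swap) (simp add: sum_distrib_right)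
      also have "\<dots> \<in> L x (m - int (c x))"
      proof (rule LI, rule vball_sum)
        fix e e' assume ee: "e' \<in> E" "e \<in> E"
        show "z e * M w e e' \<in> F \<inter> vball (v x) (m - int (c x))"
          using vball_mult[of "z e" "M w e e'" m "- int (c x)"] Fr(6) z(2) entry[OF w ee(2,1)] ee(2) by auto
      qed
      finally show ?thesis .
    qed
    have "f \<in> vball (v x) m" if f: "f \<in> F" "f \<in> L x m" for f m
    proof -
      obtain z where z: "f = (\<Sum>e\<in>E. z e * e)" "\<forall>e\<in>E. z e \<in> F \<inter> vball (v x) m"
        using LE[OF f(2)] by blast
      have "(\<Sum>e\<in>E. (z e - (if e = 1 then f else 0)) * e) = 0"
        using z(1) single[of f] by (simp add: left_diff_distrib sum_subtractf)
      moreover have "\<forall>e\<in>E. z e - (if e = 1 then f else 0) \<in> F"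
        using z(2) f(1) Fr(1,5) by auto
      ultimately have "\<forall>e\<in>E. z e - (if e = 1 then f else 0) = 0"
        using spec[OF ind[unfolded linearly_independent_def], of "\<lambda>e. z e - (if e = 1 then f else 0)"]
        by blast
      then have "z 1 = f"
        using E(2) by (auto dest: bspec[of _ _ 1])
      then show ?thesis
        using z(2) E(2) by auto
    qed
    then show ?thesis
      unfolding filtration_def using one add scale mult by blast
  qed
  ultimately show ?thesis
    by blast
qed

text \<open>
  A generator that is transcendental over \<open>F\<close> is absorbed into \<open>F\<close> by Gauss extension, where it has value
  \<open>0\<close>.  When no generator is transcendental any more, the algebraic case applies.
\<close>

lemma filtration_exists:
  fixes F :: "'a::field set" and v :: "'x \<Rightarrow> 'a \<Rightarrow> int"
  assumes "is_subfield F" "valuation_family F I v" "finite Ws"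
  shows "\<exists>c L. finite {x \<in> I. c x \<noteq> 0} \<and> (\<forall>x\<in>I. filtration F (v x) Ws (c x) (L x))"
  using assms
proof (induction "card Ws" arbitrary: F v Ws rule: less_induct)
  case less
  note F = less.prems(1) and fam = less.prems(2) and fin = less.prems(3)
  show ?case
  proof (cases "\<exists>w\<in>Ws. transcendental_over F w")
    case False
    then show ?thesis
      using filtration_algebraic[OF F fam fin] by blast
  next
    case True
    then obtain w where w: "w \<in> Ws" "transcendental_over F w"
      by blast
    let ?F' = "rational_functions F w"
    define v' where "v' x = valued_field.gauss_extension F (v x) w" for x
    have F': "is_subfield ?F'"
      unfolding rational_functions_def
      by (intro is_subfield_frac_field is_subring_poly_image is_subfieldD(1)[OF F])
    have fam': "valuation_family ?F' I v'"
      unfolding v'_def by (rule valuation_family_gauss_extension[OF F fam w(2)])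
    have "card (Ws - {w}) < card Ws"
      by (rule card_Diff1_less[OF fin w(1)])
    then obtain c L where c: "finite {x \<in> I. c x \<noteq> 0}"
      and L: "\<And>x. x \<in> I \<Longrightarrow> filtration ?F' (v' x) (Ws - {w}) (c x) (L x)"
      using less.hyps[of "Ws - {w}" ?F' v'] F' fam' fin by blast
    have "filtration F (v x) Ws (c x) (L x)" if x: "x \<in> I" for x
    proof -
      interpret valued_field F "v x"
        using F fam x by (auto simp: valuation_family_def intro: valued_field.intro)
      have L': "1 \<in> L x 0" "\<And>m y z. y \<in> L x m \<Longrightarrow> z \<in> L x m \<Longrightarrow> y + z \<in> L x m"
        "\<And>m j f z. f \<in> ?F' \<Longrightarrow> f \<in> vball (v' x) j \<Longrightarrow> z \<in> L x m \<Longrightarrow> f * z \<in> L x (m + j)"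
        "\<And>w' m z. w' \<in> Ws - {w} \<Longrightarrow> z \<in> L x m \<Longrightarrow> w' * z \<in> L x (m - int (c x))"
        "\<And>m f. f \<in> ?F' \<Longrightarrow> f \<in> L x m \<Longrightarrow> f \<in> vball (v' x) m"
        using L[OF x] unfolding filtration_def by blast+
      have sub: "F \<subseteq> ?F'"
      proof
        fix f assume f: "f \<in> F"
        have "[:f:] \<in> polys_over F" "[:1:] \<in> polys_over F"
          using const_in_polys_over[OF is_subfieldD(1)[OF F]] f Fr(2) by auto
        moreover have "f = poly [:f:] w / poly [:1:] w" "poly [:1:] w \<noteq> 0"
          by simp_all
        ultimately show "f \<in> ?F'"
          unfolding rational_functions_def frac_field_def by blast
      qed
      have ball: "f \<in> vball (v' x) m \<longleftrightarrow> f \<in> vball (v x) m" if "f \<in> F" for f m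
        using gauss_extension_extends[OF w(2) that] by (cases "f = 0") (auto simp: vball_def v'_def)
      have mult: "w' * z \<in> L x (m - int (c x))" if "w' \<in> Ws" and z: "z \<in> L x m" for w' m z
      proof (cases "w' = w")
        case True
        have "w \<in> vball (v' x) (- int (c x))"
          using gauss_extension_generator[OF w(2)] by (simp add: vball_def v'_def)
        then show ?thesis
          using L'(3)[OF generator_in[OF w(2)] _ z] True by fastforce
      qed (use L'(4) that in blast)
      show ?thesis
        unfolding filtration_def
      proof (intro conjI allI ballI)
        show "f * z \<in> L x (m + j)" if "f \<in> F \<inter> vball (v x) j" "z \<in> L x m" for m j f z
          using L'(3)[of f j z m] ball sub that by blast
        show "F \<inter> L x m \<subseteq> vball (v x) m" for m
          using L'(5) ball sub by blast
      qed (use L'(1,2) mult in blast)+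
    qed
    then show ?thesis
      using c by blast
  qed
qed

text \<open>
  The valuations of \<open>F\<close> bound the elements of \<open>F\<close> in a graded linear series: in the filtration above,
  multiplication by an element of degree \<open>n\<close> lowers the index by at most \<open>n c\<close>.
\<close>

lemma (in standard_graded) valuations_linearly_bounded:
  fixes E :: "'a set" and v :: "'x \<Rightarrow> 'a \<Rightarrow> int"
  assumes E: "is_subfield E" "k \<subseteq> E" and fam: "valuation_family E I v"
    and trivial: "\<And>x a. x \<in> I \<Longrightarrow> a \<in> k \<Longrightarrow> a \<noteq> 0 \<Longrightarrow> v x a = 0"
  shows "\<exists>c :: 'x \<Rightarrow> nat. finite {x \<in> I. c x \<noteq> 0} \<and>
    (\<forall>x\<in>I. \<forall>n f. f \<in> E \<and> Polynomial.monom f n \<in> S \<and> f \<noteq> 0 \<longrightarrow> - int (n * c x) \<le> v x f)"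
proof -
  obtain c L where c: "finite {x \<in> I. c x \<noteq> 0}"
    and L: "\<And>x. x \<in> I \<Longrightarrow> filtration E (v x) T (c x) (L x)"
    using filtration_exists[OF E(1) fam T(2)] by blast
  have "- int (n * c x) \<le> v x f"
    if x: "x \<in> I" and f: "f \<in> E" "Polynomial.monom f n \<in> S" "f \<noteq> 0" for x n f
  proof -
    have L': "1 \<in> L x 0" "\<And>m y z. y \<in> L x m \<Longrightarrow> z \<in> L x m \<Longrightarrow> y + z \<in> L x m"
        "\<And>m j f z. f \<in> E \<Longrightarrow> f \<in> vball (v x) j \<Longrightarrow> z \<in> L x m \<Longrightarrow> f * z \<in> L x (m + j)"
        "\<And>t m z. t \<in> T \<Longrightarrow> z \<in> L x m \<Longrightarrow> t * z \<in> L x (m - int (c x))"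
        "\<And>m f. f \<in> E \<Longrightarrow> f \<in> L x m \<Longrightarrow> f \<in> vball (v x) m"
      using L[OF x] unfolding filtration_def by blast+
    have kscale: "a * z \<in> L x m" if "a \<in> k" "z \<in> L x m" for a z m
    proof -
      have "a \<in> vball (v x) 0"
        using trivial[OF x that(1)] by (cases "a = 0") (simp_all add: vball_def)
      then show ?thesis
        using L'(3)[of a 0 z m] E(2) that by auto
    qed
    have kr: "0 \<in> k" "- 1 \<in> k"
      using is_subringD(1,2,3)[OF is_subfieldD(1)[OF k]] by auto
    have zero: "0 \<in> L x m" for m
      using L'(3)[of 0 m 1 0] L'(1) E(2) kr(1) by auto
    have sum: "sum g X \<in> L x m" if "\<And>i. i \<in> X \<Longrightarrow> g i \<in> L x m" for g m and X :: "'i set"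
      using that by (induction X rule: infinite_finite_induct) (use zero L'(2) in auto)
    have "\<forall>n m. \<forall>z\<in>L x m. Polynomial.coeff p n * z \<in> L x (m - int (n * c x))" if "p \<in> S" for p
      using that
    proof (induction rule: S_induct)
      case one
      then show ?case
        using zero by (simp add: coeff_1)
    next
      case (const a)
      then show ?case
        using zero kscale by simp
    next
      case (linear a)
      then obtain b where b: "\<forall>t\<in>T. b t \<in> k" "a = (\<Sum>t\<in>T. b t * t)"
        using T(3) by blast
      have "a * z \<in> L x (m - int (c x))" if z: "z \<in> L x m" for m z
      proof -
        have "a * z = (\<Sum>t\<in>T. b t * (t * z))"
          by (simp add: b(2) sum_distrib_right mult.assoc)
        also have "\<dots> \<in> L x (m - int (c x))"
        proof (rule sum)
          show "b t * (t * z) \<in> L x (m - int (c x))" if "t \<in> T" for t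
            using kscale L'(4) b(1) that z by blast
        qed
        finally show ?thesis .
      qed
      then show ?case
        using zero by simp
    next
      case (uminus p)
      have "- y \<in> L x m" if "y \<in> L x m" for y m
        using kscale[OF kr(2) that] by simp
      then show ?case
        using uminus by simp
    next
      case (add p q)
      then show ?case
        using L'(2) by (simp add: distrib_right)
    next
      case (mult p q)
      show ?case
      proof (intro allI ballI)
        fix n m z assume z: "z \<in> L x m"
        have "Polynomial.coeff (p * q) n * z =
            (\<Sum>i\<le>n. Polynomial.coeff p i * (Polynomial.coeff q (n - i) * z))"
          by (simp add: coeff_mult sum_distrib_right mult.assoc)
        also have "\<dots> \<in> L x (m - int (n * c x))"
        proof (rule sum)
          fix i assume i: "i \<in> {..n}"
          have "m - int ((n - i) * c x) - int (i * c x) = m - int (n * c x)"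
            using i by (simp add: of_nat_diff algebra_simps)
          then show "Polynomial.coeff p i * (Polynomial.coeff q (n - i) * z) \<in> L x (m - int (n * c x))"
            using mult(3,4) z by metis
        qed
        finally show "Polynomial.coeff (p * q) n * z \<in> L x (m - int (n * c x))" .
      qed
    qed
    from this[OF f(2), THEN spec, THEN spec, THEN bspec, OF L'(1), of n]
    have "f \<in> vball (v x) (- int (n * c x))"
      using L'(5)[OF f(1)] by simp
    then show ?thesis
      using f(3) by (simp add: vball_def)
  qed
  then show ?thesis
    using c by blast
qed

section \<open>The divisor\<close>

lemma ring_hom_ring_onD:
  fixes f :: "'a::comm_ring_1 \<Rightarrow> 'b::comm_ring_1"
  assumes f: "f \<in> ring_hom (ring_on A) (ring_on B)" and A: "is_subring A"
  shows "x \<in> A \<Longrightarrow> f x \<in> B" "x \<in> A \<Longrightarrow> y \<in> A \<Longrightarrow> f (x * y) = f x * f y"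
    "x \<in> A \<Longrightarrow> y \<in> A \<Longrightarrow> f (x + y) = f x + f y" "f 1 = 1" "f 0 = 0"
    "x \<in> A \<Longrightarrow> f (- x) = - f x"
proof -
  show "x \<in> A \<Longrightarrow> f x \<in> B"
    using ring_hom_closed[OF f, of x] by simp
  show "x \<in> A \<Longrightarrow> y \<in> A \<Longrightarrow> f (x * y) = f x * f y"
    using ring_hom_mult[OF f, of x y] by simp
  show add: "x \<in> A \<Longrightarrow> y \<in> A \<Longrightarrow> f (x + y) = f x + f y" for x y
    using ring_hom_add[OF f, of x y] by simp
  show "f 1 = 1"
    using ring_hom_one[OF f] by simp
  show zero: "f 0 = 0"
    using add[of 0 0] is_subringD(1)[OF A] by simp
  show "f (- x) = - f x" if "x \<in> A"
    using add[of x "- x"] zero that is_subringD(3)[OF A that] by (simp add: eq_neg_iff_add_eq_0 add.commute)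
qed

lemma is_subfield_image:
  fixes f :: "'a::field \<Rightarrow> 'b::field"
  assumes f: "f \<in> ring_hom (ring_on k) (ring_on B)" and k: "is_subfield k"
  shows "is_subfield (f ` k)"
proof -
  note kr = is_subfieldD(1)[OF k]
  note kc = is_subringD[OF kr]
  note fr = ring_hom_ring_onD[OF f kr]
  show ?thesis
  proof (rule is_subfieldI)
    show "is_subring (f ` k)"
    proof (rule is_subringI)
      show "1 \<in> f ` k"
        using fr(4) kc(2) by (metis imageI)
      show "- x \<in> f ` k" if "x \<in> f ` k" for x
        using that fr(6) kc(3) by (auto simp flip: fr(6))
      show "x * y \<in> f ` k" if "x \<in> f ` k" "y \<in> f ` k" for x y
        using that kc(6) by (auto simp flip: fr(2))
      show "x + y \<in> f ` k" if "x \<in> f ` k" "y \<in> f ` k" for x y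
        using that kc(4) by (auto simp flip: fr(3))
    qed
    fix y assume "y \<in> f ` k" "y \<noteq> 0"
    then obtain c where c: "c \<in> k" "y = f c"
      by auto
    then have "c \<noteq> 0"
      using \<open>y \<noteq> 0\<close> fr(5) by auto
    then have "f c * f (inverse c) = 1"
      using fr(2)[of c "inverse c"] fr(4) c(1) is_subfieldD(2)[OF k] by simp
    then have "inverse y = f (inverse c)"
      using c(2) inverse_unique by blast
    then show "inverse y \<in> f ` k"
      using c(1) is_subfieldD(2)[OF k] by blast
  qed
qed

theorem theorem1p4:
  fixes K K' k :: "'a::field set"
    and W :: "'a poly set"
    and X :: "('x, 'b::field) ratspace"
    and \<sigma> :: "'a \<Rightarrow> 'b"
    and \<iota> :: "'b \<Rightarrow> 'a"
  assumes "fg_field_extension k K'"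
    and "fg_field_extension K' K"
    and "graded_linear_series K k W"
    and "generated_in_degree_one k W"
    and "1 \<in> graded_piece W 1"
    and "normal_scheme (Proj W)"
    and "integral_scheme X"
    and "normal_scheme X"
    and "\<sigma> \<in> ring_hom (ring_on k) (ring_on (sections X (points X)))"
    and "projective_over (\<sigma> ` k) X"
    and "\<iota> \<in> ring_iso (ring_on (rat_field X)) (ring_on (series_field k (W \<inter> polys_over K')))"
    and "\<forall>c\<in>k. \<iota> (\<sigma> c) = c"
  shows "\<exists>D \<in> Q_Weil_divisors X.
           \<forall>\<^sub>F n in sequentially.
             graded_piece W n \<inter> K' \<subseteq> \<iota> ` H0 X (\<lambda>x. of_nat n * D x) \<and>
             \<iota> ` H0 X (\<lambda>x. of_nat n * D x) \<subseteq> series_field k (W \<inter> polys_over K')"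
proof -
  define E where "E = series_field k (W \<inter> polys_over K')"
  have k: "is_subfield k" and K': "is_subfield K'" and K: "is_subfield K"
    using assms(1,2) by (auto simp: fg_field_extension_def)
  interpret W: standard_graded K k W
    by (rule standard_graded.intro[OF K k assms(3,4)])
  have \<sigma>k: "is_subfield (\<sigma> ` k)"
    by (rule is_subfield_image[OF assms(9) k])
  \<comment> \<open>A homogeneous coordinate ring of \<open>X\<close>.\<close>
  obtain S h where "graded_linear_series (rat_field X) (\<sigma> ` k) S"
    "generated_in_degree_one (\<sigma> ` k) S" "iso_over_rat_field X (Proj S) h"
    using assms(10) by (auto simp: projective_over_def)
  then interpret X: normal_projective X "\<sigma> ` k" S h
    using assms(7,8) \<sigma>k by (intro normal_projective.intro)
  have E: "is_subfield E"
    unfolding E_def series_field_def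
    by (rule field.generate_field_is_subfield[OF field_from_type_algebra]) auto
  have kE: "k \<subseteq> E"
    unfolding E_def series_field_def by (auto intro: generate_field.incl)
  \<comment> \<open>Since \<open>1 \<in> W\<^sub>n\<close>, every \<open>f \<in> W\<^sub>n \<inter> K'\<close> is a quotient of two elements of this space.\<close>
  have one_piece: "1 \<in> graded_piece (W \<inter> polys_over K') n" for n
    using W.monom_power_in[of 1 n] assms(5) is_subringD(2)[OF is_subfieldD(1)[OF K']]
      monom_in_polys_over[OF is_subfieldD(1)[OF K'], of 1 n] by (simp add: graded_piece_def)
  have piece_E: "f \<in> E" if f: "f \<in> graded_piece W n \<inter> K'" and n: "n \<ge> 1" for f n
  proof (cases "f = 0")
    case False
    have "f \<in> graded_piece (W \<inter> polys_over K') n"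
      using f monom_in_polys_over[OF is_subfieldD(1)[OF K'], of f n] by (simp add: graded_piece_def)
    then have "f / 1 \<in> {f / g |f g n. n \<ge> 1 \<and> f \<in> graded_piece (W \<inter> polys_over K') n \<and>
        g \<in> graded_piece (W \<inter> polys_over K') n \<and> f \<noteq> 0 \<and> g \<noteq> 0}"
      by (intro CollectI exI[of _ f] exI[of _ 1] exI[of _ n] conjI refl n one_piece False one_neq_zero)
    then show ?thesis
      unfolding E_def series_field_def by (intro generate_field.incl) simp
  qed (use is_subringD(1)[OF is_subfieldD(1)[OF E]] in simp)
  have \<iota>: "\<iota> \<in> ring_hom (ring_on (rat_field X)) (ring_on E)" and bij: "bij_betw \<iota> (rat_field X) E"
    using assms(11) by (auto simp: ring_iso_def E_def)
  note Xr = is_subringD[OF is_subfieldD(1)[OF X.F]]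
  note \<iota>r = ring_hom_ring_onD[OF \<iota> is_subfieldD(1)[OF X.F]]
  define \<tau> where "\<tau> = inv_into (rat_field X) \<iota>"
  have \<tau>: "\<tau> f \<in> rat_field X" "\<iota> (\<tau> f) = f" if "f \<in> E" for f
    using that bij by (auto simp: \<tau>_def bij_betw_def inv_into_into f_inv_into_f)
  have \<tau>_eq: "\<tau> f = \<phi>" if "\<phi> \<in> rat_field X" "\<iota> \<phi> = f" for f \<phi>
    using that bij by (auto simp: \<tau>_def bij_betw_def)
  have \<tau>_nz: "\<tau> f \<noteq> 0" if "f \<in> E" "f \<noteq> 0" for f
    using \<tau>[OF that(1)] that(2) \<iota>r(5) by auto
  have \<tau>_hom: "\<tau> (f * g) = \<tau> f * \<tau> g" "\<tau> (f + g) = \<tau> f + \<tau> g" if "f \<in> E" "g \<in> E" for f g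
    using \<tau>[OF that(1)] \<tau>[OF that(2)] \<iota>r(2,3) Xr(4,6) by (auto intro!: \<tau>_eq)
  \<comment> \<open>The orders of vanishing on \<open>X\<close>, transported to the subfield \<open>E\<close> of \<open>K\<close>.\<close>
  define v where "v x f = dvr_ord (stalk X x) (\<tau> f)" for x f
  have fam: "valuation_family E (codim1_points X) v"
    unfolding valuation_family_def
  proof (intro conjI ballI impI)
    fix x assume x: "x \<in> codim1_points X"
    note val = X.valuation_ord[OF x, unfolded valuation_on_def]
    show "valuation_on E (v x)"
      unfolding valuation_on_def v_def
    proof (intro ballI impI, elim conjE)
      fix f g assume fg: "f \<in> E" "g \<in> E" "f \<noteq> 0" "g \<noteq> 0"
      have "f + g \<in> E"
        using fg is_subringD(4)[OF is_subfieldD(1)[OF E]] by blast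
      then have "f + g \<noteq> 0 \<Longrightarrow> \<tau> f + \<tau> g \<noteq> 0"
        using \<tau>_nz[of "f + g"] \<tau>_hom(2)[OF fg(1,2)] by simp
      then show "dvr_ord (stalk X x) (\<tau> (f * g)) = dvr_ord (stalk X x) (\<tau> f) + dvr_ord (stalk X x) (\<tau> g) \<and>
          (f + g \<noteq> 0 \<longrightarrow> min (dvr_ord (stalk X x) (\<tau> f)) (dvr_ord (stalk X x) (\<tau> g))
            \<le> dvr_ord (stalk X x) (\<tau> (f + g)))"
        using val \<tau>(1) \<tau>_nz fg \<tau>_hom[OF fg(1,2)] by simp
    qed
  next
    fix f assume f: "f \<in> E" "f \<noteq> 0"
    show "finite {x \<in> codim1_points X. v x f \<noteq> 0}"
      unfolding v_def by (rule X.finite_zeros_poles[OF \<tau>(1)[OF f(1)] \<tau>_nz[OF f]])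
  qed
  have "v x c = 0" if x: "x \<in> codim1_points X" and c: "c \<in> k" "c \<noteq> 0" for x c
  proof -
    have "\<tau> c = \<sigma> c"
      using c(1) assms(12) X.k_subset_F by (intro \<tau>_eq) auto
    then show ?thesis
      using X.ord_constant_zero[OF x, of "\<sigma> c"] c \<tau>_nz[of c] kE by (auto simp: v_def)
  qed
  then obtain c :: "'x \<Rightarrow> nat" where c: "finite {x \<in> codim1_points X. c x \<noteq> 0}"
    "\<forall>x\<in>codim1_points X. \<forall>n f. f \<in> E \<and> Polynomial.monom f n \<in> W \<and> f \<noteq> 0 \<longrightarrow> - int (n * c x) \<le> v x f"
    using W.valuations_linearly_bounded[OF E kE fam] by blast
  \<comment> \<open>The bound per degree is the coefficient, so that \<open>n D\<close> dominates the poles in degree \<open>n\<close>.\<close>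
  define D :: "'x \<Rightarrow> rat" where "D x = (if x \<in> codim1_points X then of_nat (c x) else 0)" for x
  have "{x. D x \<noteq> 0} = {x \<in> codim1_points X. c x \<noteq> 0}"
    by (auto simp: D_def)
  then have D: "D \<in> Q_Weil_divisors X"
    using c(1) by (auto simp: Q_Weil_divisors_def)
  have sections: "graded_piece W n \<inter> K' \<subseteq> \<iota> ` H0 X (\<lambda>x. of_nat n * D x)" if n: "n \<ge> 1" for n
  proof
    fix f assume f: "f \<in> graded_piece W n \<inter> K'"
    note fE = piece_E[OF f n]
    show "f \<in> \<iota> ` H0 X (\<lambda>x. of_nat n * D x)"
    proof (cases "f = 0")
      case True
      then show ?thesis
        using \<iota>r(5) by (auto simp: H0_def intro!: image_eqI[of _ _ 0])
    next
      case False
      have "0 \<le> of_nat n * D x + principal_divisor X (\<tau> f) x" if x: "x \<in> codim1_points X" for x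
      proof -
        have "- int (n * c x) \<le> v x f"
          using c(2) x fE f False by (simp add: graded_piece_def)
        then have "0 \<le> int n * int (c x) + v x f"
          by simp
        then have "(0::rat) \<le> of_int (int n * int (c x) + v x f)"
          by (simp only: of_int_0_le_iff)
        then show ?thesis
          using x by (simp add: D_def principal_divisor_def v_def)
      qed
      then have "\<tau> f \<in> H0 X (\<lambda>x. of_nat n * D x)"
        using \<tau>(1)[OF fE] \<tau>_nz[OF fE False] by (simp add: H0_def effective_def)
      then show ?thesis
        using \<tau>(2)[OF fE] by (metis imageI)
    qed
  qed
  moreover have "\<iota> ` H0 X (\<lambda>x. of_nat n * D x) \<subseteq> E" for n
    using \<iota>r(1) Xr(1) by (auto simp: H0_def)
  ultimately have "\<forall>\<^sub>F n in sequentially.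
      graded_piece W n \<inter> K' \<subseteq> \<iota> ` H0 X (\<lambda>x. of_nat n * D x) \<and>
      \<iota> ` H0 X (\<lambda>x. of_nat n * D x) \<subseteq> E"
    by (intro eventually_sequentiallyI[of 1]) blast
  then show ?thesis
    using D unfolding E_def by blast
qed

end
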